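(* Let $T\subset\mathbb{R}$ be an infinite set algebraically independent over $\mathbb{Q}$, ordered by the usual ordering of $\mathbb{R}$, let $\mathcal{K}=\mathcal{N}^{\mathbb{R}}_{{\bf x}_0}$ be the corresponding field of real Nash functions with the ordering $f\succ0$ iff $f({\bf x}_0)>0$, let $g=(g_t\in\mathcal{K}:t\in T)$ be the family constructed in the context (for any choices made in that construction), and let $\delta_g(f)=\sum_{t\in T}g_t\frac{\partial f}{\partial\Lambda_t}$ for $f\in\mathcal{K}$. Then $(\mathcal{K},\delta_g)$ is an ordered differentially closed field.
   Context: **Ordered differentially closed fields.** For a field $R$ of characteristic zero with a derivation $\delta$, $R\{y\}=R[y_{\delta^0},y_\delta,y_{\delta^2},\ldots]$; $\operatorname{ord}p$ is the largest $n$ with $y_{\delta^n}$ occurring in $p$ ($-1$ if $p\in R$); $p^*\in R[x_0,\ldots,x_n]$ is the polynomial with $p=p^*(y_{\delta^0},\ldots,y_{\delta^n})$, so $p(a)=p^*(a,\delta(a),\ldots,\delta^n(a))$. A field $R$ with an ordering $\succ$ and a derivation $\delta$ is an ordered (ordinary) differentially closed field if $R$ is real closed and for any $p,q_1,\ldots,q_m\in R\{y\}$ with $n=\operatorname{ord}p\ge\operatorname{ord}q_i$, $1\le i\le m$, and any $a_0,\ldots,a_n\in R$ such that $p^*(a_0,\ldots,a_n)=0$, $\frac{\partial p^*}{\partial x_n}(a_0,\ldots,a_n)\ne0$ and $q_i^*(a_0,\ldots,a_n)\succ0$ for $1\le i\le m$ ($q_i^*$ viewed in $R[x_0,\ldots,x_n]$),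 there exists $a\in R$ with $p(a)=0$ and $q_i(a)\succ0$ for $1\le i\le m$. **The field $\mathcal{K}$.** $\Lambda_T=(\Lambda_t:t\in T)$ are independent variables, $\mathbb{R}^T$ has the product topology, and ${\bf x}_0\in\mathbb{R}^T$ is given by ${\bf x}_0(t)=t$. $\varOmega^{\mathbb{R}}_{{\bf x}_0}$ is the family of sets $U=\{x\in\mathbb{R}^T:|x(t_j)-\tilde x_j|<\varepsilon,\ j=1,\ldots,m\}$ for $t_1<\cdots<t_m$ in $T$, $\varepsilon\in\mathbb{Q}_+$, $\tilde x\in\mathbb{Q}^m$ with $|t_j-\tilde x_j|<\varepsilon$ for all $j$ (so ${\bf x}_0\in U$). For such $U$, $\mathcal{N}^{\mathbb{R}}(U)$ is the ring of $\mathbb{Q}$-Nash functions: real analytic $f:U\to\mathbb{R}$ with $P(\lambda,f(\lambda))=0$ on $U$ for some nonzero $P\in\mathbb{Q}[\Lambda_T,Z]$ (they depend on finitely many variables). $\mathcal{K}=\mathcal{N}^{\mathbb{R}}_{{\bf x}_0}$ is the field of classes of elements of $\bigcup_U\mathcal{N}^{\mathbb{R}}(U)$, functions being identified if they agree on some $U\in\varOmega^{\mathbb{R}}_{{\bf x}_0}$. It is known that $\mathcal{K}$ is real closed, is a real closure of $\mathbb{Q}(\Lambda_T)$, and that $f\mapsto f({\bf x}_0)$ is an order preserving embedding into $\mathbb{R}$ (so $\mathcal{K}$ is Archimedean). **Construction of $g$.** Let $\mathcal{K}[Y]=\mathcal{K}[Y_j:j\in\mathbb{N}]$, $0\in\mathbb{N}$.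 For $\mathcal{P}\in\mathcal{K}[Y]$ let $D(\mathcal{P})=\{t\in T:\frac{\partial\mathcal{P}}{\partial\Lambda_t}=0\}$ (derivative of the coefficients), which has finite complement in $T$; $\alpha(\mathcal{P})=\max\{j:\deg_{Y_j}\mathcal{P}>0\}$ if $\deg\mathcal{P}>0$, $\alpha(\mathcal{P})=-1$ if $\mathcal{P}\in\mathcal{K}\setminus\{0\}$, $\alpha(0)=-\infty$. Let $\mathcal{Z}$ be the set of all tuples $z=(\mathcal{P},\mathcal{Q}_1,\ldots,\mathcal{Q}_n,f_0,\ldots,f_k)$, $k,n\ge1$, with $\mathcal{P},\mathcal{Q}_s\in\mathcal{K}[Y]$, $f_j\in\mathcal{K}$, $k=\alpha(\mathcal{P})\ge\alpha(\mathcal{Q}_s)\ge-1$ for $1\le s\le n$, $\mathcal{P}(f_0,\ldots,f_k)=0$, $\frac{\partial\mathcal{P}}{\partial Y_k}(f_0,\ldots,f_k)\ne0$, and $\mathcal{Q}_s(f_0,\ldots,f_k)\succ0$ for $1\le s\le n$. $T$ and $\mathcal{Z}$ have the same cardinality, so one can fix a family of pairwise disjoint infinite countable sets $T_z\subset T$, $z\in\mathcal{Z}$, with union $T$. For each $z=(\mathcal{P},\mathcal{Q}_1,\ldots,\mathcal{Q}_n,f_0,\ldots,f_k)\in\mathcal{Z}$, where $k=\alpha(\mathcal{P})$, fix points $t_{z,0}<\cdots<t_{z,k-1}$ in $D(\mathcal{P})\cap D(\mathcal{Q}_1)\cap\cdots\cap D(\mathcal{Q}_n)\cap T_z$, numbers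 $r_{z,0},\ldots,r_{z,k-1}\in\mathbb{Q}\setminus\{0\}$ and $f_z\in\mathcal{K}$ such that $\mathcal{P}(r_{z,0}\Lambda_{t_{z,0}},\ldots,r_{z,k-1}\Lambda_{t_{z,k-1}},f_z)=0$ and $\mathcal{Q}_s(r_{z,0}\Lambda_{t_{z,0}},\ldots,r_{z,k-1}\Lambda_{t_{z,k-1}},f_z)\succ0$ for $1\le s\le n$ (such choices always exist). For $t\in T_z$ define: $g_t=\frac{r_{z,i+1}}{r_{z,i}}\Lambda_{t_{z,i+1}}$ if $t=t_{z,i}$, $0\le i\le k-2$; $g_t=\frac{1}{r_{z,k-1}}f_z$ if $t=t_{z,k-1}$; and $g_t=h_t$ with $h_t\in\mathcal{K}$ arbitrary for $t\in T_z\setminus\{t_{z,0},\ldots,t_{z,k-1}\}$. For each $f$ the sum defining $\delta_g(f)$ has finitely many nonzero terms, and $\delta_g$ is a derivation. *)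

theory Defs
  imports
    "HOL-Analysis.Analysis"
    "HOL-Library.Poly_Mapping"
    "HOL-Library.Extended_Real"
    "HOL-Computational_Algebra.Polynomial"
    "HOL-Algebra.Indexed_Polynomials"
begin

section \<open>Polynomials in countably many variables over a ring\<close>

text \<open>
  A polynomial is a function from monomials (finite multisets of variable indices) to coefficients,
  as in HOL-Algebra. The variables are indexed by the natural numbers; the same polynomials serve as
  R[Y_0, Y_1, ...] and, reading Y_j as the j-th derivative of y, as the differential polynomials
  R{y}. Under this reading p and p* are the same object.
\<close>

definition mpolys :: "('a, 'm) ring_scheme \<Rightarrow> (nat multiset \<Rightarrow> 'a) set"
  where "mpolys R = ring.indexed_pset R UNIV (carrier R)"

definition mpoly_eval ::
  "('a, 'm) ring_scheme \<Rightarrow> (nat multiset \<Rightarrow> 'a) \<Rightarrow> (nat \<Rightarrow> 'a) \<Rightarrow> 'a"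
  where "mpoly_eval R p a =
    (\<Oplus>\<^bsub>R\<^esub>m\<in>{m. p m \<noteq> \<zero>\<^bsub>R\<^esub>}. p m \<otimes>\<^bsub>R\<^esub> (\<Otimes>\<^bsub>R\<^esub>i\<in>set_mset m. a i [^]\<^bsub>R\<^esub> count m i))"

definition mpoly_deriv ::
  "('a, 'm) ring_scheme \<Rightarrow> nat \<Rightarrow> (nat multiset \<Rightarrow> 'a) \<Rightarrow> (nat multiset \<Rightarrow> 'a)"
  where "mpoly_deriv R k p = (\<lambda>m. [Suc (count m k)] \<cdot>\<^bsub>R\<^esub> p (add_mset k m))"

definition mpoly_vars :: "('a, 'm) ring_scheme \<Rightarrow> (nat multiset \<Rightarrow> 'a) \<Rightarrow> nat set"
  where "mpoly_vars R p = {i. \<not> ring.index_free R p i}"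

text \<open>The order of a differential polynomial; it is -1 for all constants, including zero.\<close>

definition mpoly_ord :: "('a, 'm) ring_scheme \<Rightarrow> (nat multiset \<Rightarrow> 'a) \<Rightarrow> int"
  where "mpoly_ord R p = (if mpoly_vars R p = {} then -1 else int (Max (mpoly_vars R p)))"

text \<open>The function \<open>\<alpha>\<close> differs from the order only at the zero polynomial.\<close>

definition mpoly_alpha :: "('a, 'm) ring_scheme \<Rightarrow> (nat multiset \<Rightarrow> 'a) \<Rightarrow> ereal"
  where "mpoly_alpha R p =
    (if \<forall>m. p m = \<zero>\<^bsub>R\<^esub> then - \<infinity> else ereal (real_of_int (mpoly_ord R p)))"


section \<open>Ordered differentially closed fields\<close>

text \<open>An ordering is given by its set P of strictly positive elements.\<close>

definition ordered_field :: "('a, 'm) ring_scheme \<Rightarrow> 'a set \<Rightarrow> bool"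
  where "ordered_field R P \<longleftrightarrow>
    field R \<and> P \<subseteq> carrier R \<and> \<zero>\<^bsub>R\<^esub> \<notin> P \<and>
    (\<forall>a\<in>carrier R. a = \<zero>\<^bsub>R\<^esub> \<or> a \<in> P \<or> \<ominus>\<^bsub>R\<^esub> a \<in> P) \<and>
    (\<forall>a\<in>P. \<forall>b\<in>P. a \<oplus>\<^bsub>R\<^esub> b \<in> P \<and> a \<otimes>\<^bsub>R\<^esub> b \<in> P)"

definition real_closed_field :: "('a, 'm) ring_scheme \<Rightarrow> 'a set \<Rightarrow> bool"
  where "real_closed_field R P \<longleftrightarrow>
    ordered_field R P \<and>
    (\<forall>a\<in>P. \<exists>b\<in>carrier R. b \<otimes>\<^bsub>R\<^esub> b = a) \<and>
    (\<forall>p\<in>carrier (univ_poly R (carrier R)). odd (Polynomials.degree p) \<longrightarrow>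
      (\<exists>a\<in>carrier R. ring.eval R p a = \<zero>\<^bsub>R\<^esub>))"

definition derivation :: "('a, 'm) ring_scheme \<Rightarrow> ('a \<Rightarrow> 'a) \<Rightarrow> bool"
  where "derivation R \<delta> \<longleftrightarrow>
    \<delta> \<in> carrier R \<rightarrow> carrier R \<and>
    (\<forall>a\<in>carrier R. \<forall>b\<in>carrier R. \<delta> (a \<oplus>\<^bsub>R\<^esub> b) = \<delta> a \<oplus>\<^bsub>R\<^esub> \<delta> b) \<and>
    (\<forall>a\<in>carrier R. \<forall>b\<in>carrier R.
      \<delta> (a \<otimes>\<^bsub>R\<^esub> b) = (\<delta> a \<otimes>\<^bsub>R\<^esub> b) \<oplus>\<^bsub>R\<^esub> (a \<otimes>\<^bsub>R\<^esub> \<delta> b))"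

definition diff_eval ::
  "('a, 'm) ring_scheme \<Rightarrow> ('a \<Rightarrow> 'a) \<Rightarrow> (nat multiset \<Rightarrow> 'a) \<Rightarrow> 'a \<Rightarrow> 'a"
  where "diff_eval R \<delta> p a = mpoly_eval R p (\<lambda>i. (\<delta> ^^ i) a)"

text \<open>
  The list \<open>xs\<close> is the point (a_0, ..., a_n) and \<open>qs\<close> is the list of the q_i. No entry of \<open>xs\<close>
  beyond the n-th is ever evaluated, since the order of every polynomial involved is at most n.
\<close>

definition ordered_diff_closed_field ::
  "('a, 'm) ring_scheme \<Rightarrow> 'a set \<Rightarrow> ('a \<Rightarrow> 'a) \<Rightarrow> bool"
  where "ordered_diff_closed_field R P \<delta> \<longleftrightarrow>
    real_closed_field R P \<and> derivation R \<delta> \<and>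
    (\<forall>p qs n xs.
      p \<in> mpolys R \<and> set qs \<subseteq> mpolys R \<and>
      mpoly_ord R p = int n \<and> (\<forall>q\<in>set qs. mpoly_ord R q \<le> int n) \<and>
      length xs = n + 1 \<and> set xs \<subseteq> carrier R \<and>
      mpoly_eval R p (nth xs) = \<zero>\<^bsub>R\<^esub> \<and>
      mpoly_eval R (mpoly_deriv R n p) (nth xs) \<noteq> \<zero>\<^bsub>R\<^esub> \<and>
      (\<forall>q\<in>set qs. mpoly_eval R q (nth xs) \<in> P)
      \<longrightarrow> (\<exists>a\<in>carrier R. diff_eval R \<delta> p a = \<zero>\<^bsub>R\<^esub> \<and> (\<forall>q\<in>set qs. diff_eval R \<delta> q a \<in> P)))"


section \<open>Rational polynomials in real-indexed variables\<close>

text \<open>The variables \<open>\<Lambda>\<^sub>t\<close> are indexed by real numbers; for a set T of reals, the polynomials all of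
  whose variables lie in T form Q[\<open>\<Lambda>\<^sub>T\<close>].\<close>

type_synonym rat_mpoly = "(real \<Rightarrow>\<^sub>0 nat) \<Rightarrow>\<^sub>0 rat"

definition rat_mpolys :: "real set \<Rightarrow> rat_mpoly set"
  where "rat_mpolys T = {p. \<forall>m\<in>Poly_Mapping.keys p. Poly_Mapping.keys m \<subseteq> T}"

definition rat_mpoly_eval :: "rat_mpoly \<Rightarrow> (real \<Rightarrow> real) \<Rightarrow> real"
  where "rat_mpoly_eval p x =
    (\<Sum>m\<in>Poly_Mapping.keys p. of_rat (Poly_Mapping.lookup p m) *
       (\<Prod>t\<in>Poly_Mapping.keys m. x t ^ Poly_Mapping.lookup m t))"

definition algebraically_independent :: "real set \<Rightarrow> bool"
  where "algebraically_independent T \<longleftrightarrow>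
    (\<forall>p\<in>rat_mpolys T. p \<noteq> 0 \<longrightarrow> rat_mpoly_eval p (\<lambda>t. t) \<noteq> 0)"


section \<open>The field of germs of Nash functions\<close>

text \<open>The space of all real-valued functions on T is \<open>T \<rightarrow>\<^sub>E UNIV\<close> (extensional functions).\<close>

definition base_point :: "real set \<Rightarrow> real \<Rightarrow> real"
  where "base_point T = (\<lambda>t\<in>T. t)"

definition basic_nhds :: "real set \<Rightarrow> (real \<Rightarrow> real) set set"
  where "basic_nhds T =
    {{x \<in> T \<rightarrow>\<^sub>E UNIV. \<forall>t\<in>S. \<bar>x t - of_rat (c t)\<bar> < of_rat \<epsilon>} | S c (\<epsilon>::rat).
       finite S \<and> S \<noteq> {} \<and> S \<subseteq> T \<and> \<epsilon> > 0 \<and> (\<forall>t\<in>S. \<bar>t - of_rat (c t)\<bar> < of_rat \<epsilon>)}"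

text \<open>
  Real analyticity on U in the variables from the finite set S: around every point of U, the function
  is the sum of a multiple power series in these variables. In particular, on U the function depends
  only on the variables from S: take x to agree with a on S.
\<close>

definition analytic_in_vars ::
  "real set \<Rightarrow> (real \<Rightarrow> real) set \<Rightarrow> ((real \<Rightarrow> real) \<Rightarrow> real) \<Rightarrow> bool"
  where "analytic_in_vars S U f \<longleftrightarrow>
    (\<forall>a\<in>U. \<exists>r>0. \<exists>c :: (real \<Rightarrow>\<^sub>0 nat) \<Rightarrow> real. \<forall>x\<in>U. (\<forall>s\<in>S. \<bar>x s - a s\<bar> < r) \<longrightarrow>
      ((\<lambda>m. c m * (\<Prod>s\<in>S. (x s - a s) ^ Poly_Mapping.lookup m s)) has_sum f x)
        {m. Poly_Mapping.keys m \<subseteq> S})"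

text \<open>
  The polynomial ring Q[\<open>\<Lambda>\<^sub>T\<close>, Z] is rendered as Q[\<open>\<Lambda>\<^sub>T\<close>][Z]. Functions on U are represented by total
  functions whose values outside U are irrelevant.
\<close>

definition nash_functions :: "real set \<Rightarrow> (real \<Rightarrow> real) set \<Rightarrow> ((real \<Rightarrow> real) \<Rightarrow> real) set"
  where "nash_functions T U =
    {f. (\<exists>S. finite S \<and> S \<subseteq> T \<and> analytic_in_vars S U f) \<and>
        (\<exists>p :: rat_mpoly poly. p \<noteq> 0 \<and> (\<forall>i. poly.coeff p i \<in> rat_mpolys T) \<and>
           (\<forall>x\<in>U. poly (map_poly (\<lambda>q. rat_mpoly_eval q x) p) (f x) = 0))}"

type_synonym germ = "((real \<Rightarrow> real) \<Rightarrow> real) set"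

definition germ_of :: "real set \<Rightarrow> ((real \<Rightarrow> real) \<Rightarrow> real) \<Rightarrow> germ"
  where "germ_of T f = {h. \<exists>U\<in>basic_nhds T. \<forall>x\<in>U. h x = f x}"

definition nash_field :: "real set \<Rightarrow> germ ring"
  where "nash_field T =
    \<lparr> carrier = {germ_of T f | f U. U \<in> basic_nhds T \<and> f \<in> nash_functions T U},
      monoid.mult = (\<lambda>a b. \<Union>f\<in>a. \<Union>h\<in>b. germ_of T (\<lambda>x. f x * h x)),
      one = germ_of T (\<lambda>_. 1),
      zero = germ_of T (\<lambda>_. 0),
      add = (\<lambda>a b. \<Union>f\<in>a. \<Union>h\<in>b. germ_of T (\<lambda>x. f x + h x)) \<rparr>"

definition nash_pos :: "real set \<Rightarrow> germ set"
  where "nash_pos T = {a \<in> carrier (nash_field T). \<exists>f\<in>a. f (base_point T) > 0}"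

definition nash_var :: "real set \<Rightarrow> real \<Rightarrow> germ"
  where "nash_var T t = germ_of T (\<lambda>x. x t)"

definition nash_const :: "real set \<Rightarrow> rat \<Rightarrow> germ"
  where "nash_const T c = germ_of T (\<lambda>_. of_rat c)"

definition nash_partial :: "real set \<Rightarrow> real \<Rightarrow> germ \<Rightarrow> germ"
  where "nash_partial T t a = (\<Union>f\<in>a. germ_of T (\<lambda>x. deriv (\<lambda>s. f (x(t := s))) (x t)))"

text \<open>The infinite sum is taken over the (finite) set of its nonzero terms.\<close>

definition nash_delta :: "real set \<Rightarrow> (real \<Rightarrow> germ) \<Rightarrow> germ \<Rightarrow> germ"
  where "nash_delta T g f =
    (\<Oplus>\<^bsub>nash_field T\<^esub>t\<in>{t\<in>T. g t \<otimes>\<^bsub>nash_field T\<^esub> nash_partial T t f \<noteq> \<zero>\<^bsub>nash_field T\<^esub>}.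
       g t \<otimes>\<^bsub>nash_field T\<^esub> nash_partial T t f)"


section \<open>The construction of the family g\<close>

definition const_params :: "real set \<Rightarrow> (nat multiset \<Rightarrow> germ) \<Rightarrow> real set"
  where "const_params T p = {t\<in>T. \<forall>m. nash_partial T t (p m) = \<zero>\<^bsub>nash_field T\<^esub>}"

text \<open>The tuple (P, Q_1, ..., Q_n, f_0, ..., f_k) is represented as (P, [Q_1, ..., Q_n], [f_0, ..., f_k]).\<close>

type_synonym tuple =
  "(nat multiset \<Rightarrow> germ) \<times> (nat multiset \<Rightarrow> germ) list \<times> germ list"

definition tuple_deg :: "tuple \<Rightarrow> nat"
  where "tuple_deg z = (case z of (P, Qs, fs) \<Rightarrow> length fs - 1)"

definition nash_tuples :: "real set \<Rightarrow> tuple set"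
  where "nash_tuples T =
    {(P, Qs, fs) | P Qs fs k.
       k \<ge> 1 \<and> length fs = k + 1 \<and> Qs \<noteq> [] \<and>
       P \<in> mpolys (nash_field T) \<and> set Qs \<subseteq> mpolys (nash_field T) \<and>
       set fs \<subseteq> carrier (nash_field T) \<and>
       mpoly_alpha (nash_field T) P = ereal (real k) \<and>
       (\<forall>Q\<in>set Qs. mpoly_alpha (nash_field T) P \<ge> mpoly_alpha (nash_field T) Q \<and>
                    mpoly_alpha (nash_field T) Q \<ge> -1) \<and>
       mpoly_eval (nash_field T) P (nth fs) = \<zero>\<^bsub>nash_field T\<^esub> \<and>
       mpoly_eval (nash_field T) (mpoly_deriv (nash_field T) k P) (nth fs) \<noteq> \<zero>\<^bsub>nash_field T\<^esub> \<and>
       (\<forall>Q\<in>set Qs. mpoly_eval (nash_field T) Q (nth fs) \<in> nash_pos T)}"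

definition partition_family :: "real set \<Rightarrow> (tuple \<Rightarrow> real set) \<Rightarrow> bool"
  where "partition_family T Tz \<longleftrightarrow>
    disjoint_family_on Tz (nash_tuples T) \<and> (\<Union>z\<in>nash_tuples T. Tz z) = T \<and>
    (\<forall>z\<in>nash_tuples T. infinite (Tz z) \<and> countable (Tz z))"

text \<open>
  For a tuple z with k = \<open>\<alpha>\<close>(P), \<open>tz z i\<close> and \<open>rz z i\<close> (i < k) are the chosen points and rational
  numbers, and \<open>fz z\<close> is the chosen element of the field.
\<close>

definition admissible_choices ::
  "real set \<Rightarrow> (tuple \<Rightarrow> real set) \<Rightarrow> (tuple \<Rightarrow> nat \<Rightarrow> real) \<Rightarrow> (tuple \<Rightarrow> nat \<Rightarrow> rat)
     \<Rightarrow> (tuple \<Rightarrow> germ) \<Rightarrow> bool"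
  where "admissible_choices T Tz tz rz fz \<longleftrightarrow>
    (\<forall>z\<in>nash_tuples T. case z of (P, Qs, fs) \<Rightarrow>
      let k = tuple_deg z;
          xs = map (\<lambda>i. nash_const T (rz z i) \<otimes>\<^bsub>nash_field T\<^esub> nash_var T (tz z i)) [0..<k] @ [fz z]
      in strict_mono_on {..<k} (tz z) \<and>
         tz z ` {..<k} \<subseteq> const_params T P \<inter> (\<Inter>Q\<in>set Qs. const_params T Q) \<inter> Tz z \<and>
         (\<forall>i<k. rz z i \<noteq> 0) \<and>
         fz z \<in> carrier (nash_field T) \<and>
         mpoly_eval (nash_field T) P (nth xs) = \<zero>\<^bsub>nash_field T\<^esub> \<and>
         (\<forall>Q\<in>set Qs. mpoly_eval (nash_field T) Q (nth xs) \<in> nash_pos T))"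

definition constructed_family ::
  "real set \<Rightarrow> (tuple \<Rightarrow> real set) \<Rightarrow> (tuple \<Rightarrow> nat \<Rightarrow> real) \<Rightarrow> (tuple \<Rightarrow> nat \<Rightarrow> rat)
     \<Rightarrow> (tuple \<Rightarrow> germ) \<Rightarrow> (real \<Rightarrow> germ) \<Rightarrow> (real \<Rightarrow> germ) \<Rightarrow> bool"
  where "constructed_family T Tz tz rz fz h g \<longleftrightarrow>
    (\<forall>z\<in>nash_tuples T. let k = tuple_deg z in
      (\<forall>i. i + 2 \<le> k \<longrightarrow>
         g (tz z i) =
           nash_const T (rz z (i + 1) / rz z i) \<otimes>\<^bsub>nash_field T\<^esub> nash_var T (tz z (i + 1))) \<and>
      g (tz z (k - 1)) = nash_const T (1 / rz z (k - 1)) \<otimes>\<^bsub>nash_field T\<^esub> fz z \<and>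
      (\<forall>t\<in>Tz z - tz z ` {..<k}. h t \<in> carrier (nash_field T) \<and> g t = h t))"

end

theory Submission
  imports Defs
begin

text \<open>
  Evaluation at the base point identifies the field of germs with the field of real numbers that
  are algebraic over the rationals adjoined T. It is injective: if f vanishes at the base point and
  p(x, f(x)) = 0, cancel powers of Z from p until its constant term is nonzero; by algebraic
  independence that term does not vanish at the base point, hence neither does p(x, f(x)) nearby.
  It is surjective: a real number algebraic over T is a simple root of a polynomial of minimal
  degree, and the implicit function theorem, proved by a contraction in weighted l1 algebras of
  power series, extends it to a Nash function. So being a Nash germ amounts to being algebraic and
  continuous at the base point, and the field inherits real closedness from the real numbers.
  Partial derivatives of a Nash germ are again algebraic by implicit differentiation.

  For the differential property, given a system of order n > 0 with an algebraic solution, the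
  element a = r_0 Lambda_(t_0) belonging to the corresponding tuple z satisfies
  delta^i(a) = r_i Lambda_(t_i) for i < n and delta^n(a) = f_z, so it solves the system.
\<close>

section \<open>Evaluation of polynomials\<close>

text \<open>Sums, products and inverses of Nash functions are never shown to be analytic directly.
  The work is done with the weaker notion \<open>nash_like\<close>, algebraic near the base point
  and continuous at it, which passes easily to these operations. Analyticity returns only when a
  germ is replaced by a representative rebuilt from its value. The algebraic obstacle is closure of
  algebraic functions under sums and products: functions on a set have zero divisors, so field
  degrees are replaced by finitely generated modules that are preserved up to a denominator. The
  same predicate \<open>alg_on\<close>, taken on the one-point set of the base point, handles
  algebraic real numbers. In the implicit function theorem the norm is an l1 norm of coefficients,
  because uniform limits of real analytic functions need not be analytic, whereas l1 limits of power
  series are power series. Since a Nash function must be analytic at every point of its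
  neighbourhood, the root is first singled out on the whole neighbourhood by monotonicity in Z and
  only then compared with local series.\<close>

lemma poly_mapping_sum_single:
  "p = (\<Sum>m\<in>Poly_Mapping.keys p. Poly_Mapping.single m (Poly_Mapping.lookup p m))"
  by (rule poly_mapping_eqI)
    (simp add: lookup_sum lookup_single when_def sum.delta in_keys_iff)

lemma poly_mapping_single_induct [case_names zero single add]:
  fixes p :: "'a \<Rightarrow>\<^sub>0 'b::comm_monoid_add"
  assumes "P 0" and "\<And>m c. m \<in> Poly_Mapping.keys p \<Longrightarrow> P (Poly_Mapping.single m c)"
    and "\<And>q r. P q \<Longrightarrow> P r \<Longrightarrow> P (q + r)"
  shows "P p"
proof -
  have "P (\<Sum>m\<in>M. Poly_Mapping.single m (Poly_Mapping.lookup p m))"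
    if "M \<subseteq> Poly_Mapping.keys p" for M
    using finite_subset[OF that finite_keys] that
    by (induction M rule: finite_induct) (auto intro: assms)
  from this[OF subset_refl] show ?thesis
    by (simp flip: poly_mapping_sum_single)
qed

definition mono_eval :: "(real \<Rightarrow>\<^sub>0 nat) \<Rightarrow> (real \<Rightarrow> real) \<Rightarrow> real"
  where "mono_eval m x = (\<Prod>t\<in>Poly_Mapping.keys m. x t ^ Poly_Mapping.lookup m t)"

lemma mono_eval_superset:
  assumes "finite S" "Poly_Mapping.keys m \<subseteq> S"
  shows "mono_eval m x = (\<Prod>t\<in>S. x t ^ Poly_Mapping.lookup m t)"
  unfolding mono_eval_def using assms
  by (intro prod.mono_neutral_left) (auto simp: in_keys_iff)

lemma mono_eval_add: "mono_eval (m + n) x = mono_eval m x * mono_eval n x"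
proof -
  let ?S = "Poly_Mapping.keys m \<union> Poly_Mapping.keys n"
  have "Poly_Mapping.keys (m + n) \<subseteq> ?S" by (rule keys_add)
  then show ?thesis
    by (simp add: mono_eval_superset[of ?S] lookup_add power_add prod.distrib)
qed

lemma rat_mpoly_eval_superset:
  assumes "finite M" "Poly_Mapping.keys p \<subseteq> M"
  shows "rat_mpoly_eval p x = (\<Sum>m\<in>M. of_rat (Poly_Mapping.lookup p m) * mono_eval m x)"
  unfolding rat_mpoly_eval_def mono_eval_def using assms
  by (intro sum.mono_neutral_left) (auto simp: in_keys_iff)

lemma rat_mpoly_eval_0 [simp]: "rat_mpoly_eval 0 x = 0"
  by (simp add: rat_mpoly_eval_def)

lemma rat_mpoly_eval_add: "rat_mpoly_eval (p + q) x = rat_mpoly_eval p x + rat_mpoly_eval q x"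
proof -
  let ?M = "Poly_Mapping.keys p \<union> Poly_Mapping.keys q"
  have "Poly_Mapping.keys (p + q) \<subseteq> ?M" by (rule keys_add)
  then show ?thesis
    by (simp add: rat_mpoly_eval_superset[of ?M] lookup_add of_rat_add sum.distrib algebra_simps)
qed

lemma rat_mpoly_eval_single:
  "rat_mpoly_eval (Poly_Mapping.single m c) x = of_rat c * mono_eval m x"
  by (subst rat_mpoly_eval_superset[of "{m}"]) auto

lemma rat_mpoly_eval_1 [simp]: "rat_mpoly_eval 1 x = 1"
  by (subst single_one[symmetric], subst rat_mpoly_eval_single) (simp add: mono_eval_def)

lemma rat_mpoly_eval_mult: "rat_mpoly_eval (p * q) x = rat_mpoly_eval p x * rat_mpoly_eval q x"
proof (induction p rule: poly_mapping_single_induct)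
  case (single m c)
  show ?case
    by (induction q rule: poly_mapping_single_induct)
      (simp_all add: mult_single rat_mpoly_eval_single mono_eval_add of_rat_mult
        distrib_left rat_mpoly_eval_add)
qed (simp_all add: distrib_right rat_mpoly_eval_add)

lemma rat_mpoly_eval_minus: "rat_mpoly_eval (- p) x = - rat_mpoly_eval p x"
  using rat_mpoly_eval_add[of p "- p" x] by simp

lemma rat_mpoly_eval_cong:
  assumes "p \<in> rat_mpolys S" "\<And>t. t \<in> S \<Longrightarrow> x t = y t"
  shows "rat_mpoly_eval p x = rat_mpoly_eval p y"
  using assms unfolding rat_mpoly_eval_def rat_mpolys_def
  by (auto simp: subset_eq intro!: sum.cong prod.cong)

lemma rat_mpolys_single_iff:
  "Poly_Mapping.single m c \<in> rat_mpolys T \<longleftrightarrow> c = 0 \<or> Poly_Mapping.keys m \<subseteq> T"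
  by (auto simp: rat_mpolys_def)

lemma rat_mpolys_0 [simp]: "0 \<in> rat_mpolys T"
  by (simp add: rat_mpolys_def)

lemma rat_mpolys_1 [simp]: "1 \<in> rat_mpolys T"
  by (simp add: rat_mpolys_def)

lemma rat_mpolys_add: "p \<in> rat_mpolys T \<Longrightarrow> q \<in> rat_mpolys T \<Longrightarrow> p + q \<in> rat_mpolys T"
  using keys_add[of p q] by (auto simp: rat_mpolys_def)

lemma rat_mpolys_minus: "p \<in> rat_mpolys T \<Longrightarrow> - p \<in> rat_mpolys T"
  by (auto simp: rat_mpolys_def in_keys_iff)

lemma rat_mpolys_diff: "p \<in> rat_mpolys T \<Longrightarrow> q \<in> rat_mpolys T \<Longrightarrow> p - q \<in> rat_mpolys T"
  using rat_mpolys_add[OF _ rat_mpolys_minus] by fastforce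

lemma rat_mpolys_mult:
  assumes "p \<in> rat_mpolys T" "q \<in> rat_mpolys T" shows "p * q \<in> rat_mpolys T"
  unfolding rat_mpolys_def
proof (clarify, rule ccontr)
  fix m t assume "m \<in> Poly_Mapping.keys (p * q)" "t \<in> Poly_Mapping.keys m" "t \<notin> T"
  then obtain a b where "a \<in> Poly_Mapping.keys p" "b \<in> Poly_Mapping.keys q" "m = a + b"
    using keys_mult[of p q] by blast
  then show False
    using assms keys_add[of a b] \<open>t \<in> Poly_Mapping.keys m\<close> \<open>t \<notin> T\<close>
    unfolding rat_mpolys_def by blast
qed

lemma rat_mpolys_power: "p \<in> rat_mpolys T \<Longrightarrow> p ^ n \<in> rat_mpolys T"
  by (induction n) (auto intro: rat_mpolys_mult)

lemma rat_mpolys_of_nat: "of_nat n \<in> rat_mpolys T"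
  by (induction n) (auto intro: rat_mpolys_add)

lemma rat_mpolys_mono: "S \<subseteq> T \<Longrightarrow> rat_mpolys S \<subseteq> rat_mpolys T"
  by (auto simp: rat_mpolys_def)

lemma finite_vars_rat_mpolys:
  assumes "p \<in> rat_mpolys T"
  shows "\<exists>S. finite S \<and> S \<subseteq> T \<and> p \<in> rat_mpolys S"
  by (rule exI[of _ "\<Union>m\<in>Poly_Mapping.keys p. Poly_Mapping.keys m"])
    (use assms in \<open>auto simp: rat_mpolys_def\<close>)

lemma rat_mpoly_eval_power: "rat_mpoly_eval (p ^ n) x = rat_mpoly_eval p x ^ n"
  by (induction n) (simp_all add: rat_mpoly_eval_mult)

lemma rat_mpoly_eval_sum: "rat_mpoly_eval (sum f I) x = (\<Sum>i\<in>I. rat_mpoly_eval (f i) x)"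
  by (induction I rule: infinite_finite_induct) (simp_all add: rat_mpoly_eval_add)

lemma rat_mpoly_eval_of_nat [simp]: "rat_mpoly_eval (of_nat n) x = of_nat n"
  by (induction n) (simp_all add: rat_mpoly_eval_add)

definition rat_var :: "real \<Rightarrow> rat_mpoly"
  where "rat_var t = Poly_Mapping.single (Poly_Mapping.single t 1) 1"

lemma rat_mpoly_eval_var [simp]: "rat_mpoly_eval (rat_var t) x = x t"
  by (simp add: rat_var_def rat_mpoly_eval_single mono_eval_def)

lemma rat_var_in_rat_mpolys [simp]: "t \<in> T \<Longrightarrow> rat_var t \<in> rat_mpolys T"
  by (simp add: rat_var_def rat_mpolys_single_iff)

definition rat_const :: "rat \<Rightarrow> rat_mpoly"
  where "rat_const c = Poly_Mapping.single 0 c"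

lemma rat_mpoly_eval_const [simp]: "rat_mpoly_eval (rat_const c) x = of_rat c"
  by (simp add: rat_const_def rat_mpoly_eval_single mono_eval_def)

lemma rat_const_in_rat_mpolys [simp]: "rat_const c \<in> rat_mpolys T"
  by (simp add: rat_const_def rat_mpolys_single_iff)


section \<open>Polynomials in Z with coefficients in Q[Lambda_T], specialised at a point\<close>

abbreviation poly_at :: "rat_mpoly poly \<Rightarrow> (real \<Rightarrow> real) \<Rightarrow> real poly"
  where "poly_at p x \<equiv> map_poly (\<lambda>q. rat_mpoly_eval q x) p"

definition rat_polys :: "real set \<Rightarrow> rat_mpoly poly set"
  where "rat_polys T = {p. \<forall>i. poly.coeff p i \<in> rat_mpolys T}"

lemma coeff_poly_at: "poly.coeff (poly_at p x) i = rat_mpoly_eval (poly.coeff p i) x"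
  by (simp add: coeff_map_poly)

lemma poly_at_pCons: "poly_at (pCons a p) x = pCons (rat_mpoly_eval a x) (poly_at p x)"
  by (simp add: map_poly_pCons)

lemma poly_at_add: "poly_at (p + q) x = poly_at p x + poly_at q x"
  by (rule poly_eqI) (simp add: coeff_poly_at rat_mpoly_eval_add)

lemma poly_at_minus: "poly_at (- p) x = - poly_at p x"
  by (rule poly_eqI) (simp add: coeff_poly_at rat_mpoly_eval_minus)

lemma poly_at_pderiv: "poly_at (pderiv p) x = pderiv (poly_at p x)"
  by (rule poly_eqI)
    (simp add: coeff_poly_at coeff_pderiv rat_mpoly_eval_mult rat_mpoly_eval_add)

text \<open>Specialisation may lower the degree; a bound for the degree of \<open>p\<close> itself
  gives a range of summation independent of \<open>x\<close>.\<close>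

lemma poly_at_eq_sum:
  assumes "Polynomial.degree p \<le> n"
  shows "poly (poly_at p x) z = (\<Sum>i\<le>n. rat_mpoly_eval (poly.coeff p i) x * z ^ i)"
proof -
  have "Polynomial.degree (poly_at p x) \<le> n"
    using assms map_poly_degree_leq[of "\<lambda>q. rat_mpoly_eval q x" p] by linarith
  then show ?thesis
    unfolding poly_altdef
    by (subst sum.mono_neutral_left[of "{..n}"])
      (auto simp: coeff_poly_at intro: coeff_eq_0 simp flip: coeff_poly_at)
qed

lemma rat_polysD: "p \<in> rat_polys T \<Longrightarrow> poly.coeff p i \<in> rat_mpolys T"
  by (simp add: rat_polys_def)

lemma rat_polys_pCons_iff: "pCons a p \<in> rat_polys T \<longleftrightarrow> a \<in> rat_mpolys T \<and> p \<in> rat_polys T"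
  by (auto simp: rat_polys_def coeff_pCons split: nat.splits)

lemma rat_polys_0 [simp]: "0 \<in> rat_polys T"
  by (simp add: rat_polys_def)

lemma rat_polys_minus: "p \<in> rat_polys T \<Longrightarrow> - p \<in> rat_polys T"
  by (simp add: rat_polys_def rat_mpolys_minus)

lemma rat_polys_pderiv: "p \<in> rat_polys T \<Longrightarrow> pderiv p \<in> rat_polys T"
  by (auto simp: rat_polys_def coeff_pderiv
      intro!: rat_mpolys_mult rat_mpolys_add rat_mpolys_of_nat)

lemma rat_polys_mono: "S \<subseteq> T \<Longrightarrow> rat_polys S \<subseteq> rat_polys T"
  by (auto simp: rat_polys_def dest: subsetD[OF rat_mpolys_mono])

lemma finite_vars_rat_polys:
  assumes "p \<in> rat_polys T"
  shows "\<exists>S. finite S \<and> S \<subseteq> T \<and> p \<in> rat_polys S"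
  using assms
proof (induction p)
  case (pCons a p)
  from pCons.prems obtain S S' where S: "finite S" "S \<subseteq> T" "a \<in> rat_mpolys S"
    and S': "finite S'" "S' \<subseteq> T" "p \<in> rat_polys S'"
    using finite_vars_rat_mpolys[of a T] pCons.IH by (auto simp: rat_polys_pCons_iff)
  then have "finite (S \<union> S') \<and> S \<union> S' \<subseteq> T \<and> pCons a p \<in> rat_polys (S \<union> S')"
    using rat_mpolys_mono[of S "S \<union> S'"] rat_polys_mono[of S' "S \<union> S'"]
    by (auto simp: rat_polys_pCons_iff)
  then show ?case by blast
qed (auto intro: exI[of _ "{}"])

section \<open>Functions algebraic over the polynomials\<close>

lemma sum_in_set:
  assumes "0 \<in> A" "\<And>a b. a \<in> A \<Longrightarrow> b \<in> A \<Longrightarrow> a + b \<in> A" "\<And>i. i \<in> I \<Longrightarrow> f i \<in> A"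
  shows "sum f I \<in> A"
  using assms by (induction I rule: infinite_finite_induct) auto

text \<open>Gaussian elimination without division: n + 1 vectors with n coordinates are dependent.
  Cross multiplication with the pivot keeps all coefficients in the subring \<open>A\<close>, later
  \<open>rat_mpolys T\<close>, whose fraction field is never formed.\<close>

lemma linear_dependence:
  fixes v :: "nat \<Rightarrow> nat \<Rightarrow> 'a::idom"
  assumes "1 \<in> A" "0 \<in> A"
    and A: "\<And>a b. a \<in> A \<Longrightarrow> b \<in> A \<Longrightarrow> a - b \<in> A" "\<And>a b. a \<in> A \<Longrightarrow> b \<in> A \<Longrightarrow> a * b \<in> A"
    and "\<And>i j. v i j \<in> A"
  shows "\<exists>c. (\<forall>i. c i \<in> A) \<and> (\<exists>i\<le>n. c i \<noteq> 0) \<and> (\<forall>j<n. (\<Sum>i\<le>n. c i * v i j) = 0)"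
  using assms(5)
proof (induction n arbitrary: v)
  case 0
  show ?case by (rule exI[of _ "\<lambda>_. 1"]) (use assms in auto)
next
  case (Suc n)
  show ?case
  proof (cases "\<forall>i\<le>Suc n. v i n = 0")
    case True
    obtain c where "\<forall>i. c i \<in> A" "\<exists>i\<le>n. c i \<noteq> 0" "\<forall>j<n. (\<Sum>i\<le>n. c i * v i j) = 0"
      using Suc by blast
    moreover from this(2) have "\<exists>i\<le>Suc n. (c(Suc n := 0)) i \<noteq> 0"
      by (metis fun_upd_other le_SucI not_less_eq_eq order_refl)
    ultimately show ?thesis
      using True \<open>0 \<in> A\<close> by (intro exI[of _ "c(Suc n := 0)"]) (auto simp: less_Suc_eq)
  next
    case False
    then obtain k where k: "k \<le> Suc n" "v k n \<noteq> 0" by blast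
    \<comment> \<open>\<open>e\<close> enumerates the indices other than the pivot \<open>k\<close>,
      and \<open>e'\<close> inverts it.\<close>
    define e where "e i = (if i < k then i else Suc i)" for i
    define e' where "e' i = (if i < k then i else i - 1)" for i
    have e: "bij_betw e {..n} ({..Suc n} - {k})"
      by (rule bij_betw_byWitness[where f' = e']) (use k in \<open>auto simp: e_def e'_def\<close>)
    have e'e: "e' (e i) = i" "e i \<noteq> k" for i by (auto simp: e_def e'_def)
    \<comment> \<open>The coordinate \<open>n\<close> of every \<open>w i\<close> is zero, so a
      relation in the first \<open>n\<close> coordinates, as given by the induction hypothesis, is a
      relation in all of them.\<close>
    define w where "w i j = v k n * v (e i) j - v (e i) n * v k j" for i j
    have "w i j \<in> A" for i j unfolding w_def by (intro A Suc.prems)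
    then obtain c where c: "\<forall>i. c i \<in> A" "\<exists>i\<le>n. c i \<noteq> 0" "\<forall>j<n. (\<Sum>i\<le>n. c i * w i j) = 0"
      using Suc.IH by blast
    \<comment> \<open>Expanding the relation between the \<open>w i\<close>, the pivot vector has
      been subtracted \<open>s\<close> times in total; this is its coefficient in \<open>d\<close>,
      up to sign.\<close>
    define s where "s = (\<Sum>i\<le>n. c i * v (e i) n)"

    have neg: "a \<in> A \<Longrightarrow> - a \<in> A" for a using A(1)[OF \<open>0 \<in> A\<close>] by fastforce
    have add: "a \<in> A \<Longrightarrow> b \<in> A \<Longrightarrow> a + b \<in> A" for a b using A(1)[OF _ neg] by fastforce
    have sA: "s \<in> A" unfolding s_def
      by (rule sum_in_set[of A]) (use c(1) Suc.prems A(2) add \<open>0 \<in> A\<close> in auto)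
    define d where "d i = (if i = k then - s else c (e' i) * v k n)" for i
    have dsum: "(\<Sum>i\<le>Suc n. d i * v i j) = (\<Sum>i\<le>n. c i * w i j)" for j
    proof -
      have "(\<Sum>i\<le>Suc n. d i * v i j) = d k * v k j + (\<Sum>i\<in>{..Suc n}-{k}. d i * v i j)"
        by (rule sum.remove) (use k in auto)
      also have "(\<Sum>i\<in>{..Suc n}-{k}. d i * v i j) = (\<Sum>i\<le>n. d (e i) * v (e i) j)"
        by (rule sum.reindex_bij_betw[OF e, symmetric])
      finally show ?thesis
        by (simp add: d_def e'e w_def s_def algebra_simps sum_subtractf sum_distrib_left)
    qed
    obtain i where i: "i \<le> n" "c i \<noteq> 0" using c(2) by blast
    have "d (e i) \<noteq> 0" using i k by (simp add: d_def e'e)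
    moreover have "e i \<le> Suc n" using i by (simp add: e_def)
    moreover have "\<forall>i. d i \<in> A" using c(1) sA Suc.prems A(2) neg by (simp add: d_def)
    moreover have "(\<Sum>i\<le>n. c i * w i j) = 0" if "j < Suc n" for j
      using c(3) that by (cases "j = n") (auto simp: w_def mult.commute)
    ultimately show ?thesis using dsum by (intro exI[of _ d]) auto
  qed
qed

section \<open>Closure of algebraic functions through finitely generated modules\<close>

text \<open>No regularity is asked of \<open>u\<close>, and \<open>U\<close> is any set. For
  independent \<open>T\<close> and \<open>U = {base_point T}\<close> it says that the value of
  \<open>u\<close> is algebraic over Q(T).\<close>

definition alg_on :: "real set \<Rightarrow> (real \<Rightarrow> real) set \<Rightarrow> ((real \<Rightarrow> real) \<Rightarrow> real) \<Rightarrow> bool"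
  where "alg_on T U u \<longleftrightarrow> (\<exists>p\<in>rat_polys T. p \<noteq> 0 \<and> (\<forall>x\<in>U. poly (poly_at p x) (u x) = 0))"

definition poly_span ::
  "real set \<Rightarrow> (real \<Rightarrow> real) set \<Rightarrow> ((real \<Rightarrow> real) \<Rightarrow> real) set \<Rightarrow> ((real \<Rightarrow> real) \<Rightarrow> real) set"
  where "poly_span T U E = {u. \<exists>m. (\<forall>e. m e \<in> rat_mpolys T) \<and>
           (\<forall>x\<in>U. u x = (\<Sum>e\<in>E. rat_mpoly_eval (m e) x * e x))}"

text \<open>Up to a denominator \<open>d\<close>, multiplication by \<open>u\<close> maps the module
  generated by \<open>E\<close> into itself. This stands in for membership in a finite extension of
  Q(Lambda_T), which makes no sense for functions with zero divisors.\<close>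

definition span_multipliers ::
  "real set \<Rightarrow> (real \<Rightarrow> real) set \<Rightarrow> ((real \<Rightarrow> real) \<Rightarrow> real) set \<Rightarrow> ((real \<Rightarrow> real) \<Rightarrow> real) set"
  where "span_multipliers T U E = {u. \<exists>d\<in>rat_mpolys T. d \<noteq> 0 \<and>
           (\<forall>e\<in>E. (\<lambda>x. rat_mpoly_eval d x * u x * e x) \<in> poly_span T U E)}"

context
  fixes T :: "real set" and U :: "(real \<Rightarrow> real) set"
begin

lemma poly_span_cong:
  "u \<in> poly_span T U E \<Longrightarrow> (\<And>x. x \<in> U \<Longrightarrow> v x = u x) \<Longrightarrow> v \<in> poly_span T U E"
  unfolding poly_span_def by auto

lemma poly_span_0: "(\<lambda>_. 0) \<in> poly_span T U E"
  unfolding poly_span_def by (auto intro!: exI[of _ "\<lambda>_. 0"])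

lemma poly_span_add:
  assumes "u \<in> poly_span T U E" "v \<in> poly_span T U E"
  shows "(\<lambda>x. u x + v x) \<in> poly_span T U E"
proof -
  obtain m n where "\<forall>e. m e \<in> rat_mpolys T" "\<forall>x\<in>U. u x = (\<Sum>e\<in>E. rat_mpoly_eval (m e) x * e x)"
    "\<forall>e. n e \<in> rat_mpolys T" "\<forall>x\<in>U. v x = (\<Sum>e\<in>E. rat_mpoly_eval (n e) x * e x)"
    using assms unfolding poly_span_def by blast
  then show ?thesis unfolding poly_span_def
    by (auto intro!: exI[of _ "\<lambda>e. m e + n e"]
        simp: rat_mpolys_add rat_mpoly_eval_add distrib_right sum.distrib)
qed

lemma poly_span_scale:
  assumes "u \<in> poly_span T U E" "d \<in> rat_mpolys T"
  shows "(\<lambda>x. rat_mpoly_eval d x * u x) \<in> poly_span T U E"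
proof -
  obtain m where "\<forall>e. m e \<in> rat_mpolys T" "\<forall>x\<in>U. u x = (\<Sum>e\<in>E. rat_mpoly_eval (m e) x * e x)"
    using assms(1) unfolding poly_span_def by blast
  then show ?thesis unfolding poly_span_def using assms(2)
    by (auto intro!: exI[of _ "\<lambda>e. d * m e"]
        simp: rat_mpolys_mult rat_mpoly_eval_mult sum_distrib_left mult.assoc)
qed

lemma poly_span_base:
  assumes "finite E" "e \<in> E" shows "e \<in> poly_span T U E"
proof -
  have "(\<Sum>e'\<in>E. rat_mpoly_eval (if e' = e then 1 else 0) x * e' x) = (\<Sum>e'\<in>E. if e' = e then e' x else 0)" for x
    by (rule sum.cong) auto
  then show ?thesis
    unfolding poly_span_def using assms
    by (auto intro!: exI[of _ "\<lambda>e'. if e' = e then 1 else 0"])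
qed

lemma poly_span_sum:
  "(\<And>i. i \<in> I \<Longrightarrow> u i \<in> poly_span T U E) \<Longrightarrow> (\<lambda>x. \<Sum>i\<in>I. u i x) \<in> poly_span T U E"
  by (induction I rule: infinite_finite_induct) (simp_all add: poly_span_0 poly_span_add)

lemma poly_span_mult_subset:
  assumes "\<And>e. e \<in> E \<Longrightarrow> (\<lambda>x. w x * e x) \<in> poly_span T U E'" and "u \<in> poly_span T U E"
  shows "(\<lambda>x. w x * u x) \<in> poly_span T U E'"
proof -
  obtain m where m: "\<forall>e. m e \<in> rat_mpolys T" "\<forall>x\<in>U. u x = (\<Sum>e\<in>E. rat_mpoly_eval (m e) x * e x)"
    using assms(2) unfolding poly_span_def by blast
  have "(\<lambda>x. \<Sum>e\<in>E. rat_mpoly_eval (m e) x * (w x * e x)) \<in> poly_span T U E'"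
    by (intro poly_span_sum poly_span_scale assms) (use m in auto)
  then show ?thesis
    by (rule poly_span_cong) (use m in \<open>simp add: sum_distrib_left algebra_simps\<close>)
qed

text \<open>The product of the individual denominators serves all \<open>u i\<close>. Passing from
  the generators to the whole span is what allows multiplications to be composed.\<close>

lemma span_multipliers_common:
  assumes "finite I" "\<And>i. i \<in> I \<Longrightarrow> u i \<in> span_multipliers T U E"
  shows "\<exists>d\<in>rat_mpolys T. d \<noteq> 0 \<and>
    (\<forall>i\<in>I. \<forall>s\<in>poly_span T U E. (\<lambda>x. rat_mpoly_eval d x * u i x * s x) \<in> poly_span T U E)"
  using assms
proof (induction I rule: finite_induct)
  case empty
  show ?case by (rule bexI[of _ 1]) auto
next
  case (insert i I)
  from insert.IH insert.prems obtain d where d: "d\<in>rat_mpolys T" "d \<noteq> 0"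
    "\<forall>i\<in>I. \<forall>s\<in>poly_span T U E. (\<lambda>x. rat_mpoly_eval d x * u i x * s x) \<in> poly_span T U E"
    by auto
  from insert.prems[of i] obtain d' where d': "d'\<in>rat_mpolys T" "d' \<noteq> 0"
    "\<forall>e\<in>E. (\<lambda>x. rat_mpoly_eval d' x * u i x * e x) \<in> poly_span T U E"
    unfolding span_multipliers_def by blast
  have "(\<lambda>x. rat_mpoly_eval (d * d') x * u j x * s x) \<in> poly_span T U E"
    if "j \<in> insert i I" and s: "s \<in> poly_span T U E" for j s
  proof (cases "j = i")
    case True
    have "(\<lambda>x. rat_mpoly_eval d' x * u i x * s x) \<in> poly_span T U E"
      by (rule poly_span_mult_subset[OF _ s]) (use d' in auto)
    from poly_span_scale[OF this d(1)] show ?thesis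
      by (rule poly_span_cong) (simp add: True rat_mpoly_eval_mult)
  next
    case False
    then have "(\<lambda>x. rat_mpoly_eval d x * u j x * s x) \<in> poly_span T U E" using that d by auto
    from poly_span_scale[OF this d'(1)] show ?thesis
      by (rule poly_span_cong) (simp add: rat_mpoly_eval_mult)
  qed
  moreover have "d * d' \<in> rat_mpolys T" "d * d' \<noteq> 0" using d d' by (auto intro: rat_mpolys_mult)
  ultimately show ?case by blast
qed

lemma span_multipliersI:
  assumes "d \<in> rat_mpolys T" "d \<noteq> 0"
    and "\<And>e. e \<in> E \<Longrightarrow> (\<lambda>x. rat_mpoly_eval d x * u x * e x) \<in> poly_span T U E"
  shows "u \<in> span_multipliers T U E"
  using assms unfolding span_multipliers_def by blast

lemma span_multipliersE:
  assumes "u \<in> span_multipliers T U E"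
  obtains d where "d \<in> rat_mpolys T" "d \<noteq> 0"
    "\<And>s. s \<in> poly_span T U E \<Longrightarrow> (\<lambda>x. rat_mpoly_eval d x * u x * s x) \<in> poly_span T U E"
  using span_multipliers_common[of "{u}" "\<lambda>u. u" E] assms by auto

lemma span_multipliers_add:
  assumes "finite E" "u \<in> span_multipliers T U E" "v \<in> span_multipliers T U E"
  shows "(\<lambda>x. u x + v x) \<in> span_multipliers T U E"
proof -
  obtain d where d: "d \<in> rat_mpolys T" "d \<noteq> 0" and
    *: "\<forall>b\<in>{u,v}. \<forall>s\<in>poly_span T U E. (\<lambda>x. rat_mpoly_eval d x * b x * s x) \<in> poly_span T U E"
    using span_multipliers_common[of "{u,v}" "\<lambda>u. u" E] assms by auto
  show ?thesis
  proof (rule span_multipliersI[OF d])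
    fix e assume "e \<in> E"
    then have e: "e \<in> poly_span T U E" by (rule poly_span_base[OF assms(1)])
    with * have "(\<lambda>x. rat_mpoly_eval d x * u x * e x + rat_mpoly_eval d x * v x * e x) \<in> poly_span T U E"
      by (intro poly_span_add) auto
    then show "(\<lambda>x. rat_mpoly_eval d x * (u x + v x) * e x) \<in> poly_span T U E"
      by (rule poly_span_cong) (simp add: algebra_simps)
  qed
qed

lemma span_multipliers_mult:
  assumes "finite E" "u \<in> span_multipliers T U E" "v \<in> span_multipliers T U E"
  shows "(\<lambda>x. u x * v x) \<in> span_multipliers T U E"
proof -
  obtain d where d: "d \<in> rat_mpolys T" "d \<noteq> 0" and
    *: "\<forall>b\<in>{u,v}. \<forall>s\<in>poly_span T U E. (\<lambda>x. rat_mpoly_eval d x * b x * s x) \<in> poly_span T U E"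
    using span_multipliers_common[of "{u,v}" "\<lambda>u. u" E] assms by auto
  have dd: "d * d \<in> rat_mpolys T" "d * d \<noteq> 0" using d by (auto intro: rat_mpolys_mult)
  show ?thesis
  proof (rule span_multipliersI[OF dd])
    fix e assume "e \<in> E"
    then have e: "e \<in> poly_span T U E" by (rule poly_span_base[OF assms(1)])
    with * have "(\<lambda>x. rat_mpoly_eval d x * u x * (rat_mpoly_eval d x * v x * e x)) \<in> poly_span T U E"
      by auto
    then show "(\<lambda>x. rat_mpoly_eval (d * d) x * (u x * v x) * e x) \<in> poly_span T U E"
      by (rule poly_span_cong) (simp add: algebra_simps rat_mpoly_eval_mult)
  qed
qed

lemma span_multipliers_poly:
  assumes "finite E" "a \<in> rat_mpolys T"
  shows "rat_mpoly_eval a \<in> span_multipliers T U E"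
proof (rule span_multipliersI[of 1])
  fix e assume "e \<in> E"
  from poly_span_scale[OF poly_span_base[OF assms(1) this] assms(2)]
  show "(\<lambda>x. rat_mpoly_eval 1 x * rat_mpoly_eval a x * e x) \<in> poly_span T U E" by simp
qed auto

text \<open>The powers of d u with exponents 0, ..., n lie in a module with n =
  \<open>card E\<close> generators, so their coefficient vectors satisfy a relation with polynomial
  coefficients, by \<open>linear_dependence\<close>.\<close>

lemma alg_on_span_multiplier:
  assumes "finite E" "(\<lambda>_. 1) \<in> poly_span T U E" "u \<in> span_multipliers T U E"
  shows "alg_on T U u"
proof -
  obtain d where d: "d \<in> rat_mpolys T" "d \<noteq> 0" and
    *: "\<And>s. s \<in> poly_span T U E \<Longrightarrow> (\<lambda>x. rat_mpoly_eval d x * u x * s x) \<in> poly_span T U E"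
    using span_multipliersE[OF assms(3)] by blast
  have "(\<lambda>x. (rat_mpoly_eval d x * u x) ^ k) \<in> poly_span T U E" for k
    by (induction k) (use assms(2) * in auto)
  then have "\<exists>m. (\<forall>e. m e \<in> rat_mpolys T) \<and>
    (\<forall>x\<in>U. (rat_mpoly_eval d x * u x) ^ k = (\<Sum>e\<in>E. rat_mpoly_eval (m e) x * e x))" for k
    unfolding poly_span_def by simp
  then have "\<forall>k. \<exists>m. (\<forall>e. m e \<in> rat_mpolys T) \<and>
    (\<forall>x\<in>U. (rat_mpoly_eval d x * u x) ^ k = (\<Sum>e\<in>E. rat_mpoly_eval (m e) x * e x))"
    by blast
  from choice[OF this] obtain m where m: "\<And>k e. m k e \<in> rat_mpolys T"
    "\<And>k x. x\<in>U \<Longrightarrow> (rat_mpoly_eval d x * u x) ^ k = (\<Sum>e\<in>E. rat_mpoly_eval (m k e) x * e x)"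
    by blast
  define n where "n = card E"
  obtain b where b: "bij_betw b {..<n} E"
    using ex_bij_betw_nat_finite[OF assms(1)] by (auto simp: n_def atLeast0LessThan)
  obtain c where c: "\<forall>i. c i \<in> rat_mpolys T" "\<exists>i\<le>n. c i \<noteq> 0"
    "\<forall>j<n. (\<Sum>i\<le>n. c i * m i (b j)) = 0"
    using linear_dependence[of "rat_mpolys T" "\<lambda>i j. m i (b j)" n]
    by (auto simp: rat_mpolys_diff rat_mpolys_mult m)
  \<comment> \<open>The factor \<open>d ^ i\<close> absorbs the denominators: evaluated at
    \<open>u\<close>, this polynomial is the relation between the powers of d u. It is nonzero
    because \<open>d\<close> is.\<close>
  define p where "p = (\<Sum>i\<le>n. Polynomial.monom (c i * d ^ i) i)"
  have pc: "poly.coeff p i = (if i \<le> n then c i * d ^ i else 0)" for i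
    by (simp add: p_def coeff_sum)
  have "p \<in> rat_polys T"
    using c(1) d(1) by (simp add: rat_polys_def pc rat_mpolys_mult rat_mpolys_power)
  moreover have "p \<noteq> 0"
    using c(2) d(2) pc by (metis coeff_0 mult_eq_0_iff power_not_zero)
  moreover have "poly (poly_at p x) (u x) = 0" if "x \<in> U" for x
  proof -
    have "Polynomial.degree p \<le> n" by (rule degree_le) (simp add: pc)
    then have "poly (poly_at p x) (u x) = (\<Sum>i\<le>n. rat_mpoly_eval (c i) x * (rat_mpoly_eval d x * u x) ^ i)"
      by (simp add: poly_at_eq_sum pc rat_mpoly_eval_mult rat_mpoly_eval_power power_mult_distrib mult.assoc)
    also have "\<dots> = (\<Sum>i\<le>n. \<Sum>e\<in>E. rat_mpoly_eval (c i) x * (rat_mpoly_eval (m i e) x * e x))"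
      by (simp add: m(2)[OF that] sum_distrib_left)
    also have "\<dots> = (\<Sum>e\<in>E. \<Sum>i\<le>n. rat_mpoly_eval (c i) x * (rat_mpoly_eval (m i e) x * e x))"
      by (rule sum.swap)
    also have "\<dots> = (\<Sum>j<n. \<Sum>i\<le>n. rat_mpoly_eval (c i) x * (rat_mpoly_eval (m i (b j)) x * b j x))"
      by (rule sum.reindex_bij_betw[OF b, symmetric])
    also have "\<dots> = (\<Sum>j<n. rat_mpoly_eval (\<Sum>i\<le>n. c i * m i (b j)) x * b j x)"
      by (simp add: rat_mpoly_eval_sum rat_mpoly_eval_mult sum_distrib_right mult.assoc)
    also have "\<dots> = 0" using c(3) by simp
    finally show ?thesis .
  qed
  ultimately show ?thesis unfolding alg_on_def by blast
qed

text \<open>\<open>f\<close> is adjoined through the generators e f^i with i < n. Old multipliers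
  commute with powers of \<open>f\<close> and keep their denominators. Multiplication by
  \<open>f\<close> leaves the generators only at e f^(n-1), where the relation rewrites f^n.\<close>

lemma span_multipliers_extend:
  assumes E: "finite E" and one: "(\<lambda>_. 1) \<in> poly_span T U E" and "n > 0"
    and d0: "d0 \<in> rat_mpolys T" "d0 \<noteq> 0"
    and a: "\<And>i. i < n \<Longrightarrow> a i \<in> span_multipliers T U E"
    and f: "\<And>x. x \<in> U \<Longrightarrow> rat_mpoly_eval d0 x * f x ^ n = (\<Sum>i<n. a i x * f x ^ i)"
  obtains E' where "finite E'" "(\<lambda>_. 1) \<in> poly_span T U E'"
    "span_multipliers T U E \<subseteq> span_multipliers T U E'" "f \<in> span_multipliers T U E'"
proof -
  define E' where "E' = (\<lambda>(e, i) x. e x * f x ^ i) ` (E \<times> {..<n})"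
  have E': "finite E'" using E by (simp add: E'_def)
  have E'I: "(\<lambda>x. e x * f x ^ i) \<in> poly_span T U E'" if "e \<in> E" "i < n" for e i
    by (rule poly_span_base[OF E']) (use that in \<open>auto simp: E'_def\<close>)
  have sp: "(\<lambda>x. f x ^ i * s x) \<in> poly_span T U E'" if "s \<in> poly_span T U E" "i < n" for s i
    using E'I[OF _ that(2)] by (intro poly_span_mult_subset[OF _ that(1)]) (simp add: mult.commute)
  have 1: "(\<lambda>_. 1) \<in> poly_span T U E'" using sp[OF one \<open>n > 0\<close>] by simp
  have 2: "u \<in> span_multipliers T U E'" if u: "u \<in> span_multipliers T U E" for u
  proof -
    obtain d where d: "d \<in> rat_mpolys T" "d \<noteq> 0" and
      *: "\<And>s. s \<in> poly_span T U E \<Longrightarrow> (\<lambda>x. rat_mpoly_eval d x * u x * s x) \<in> poly_span T U E"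
      using span_multipliersE[OF u] by blast
    show ?thesis
    proof (rule span_multipliersI[OF d])
      fix g assume "g \<in> E'"
      then obtain e i where g: "e \<in> E" "i < n" "g = (\<lambda>x. e x * f x ^ i)" by (auto simp: E'_def)
      show "(\<lambda>x. rat_mpoly_eval d x * u x * g x) \<in> poly_span T U E'"
        by (rule poly_span_cong[OF sp[OF *[OF poly_span_base[OF E g(1)]] g(2)]])
          (simp add: g algebra_simps)
    qed
  qed
  obtain d where d: "d \<in> rat_mpolys T" "d \<noteq> 0" and
    *: "\<And>i s. i < n \<Longrightarrow> s \<in> poly_span T U E \<Longrightarrow> (\<lambda>x. rat_mpoly_eval d x * a i x * s x) \<in> poly_span T U E"
    using span_multipliers_common[of "{..<n}" a E] a by auto
  have dd: "d0 * d \<in> rat_mpolys T" "d0 * d \<noteq> 0" using d d0 by (auto intro: rat_mpolys_mult)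
  have "f \<in> span_multipliers T U E'"
  proof (rule span_multipliersI[OF dd])
    fix g assume "g \<in> E'"
    then obtain e i where g: "e \<in> E" "i < n" "g = (\<lambda>x. e x * f x ^ i)" by (auto simp: E'_def)
    show "(\<lambda>x. rat_mpoly_eval (d0 * d) x * f x * g x) \<in> poly_span T U E'"
    proof (cases "Suc i < n")
      case True
      show ?thesis
        by (rule poly_span_cong[OF poly_span_scale[OF E'I[OF g(1) True] dd(1)]])
          (simp add: g algebra_simps)
    next
      case False
      with g(2) have n: "n = Suc i" by simp
      have "(\<lambda>x. \<Sum>j<n. f x ^ j * (rat_mpoly_eval d x * a j x * e x)) \<in> poly_span T U E'"
        by (intro poly_span_sum sp *) (use poly_span_base[OF E g(1)] in auto)
      then show ?thesis
      proof (rule poly_span_cong)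
        fix x assume "x \<in> U"
        have "rat_mpoly_eval (d0 * d) x * f x * g x
            = rat_mpoly_eval d x * e x * (rat_mpoly_eval d0 x * f x ^ n)"
          by (simp add: g n rat_mpoly_eval_mult algebra_simps)
        also have "\<dots> = (\<Sum>j<n. f x ^ j * (rat_mpoly_eval d x * a j x * e x))"
          by (simp add: f[OF \<open>x \<in> U\<close>] sum_distrib_left algebra_simps)
        finally show "rat_mpoly_eval (d0 * d) x * f x * g x
            = (\<Sum>j<n. f x ^ j * (rat_mpoly_eval d x * a j x * e x))" .
      qed
    qed
  qed
  with E' 1 2 that show ?thesis by blast
qed

text \<open>The leading coefficient of an annihilating polynomial plays the role of
  \<open>d0\<close>, so nothing has to be made monic.\<close>

lemma span_multipliers_extend_alg_on:
  assumes E: "finite E" and one: "(\<lambda>_. 1) \<in> poly_span T U E" and "alg_on T U f"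
  obtains E' where "finite E'" "(\<lambda>_. 1) \<in> poly_span T U E'"
    "span_multipliers T U E \<subseteq> span_multipliers T U E'" "f \<in> span_multipliers T U E'"
proof -
  obtain p where p: "p \<in> rat_polys T" "p \<noteq> 0" "\<forall>x\<in>U. poly (poly_at p x) (f x) = 0"
    using assms(3) unfolding alg_on_def by blast
  \<comment> \<open>The factor Z makes the degree positive.\<close>
  define q where "q = pCons 0 p"
  have q: "q \<in> rat_polys T" "q \<noteq> 0" "\<forall>x\<in>U. poly (poly_at q x) (f x) = 0" "Polynomial.degree q > 0"
    using p by (simp_all add: q_def rat_polys_pCons_iff poly_at_pCons)
  let ?n = "Polynomial.degree q"
  have 1: "rat_mpoly_eval (Polynomial.lead_coeff q) x * f x ^ ?n
      = (\<Sum>i<?n. rat_mpoly_eval (- poly.coeff q i) x * f x ^ i)" if "x \<in> U" for x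
  proof -
    have "(\<Sum>i\<le>?n. rat_mpoly_eval (poly.coeff q i) x * f x ^ i) = 0"
      using q(3) that poly_at_eq_sum[of q ?n x "f x"] by simp
    then show ?thesis
      by (simp add: lessThan_Suc_atMost[symmetric] rat_mpoly_eval_minus sum_negf)
  qed
  have 2: "rat_mpoly_eval (- poly.coeff q i) \<in> span_multipliers T U E" for i
    by (intro span_multipliers_poly E rat_mpolys_minus rat_polysD q)
  have 3: "Polynomial.lead_coeff q \<noteq> 0" using q by simp
  show ?thesis
    by (rule span_multipliers_extend[OF E one q(4) rat_polysD[OF q(1)] 3 2 1]) (use that in auto)
qed

lemma alg_on_finite_module:
  fixes n :: nat
  assumes "\<And>i. i < n \<Longrightarrow> alg_on T U (a i)"
  shows "\<exists>E. finite E \<and> (\<lambda>_. 1) \<in> poly_span T U E \<and> (\<forall>i<n. a i \<in> span_multipliers T U E)"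
  using assms
proof (induction n)
  case 0
  show ?case by (rule exI[of _ "{\<lambda>_. 1}"]) (auto intro: poly_span_base)
next
  case (Suc n)
  then obtain E where E: "finite E" "(\<lambda>_. 1) \<in> poly_span T U E" "\<forall>i<n. a i \<in> span_multipliers T U E"
    by auto
  obtain E' where "finite E'" "(\<lambda>_. 1) \<in> poly_span T U E'"
    "span_multipliers T U E \<subseteq> span_multipliers T U E'" "a n \<in> span_multipliers T U E'"
    using span_multipliers_extend_alg_on[OF E(1,2), of "a n"] Suc.prems by blast
  then show ?case using E(3) by (intro exI[of _ E']) (auto simp: less_Suc_eq)
qed

lemma
  assumes "alg_on T U u" "alg_on T U v"
  shows alg_on_add: "alg_on T U (\<lambda>x. u x + v x)" and alg_on_mult: "alg_on T U (\<lambda>x. u x * v x)"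
proof -
  have "alg_on T U (if i = 0 then u else v)" for i :: nat
    using assms by simp
  then have "\<exists>E. finite E \<and> (\<lambda>_. 1) \<in> poly_span T U E \<and>
      (\<forall>i<2. (if i = (0::nat) then u else v) \<in> span_multipliers T U E)"
    by (intro alg_on_finite_module)
  then obtain E where E: "finite E" "(\<lambda>_. 1) \<in> poly_span T U E"
    "\<forall>i<2. (if i = (0::nat) then u else v) \<in> span_multipliers T U E"
    by blast
  have uv: "u \<in> span_multipliers T U E" "v \<in> span_multipliers T U E"
    using E(3)[rule_format, of 0] E(3)[rule_format, of 1] by auto
  show "alg_on T U (\<lambda>x. u x + v x)" "alg_on T U (\<lambda>x. u x * v x)"
    by (rule alg_on_span_multiplier[OF E(1,2)] span_multipliers_add span_multipliers_mult E uv)+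
qed

text \<open>Transitivity of algebraic dependence: the coefficients are adjoined first, then
  \<open>f\<close> with \<open>d0 = 1\<close>. Applied at the base point, it shows that real roots
  of polynomials over the germ field are again algebraic over Q(T).\<close>

lemma alg_on_root:
  assumes "n > 0" "\<And>i. i < n \<Longrightarrow> alg_on T U (a i)"
    and f: "\<And>x. x \<in> U \<Longrightarrow> f x ^ n = (\<Sum>i<n. a i x * f x ^ i)"
  shows "alg_on T U f"
proof -
  obtain E where E: "finite E" "(\<lambda>_. 1) \<in> poly_span T U E" "\<forall>i<n. a i \<in> span_multipliers T U E"
    using alg_on_finite_module[of n a] assms by auto
  show ?thesis
  proof (rule span_multipliers_extend[OF E(1,2) assms(1)])
    show "rat_mpoly_eval 1 x * f x ^ n = (\<Sum>i<n. a i x * f x ^ i)" if "x \<in> U" for x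
      using f[OF that] by simp
  qed (use E(3) in \<open>auto intro: alg_on_span_multiplier\<close>)
qed

lemma alg_on_poly:
  assumes "a \<in> rat_mpolys T" shows "alg_on T U (rat_mpoly_eval a)"
  unfolding alg_on_def using assms
  by (intro bexI[of _ "[:- a, 1:]"])
    (simp_all add: rat_polys_pCons_iff poly_at_pCons rat_mpoly_eval_minus rat_mpolys_minus)

lemma alg_on_inverse:
  assumes "alg_on T U u" shows "alg_on T U (\<lambda>x. inverse (u x))"
proof -
  obtain p where p: "p \<in> rat_polys T" "p \<noteq> 0" "\<forall>x\<in>U. poly (poly_at p x) (u x) = 0"
    using assms unfolding alg_on_def by blast
  define n where "n = Polynomial.degree p"
  \<comment> \<open>The reflected polynomial; the factor Z accounts for the junk value at the zeros of u.\<close>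
  define q where "q = pCons 0 (\<Sum>i\<le>n. Polynomial.monom (poly.coeff p i) (n - i))"
  have s: "(\<Sum>i\<le>n. Polynomial.monom (poly.coeff p i) (n - i)) = (\<Sum>i\<le>n. Polynomial.monom (poly.coeff p (n - i)) i)"
    by (rule sum.reindex_bij_witness[of _ "\<lambda>i. n - i" "\<lambda>i. n - i"]) auto
  have c: "poly.coeff (\<Sum>i\<le>n. Polynomial.monom (poly.coeff p (n - i)) i) j
      = (if j \<le> n then poly.coeff p (n - j) else 0)" for j
    by (simp add: coeff_sum)
  have "q \<in> rat_polys T"
    using p(1) by (simp add: q_def s rat_polys_pCons_iff) (simp add: rat_polys_def c)
  moreover have "(\<Sum>i\<le>n. Polynomial.monom (poly.coeff p (n - i)) i) \<noteq> 0"
    using c[of 0] p(2) by (auto simp: n_def)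
  then have "q \<noteq> 0" by (simp add: q_def s)
  moreover have "poly (poly_at q x) (inverse (u x)) = 0" if "x \<in> U" for x
  proof (cases "u x = 0")
    case False
    have "Polynomial.degree (\<Sum>i\<le>n. Polynomial.monom (poly.coeff p (n - i)) i) \<le> n"
      by (rule degree_le) (simp add: c)
    from poly_at_eq_sum[OF this, of x "inverse (u x)"]
    have "poly (poly_at (\<Sum>i\<le>n. Polynomial.monom (poly.coeff p (n - i)) i) x) (inverse (u x))
      = (\<Sum>i\<le>n. rat_mpoly_eval (poly.coeff p (n - i)) x * inverse (u x) ^ i)"
      by (simp add: c)
    also have "\<dots> = (\<Sum>i\<le>n. rat_mpoly_eval (poly.coeff p i) x * inverse (u x) ^ (n - i))"
      by (rule sum.reindex_bij_witness[of _ "\<lambda>i. n - i" "\<lambda>i. n - i"]) auto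
    also have "\<dots> = inverse (u x) ^ n * (\<Sum>i\<le>n. rat_mpoly_eval (poly.coeff p i) x * u x ^ i)"
      unfolding sum_distrib_left
      by (rule sum.cong) (use False in \<open>auto simp: power_diff field_simps\<close>)
    also have "\<dots> = 0" using p(3) that poly_at_eq_sum[of p n x "u x"] by (simp add: n_def)
    finally show ?thesis by (simp add: q_def s poly_at_pCons)
  qed (simp add: q_def poly_at_pCons)
  ultimately show ?thesis unfolding alg_on_def by blast
qed

lemma alg_on_subset: "alg_on T V u \<Longrightarrow> U \<subseteq> V \<Longrightarrow> alg_on T U u"
  unfolding alg_on_def by blast

lemma alg_on_cong: "alg_on T U u \<Longrightarrow> (\<And>x. x \<in> U \<Longrightarrow> v x = u x) \<Longrightarrow> alg_on T U v"
  unfolding alg_on_def by auto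

end

section \<open>A weighted l1 algebra of power series\<close>

definition polybox :: "real set \<Rightarrow> (real \<Rightarrow> real) \<Rightarrow> real \<Rightarrow> (real \<Rightarrow> real) set"
  where "polybox S a r = {x. \<forall>s\<in>S. \<bar>x s - a s\<bar> \<le> r}"

definition exponents :: "real set \<Rightarrow> (real \<Rightarrow>\<^sub>0 nat) set"
  where "exponents S = {m. Poly_Mapping.keys m \<subseteq> S}"

definition weight :: "real set \<Rightarrow> (real \<Rightarrow>\<^sub>0 nat) \<Rightarrow> (real \<Rightarrow> real) \<Rightarrow> real"
  where "weight S m y = (\<Prod>s\<in>S. y s ^ Poly_Mapping.lookup m s)"

text \<open>\<open>M\<close> bounds the weighted l1 norm, the sum of |c_m| r^|m|, of a power series
  of \<open>f\<close> at \<open>a\<close>. This norm is submultiplicative and complete and dominates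
  the supremum over the closed box.\<close>

definition series_bounded ::
  "real set \<Rightarrow> (real \<Rightarrow> real) \<Rightarrow> real \<Rightarrow> ((real \<Rightarrow> real) \<Rightarrow> real) \<Rightarrow> real \<Rightarrow> bool"
  where "series_bounded S a r f M \<longleftrightarrow>
    (\<exists>c N. ((\<lambda>m. \<bar>c m\<bar> * weight S m (\<lambda>_. r)) has_sum N) (exponents S) \<and> N \<le> M \<and>
       (\<forall>x\<in>polybox S a r. ((\<lambda>m. c m * weight S m (\<lambda>s. x s - a s)) has_sum f x) (exponents S)))"

lemma weight_0 [simp]: "weight S 0 y = 1"
  by (simp add: weight_def)

lemma weight_add: "weight S (m + n) y = weight S m y * weight S n y"
  by (simp add: weight_def lookup_add power_add prod.distrib)

lemma weight_pos: "0 < r \<Longrightarrow> 0 < weight S m (\<lambda>_. r)"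
  unfolding weight_def by (intro prod_pos) auto

lemma abs_weight_le:
  assumes "x \<in> polybox S a r" shows "\<bar>weight S m (\<lambda>s. x s - a s)\<bar> \<le> weight S m (\<lambda>_. r)"
  using assms unfolding weight_def polybox_def
  by (auto simp: abs_prod power_abs intro!: prod_mono power_mono)

context
  fixes S :: "real set" and a :: "real \<Rightarrow> real" and r :: real
  assumes finite_S: "finite S" and r_pos: "r > 0"
begin

lemma series_bounded_mono: "series_bounded S a r f M \<Longrightarrow> M \<le> N \<Longrightarrow> series_bounded S a r f N"
  unfolding series_bounded_def by (meson order_trans)

text \<open>Terms with equal exponents may be collected, so a series indexed by any set will do.\<close>

lemma series_boundedI:
  fixes c :: "'i \<Rightarrow> real"
  assumes e: "\<And>i. i \<in> I \<Longrightarrow> e i \<in> exponents S"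
    and N: "((\<lambda>i. \<bar>c i\<bar> * weight S (e i) (\<lambda>_. r)) has_sum N) I" "N \<le> M"
    and f: "\<And>x. x \<in> polybox S a r \<Longrightarrow> ((\<lambda>i. c i * weight S (e i) (\<lambda>s. x s - a s)) has_sum f x) I"
  shows "series_bounded S a r f M"
proof -
  \<comment> \<open>\<open>F m\<close> is the fibre of \<open>e\<close> over an exponent.
    \<open>C\<close> collects the coefficients of a fibre; \<open>B\<close> collects their absolute
    values, dominates \<open>C\<close>, and has weighted sum \<open>N\<close>.\<close>
  define F where "F m = {i \<in> I. e i = m}" for m
  define C where "C m = infsum c (F m)" for m
  define B where "B m = infsum (\<lambda>i. \<bar>c i\<bar>) (F m)" for m
  have bij: "bij_betw snd (Sigma (exponents S) F) I"
    by (rule bij_betw_byWitness[where f' = "\<lambda>i. (e i, i)"]) (use e in \<open>auto simp: F_def\<close>)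
  have sigma: "((\<lambda>p. u (snd p) * weight S (fst p) y) has_sum v) (Sigma (exponents S) F)"
    if "((\<lambda>i. u i * weight S (e i) y) has_sum v) I" for u y v
  proof -
    have "((\<lambda>p. u (snd p) * weight S (e (snd p)) y) has_sum v) (Sigma (exponents S) F)"
      using that has_sum_reindex_bij_betw[OF bij, of "\<lambda>i. u i * weight S (e i) y" v] by simp
    then show ?thesis by (rule has_sum_cong[THEN iffD1, rotated]) (auto simp: F_def)
  qed
  have B: "((\<lambda>i. \<bar>c i\<bar>) has_sum B m) (F m)" for m
  proof -
    have "(\<lambda>i. \<bar>c i\<bar> * weight S (e i) (\<lambda>_. r)) summable_on F m"
      by (rule summable_on_subset[OF has_sum_imp_summable[OF N(1)]]) (auto simp: F_def)
    then have "(\<lambda>i. \<bar>c i\<bar> * weight S m (\<lambda>_. r)) summable_on F m"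
      by (rule summable_on_cong[THEN iffD1, rotated]) (auto simp: F_def)
    \<comment> \<open>On a single fibre the weight is a positive constant and can be
      cancelled.\<close>
    then have "(\<lambda>i. \<bar>c i\<bar>) summable_on F m"
      using summable_on_cmult_left'[of "weight S m (\<lambda>_. r)" "\<lambda>i. \<bar>c i\<bar>" "F m"] weight_pos[OF r_pos, of S m]
      by simp
    then show ?thesis by (simp add: B_def)
  qed
  have C: "(c has_sum C m) (F m)" for m
  proof -
    have "(\<lambda>i. norm (c i)) summable_on F m" using has_sum_imp_summable[OF B[of m]] by simp
    then show ?thesis unfolding C_def by (rule has_sum_infsum[OF abs_summable_summable])
  qed
  have CB: "\<bar>C m\<bar> \<le> B m" for m
    using norm_has_sum_bound[OF _ C[of m]] B[of m] by simp
  have BN: "((\<lambda>m. B m * weight S m (\<lambda>_. r)) has_sum N) (exponents S)"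
    by (rule has_sum_SigmaD[OF sigma[OF N(1)]]) (simp add: has_sum_cmult_left[OF B])
  have w: "0 \<le> weight S m (\<lambda>_. r)" for m using weight_pos[OF r_pos, of S m] by simp
  have sm: "(\<lambda>m. \<bar>C m\<bar> * weight S m (\<lambda>_. r)) summable_on (exponents S)"
    by (rule summable_on_comparison_test[OF has_sum_imp_summable[OF BN]])
      (use w CB in \<open>auto intro!: mult_right_mono\<close>)
  then obtain N' where N': "((\<lambda>m. \<bar>C m\<bar> * weight S m (\<lambda>_. r)) has_sum N') (exponents S)"
    by (auto simp: summable_on_def)
  have "N' \<le> N" by (rule has_sum_mono[OF N' BN]) (use w CB in \<open>auto intro!: mult_right_mono\<close>)
  moreover have "((\<lambda>m. C m * weight S m (\<lambda>s. x s - a s)) has_sum f x) (exponents S)"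
    if "x \<in> polybox S a r" for x
    by (rule has_sum_SigmaD[OF sigma[OF f[OF that]]]) (simp add: has_sum_cmult_left[OF C])
  ultimately show ?thesis
    unfolding series_bounded_def using N' N(2) by (meson order_trans)
qed

lemma series_bounded_const: "series_bounded S a r (\<lambda>_. k) \<bar>k\<bar>"
  by (rule series_boundedI[of "{()}" "\<lambda>_. 0" "\<lambda>_. k"]) (auto simp: exponents_def has_sum_finite_iff)

lemma series_bounded_var:
  assumes "s \<in> S" shows "series_bounded S a r (\<lambda>x. x s - a s) r"
proof -
  have "weight S (Poly_Mapping.single s 1) y = y s" for y
    using assms finite_S by (simp add: weight_def lookup_single when_def prod.remove[of S s])
  then show ?thesis using assms r_pos
    by (intro series_boundedI[of "{()}" "\<lambda>_. Poly_Mapping.single s 1" "\<lambda>_. 1" r])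
      (auto simp: exponents_def has_sum_finite_iff)
qed

text \<open>Completeness of the l1 norm: all terms of all the series are absolutely summable over
  pairs of an index and an exponent, and \<open>series_boundedI\<close> collects them with
  \<open>e = snd\<close>. Addition is derived below as the case of two nonzero terms.\<close>

lemma series_bounded_sums:
  assumes f: "\<And>n::nat. series_bounded S a r (f n) (M n)" and M: "(M has_sum K) UNIV"
    and g: "\<And>x. x \<in> polybox S a r \<Longrightarrow> ((\<lambda>n. f n x) has_sum g x) UNIV"
  shows "series_bounded S a r g K"
proof -
  have "\<forall>n. \<exists>c N. ((\<lambda>m. \<bar>c m\<bar> * weight S m (\<lambda>_. r)) has_sum N) (exponents S) \<and> N \<le> M n \<and>
       (\<forall>x\<in>polybox S a r. ((\<lambda>m. c m * weight S m (\<lambda>s. x s - a s)) has_sum f n x) (exponents S))"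
    using f unfolding series_bounded_def by blast
  from choice[OF this] obtain c where "\<forall>n. \<exists>N. ((\<lambda>m. \<bar>c n m\<bar> * weight S m (\<lambda>_. r)) has_sum N) (exponents S) \<and> N \<le> M n \<and>
       (\<forall>x\<in>polybox S a r. ((\<lambda>m. c n m * weight S m (\<lambda>s. x s - a s)) has_sum f n x) (exponents S))"
    by blast
  from choice[OF this] obtain N where
    N: "\<And>n. ((\<lambda>m. \<bar>c n m\<bar> * weight S m (\<lambda>_. r)) has_sum N n) (exponents S)" "\<And>n. N n \<le> M n"
    and fc: "\<And>n x. x \<in> polybox S a r \<Longrightarrow> ((\<lambda>m. c n m * weight S m (\<lambda>s. x s - a s)) has_sum f n x) (exponents S)"
    by blast
  have w: "0 < weight S m (\<lambda>_. r)" for m by (rule weight_pos[OF r_pos])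
  have N0: "0 \<le> N n" for n
    by (rule has_sum_nonneg[OF N(1)]) (use w in \<open>simp add: less_imp_le\<close>)
  have "N summable_on UNIV"
    by (rule summable_on_comparison_test[OF has_sum_imp_summable[OF M]]) (use N N0 in auto)
  then obtain K' where K': "(N has_sum K') UNIV" by (auto simp: summable_on_def)
  have "K' \<le> K" by (rule has_sum_mono[OF K' M]) (use N in auto)
  let ?A = "\<lambda>p. \<bar>c (fst p) (snd p)\<bar> * weight S (snd p) (\<lambda>_. r)"
  have sA: "?A summable_on (UNIV \<times> exponents S)"
    by (rule summable_on_SigmaI[where g = N])
      (use N w in \<open>auto simp: less_imp_le has_sum_imp_summable[OF K']\<close>)
  have A: "(?A has_sum K') (UNIV \<times> exponents S)"
    by (rule has_sum_SigmaI[OF _ K' sA]) (use N in auto)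
  have X: "((\<lambda>p. c (fst p) (snd p) * weight S (snd p) (\<lambda>s. x s - a s)) has_sum g x) (UNIV \<times> exponents S)"
    if x: "x \<in> polybox S a r" for x
  proof (rule has_sum_SigmaI[OF _ g[OF x]])
    have "(\<lambda>p. norm (c (fst p) (snd p) * weight S (snd p) (\<lambda>s. x s - a s))) summable_on (UNIV \<times> exponents S)"
      by (rule summable_on_comparison_test[OF sA])
        (use abs_weight_le[OF x] in \<open>auto simp: abs_mult intro!: mult_left_mono\<close>)
    then show "(\<lambda>p. c (fst p) (snd p) * weight S (snd p) (\<lambda>s. x s - a s)) summable_on (UNIV \<times> exponents S)"
      by (rule abs_summable_summable)
  qed (use fc[OF x] in auto)
  show ?thesis
    by (rule series_boundedI[OF _ A \<open>K' \<le> K\<close> X]) auto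
qed

lemma series_bounded_add:
  assumes "series_bounded S a r f M" "series_bounded S a r g N"
  shows "series_bounded S a r (\<lambda>x. f x + g x) (M + N)"
proof (rule series_bounded_sums)
  show "series_bounded S a r (if n = 0 then f else if n = 1 then g else (\<lambda>_. 0))
    (if n = 0 then M else if n = 1 then N else 0)" for n :: nat
    using assms series_bounded_const[of 0] by auto
  show "((\<lambda>n::nat. if n = 0 then M else if n = 1 then N else 0) has_sum M + N) UNIV"
    by (rule has_sum_finite_neutralI[of "{0, 1::nat}"]) auto
  show "((\<lambda>n::nat. (if n = 0 then f else if n = 1 then g else (\<lambda>_. 0)) x) has_sum f x + g x) UNIV" for x
    by (rule has_sum_finite_neutralI[of "{0, 1::nat}"]) auto
qed

lemma series_bounded_sum:
  assumes "finite I" "\<And>i. i \<in> I \<Longrightarrow> series_bounded S a r (f i) (M i)"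
  shows "series_bounded S a r (\<lambda>x. \<Sum>i\<in>I. f i x) (sum M I)"
  using assms series_bounded_const[of 0]
  by (induction I rule: finite_induct) (auto intro: series_bounded_add)

text \<open>The Cauchy product, indexed by pairs of exponents and evaluated at their sum; collecting
  equal sums is left to \<open>series_boundedI\<close>.\<close>

lemma series_bounded_mult:
  assumes "series_bounded S a r f M" "series_bounded S a r g N"
  shows "series_bounded S a r (\<lambda>x. f x * g x) (M * N)"
proof -
  obtain c M' where c: "((\<lambda>m. \<bar>c m\<bar> * weight S m (\<lambda>_. r)) has_sum M') (exponents S)" "M' \<le> M"
    "\<And>x. x \<in> polybox S a r \<Longrightarrow> ((\<lambda>m. c m * weight S m (\<lambda>s. x s - a s)) has_sum f x) (exponents S)"
    using assms(1) unfolding series_bounded_def by blast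
  obtain d N' where d: "((\<lambda>m. \<bar>d m\<bar> * weight S m (\<lambda>_. r)) has_sum N') (exponents S)" "N' \<le> N"
    "\<And>x. x \<in> polybox S a r \<Longrightarrow> ((\<lambda>m. d m * weight S m (\<lambda>s. x s - a s)) has_sum g x) (exponents S)"
    using assms(2) unfolding series_bounded_def by blast
  have w: "0 < weight S m (\<lambda>_. r)" for m by (rule weight_pos[OF r_pos])
  have nn: "0 \<le> M'" "0 \<le> N'"
    by (rule has_sum_nonneg[OF c(1)], use w in \<open>simp add: less_imp_le\<close>)
      (rule has_sum_nonneg[OF d(1)], use w in \<open>simp add: less_imp_le\<close>)
  let ?A = "\<lambda>p. \<bar>c (fst p) * d (snd p)\<bar> * weight S (fst p + snd p) (\<lambda>_. r)"
  have fib: "((\<lambda>n. u m * v n * weight S (m + n) y) has_sum u m * weight S m y * h) (exponents S)"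
    if "((\<lambda>n. v n * weight S n y) has_sum h) (exponents S)" for u v :: "_ \<Rightarrow> real" and m y h
    using has_sum_cmult_right[OF that, of "u m * weight S m y"]
    by (simp add: weight_add algebra_simps)
  have 1: "((\<lambda>n. ?A (m, n)) has_sum \<bar>c m\<bar> * weight S m (\<lambda>_. r) * N') (exponents S)" for m
    using fib[OF d(1), of "\<lambda>m. \<bar>c m\<bar>"] by (simp add: abs_mult)
  have 2: "((\<lambda>m. \<bar>c m\<bar> * weight S m (\<lambda>_. r) * N') has_sum M' * N') (exponents S)"
    by (rule has_sum_cmult_left[OF c(1)])
  have sA: "?A summable_on (exponents S \<times> exponents S)"
    by (rule summable_on_SigmaI[OF 1 has_sum_imp_summable[OF 2]]) (use w in \<open>auto simp: less_imp_le\<close>)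
  have A: "(?A has_sum M' * N') (exponents S \<times> exponents S)"
    by (rule has_sum_SigmaI[OF 1 2 sA])
  have X: "((\<lambda>p. (c (fst p) * d (snd p)) * weight S (fst p + snd p) (\<lambda>s. x s - a s)) has_sum f x * g x)
      (exponents S \<times> exponents S)" if x: "x \<in> polybox S a r" for x
  proof (rule has_sum_SigmaI)
    show "((\<lambda>m. c m * weight S m (\<lambda>s. x s - a s) * g x) has_sum f x * g x) (exponents S)"
      by (rule has_sum_cmult_left[OF c(3)[OF x]])
    have "(\<lambda>p. norm ((c (fst p) * d (snd p)) * weight S (fst p + snd p) (\<lambda>s. x s - a s)))
        summable_on (exponents S \<times> exponents S)"
      by (rule summable_on_comparison_test[OF sA])
        (use abs_weight_le[OF x] in \<open>auto simp: abs_mult intro!: mult_left_mono\<close>)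
    then show "(\<lambda>p. (c (fst p) * d (snd p)) * weight S (fst p + snd p) (\<lambda>s. x s - a s))
        summable_on (exponents S \<times> exponents S)"
      by (rule abs_summable_summable)
  qed (use fib[OF d(3)[OF x]] in auto)
  have "M' * N' \<le> M * N" by (rule mult_mono) (use c d nn in auto)
  moreover have "fst p + snd p \<in> exponents S" if "p \<in> exponents S \<times> exponents S" for p
    using that keys_add[of "fst p" "snd p"] unfolding exponents_def by fastforce
  ultimately show ?thesis
    by (intro series_boundedI[OF _ A _ X]) auto
qed

lemma series_bounded_scale:
  "series_bounded S a r f M \<Longrightarrow> series_bounded S a r (\<lambda>x. k * f x) (\<bar>k\<bar> * M)"
  by (rule series_bounded_mult[OF series_bounded_const])

lemma series_bounded_bound:
  assumes "series_bounded S a r f M" "x \<in> polybox S a r" shows "\<bar>f x\<bar> \<le> M"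
proof -
  obtain c N where c: "((\<lambda>m. \<bar>c m\<bar> * weight S m (\<lambda>_. r)) has_sum N) (exponents S)" "N \<le> M"
    "((\<lambda>m. c m * weight S m (\<lambda>s. x s - a s)) has_sum f x) (exponents S)"
    using assms unfolding series_bounded_def by blast
  have "(\<lambda>m. norm (c m * weight S m (\<lambda>s. x s - a s))) summable_on (exponents S)"
    by (rule summable_on_comparison_test[OF has_sum_imp_summable[OF c(1)]])
      (use abs_weight_le[OF assms(2)] in \<open>auto simp: abs_mult intro!: mult_left_mono\<close>)
  then obtain K where K: "((\<lambda>m. norm (c m * weight S m (\<lambda>s. x s - a s))) has_sum K) (exponents S)"
    by (auto simp: summable_on_def)
  have "K \<le> N" by (rule has_sum_mono[OF K c(1)])
      (use abs_weight_le[OF assms(2)] in \<open>auto simp: abs_mult intro!: mult_left_mono\<close>)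
  then show ?thesis using norm_has_sum_bound[OF K c(3)] c(2) by simp
qed

lemma series_bounded_nonneg: "series_bounded S a r f M \<Longrightarrow> 0 \<le> M"
  using series_bounded_bound[of f M a] r_pos by (force simp: polybox_def)

text \<open>The Lipschitz bound of z^j on the ball of radius \<open>\<rho>\<close>, by u^(j+1) -
  v^(j+1) = u (u^j - v^j) + (u - v) v^j. For \<open>j = 0\<close> the truncated exponent is harmless
  since the factor \<open>j\<close> is zero.\<close>

lemma series_bounded_power_diff:
  assumes u: "series_bounded S a r u \<rho>" and v: "series_bounded S a r v \<rho>"
    and uv: "series_bounded S a r (\<lambda>x. u x - v x) \<delta>"
  shows "series_bounded S a r (\<lambda>x. u x ^ j - v x ^ j) (j * \<rho> ^ (j - 1) * \<delta>)"
proof (induction j)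
  case 0
  then show ?case using series_bounded_const[of 0] by simp
next
  case (Suc j)
  have vj: "series_bounded S a r (\<lambda>x. v x ^ j) (\<rho> ^ j)"
    using series_bounded_const[of 1] v by (induction j) (auto intro: series_bounded_mult)
  have "series_bounded S a r (\<lambda>x. u x * (u x ^ j - v x ^ j) + (u x - v x) * v x ^ j)
      (\<rho> * (j * \<rho> ^ (j - 1) * \<delta>) + \<delta> * \<rho> ^ j)"
    by (intro series_bounded_add series_bounded_mult Suc u uv vj)
  moreover have "\<rho> * (j * \<rho> ^ (j - 1) * \<delta>) + \<delta> * \<rho> ^ j = Suc j * \<rho> ^ (Suc j - 1) * \<delta>"
    by (cases j) (simp_all add: algebra_simps)
  moreover have "u x * (u x ^ j - v x ^ j) + (u x - v x) * v x ^ j = u x ^ Suc j - v x ^ Suc j" for x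
    by (simp add: algebra_simps)
  ultimately show ?case by simp
qed

end

section \<open>The analytic implicit function theorem for polynomials\<close>

text \<open>The l1 norm of f - f(a) is O(r) as the radius shrinks, with one constant for all r \<le>
  1. Hence a coefficient that vanishes at \<open>a\<close> becomes small in norm on a small
  box.\<close>

definition vanishing_series :: "real set \<Rightarrow> (real \<Rightarrow> real) \<Rightarrow> ((real \<Rightarrow> real) \<Rightarrow> real) \<Rightarrow> bool"
  where "vanishing_series S a f \<longleftrightarrow>
    (\<exists>C\<ge>0. \<forall>r. 0 < r \<longrightarrow> r \<le> 1 \<longrightarrow> series_bounded S a r (\<lambda>x. f x - f a) (C * r))"

context
  fixes S :: "real set" and a :: "real \<Rightarrow> real"
  assumes finite_S: "finite S"
begin

lemma vanishing_series_const: "vanishing_series S a (\<lambda>_. k)"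
  unfolding vanishing_series_def
  by (rule exI[of _ 0]) (use series_bounded_const[OF finite_S, of _ a 0] in auto)

lemma vanishing_series_var: "s \<in> S \<Longrightarrow> vanishing_series S a (\<lambda>x. x s)"
  unfolding vanishing_series_def
  by (rule exI[of _ 1]) (use series_bounded_var[OF finite_S, of _ s a] in auto)

lemma vanishing_series_add:
  assumes "vanishing_series S a f" "vanishing_series S a g"
  shows "vanishing_series S a (\<lambda>x. f x + g x)"
proof -
  obtain C D where C: "C \<ge> 0" "\<And>r. 0 < r \<Longrightarrow> r \<le> 1 \<Longrightarrow> series_bounded S a r (\<lambda>x. f x - f a) (C * r)"
    and D: "D \<ge> 0" "\<And>r. 0 < r \<Longrightarrow> r \<le> 1 \<Longrightarrow> series_bounded S a r (\<lambda>x. g x - g a) (D * r)"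
    using assms unfolding vanishing_series_def by blast
  show ?thesis unfolding vanishing_series_def
  proof (intro exI[of _ "C + D"] conjI allI impI)
    fix r :: real assume "0 < r" "r \<le> 1"
    then show "series_bounded S a r (\<lambda>x. (f x + g x) - (f a + g a)) ((C + D) * r)"
      using series_bounded_add[OF finite_S _ C(2) D(2), of r]
      by (simp add: algebra_simps)
  qed (use C D in auto)
qed

lemma vanishing_series_mult:
  assumes "vanishing_series S a f" "vanishing_series S a g"
  shows "vanishing_series S a (\<lambda>x. f x * g x)"
proof -
  obtain C D where C: "C \<ge> 0" "\<And>r. 0 < r \<Longrightarrow> r \<le> 1 \<Longrightarrow> series_bounded S a r (\<lambda>x. f x - f a) (C * r)"
    and D: "D \<ge> 0" "\<And>r. 0 < r \<Longrightarrow> r \<le> 1 \<Longrightarrow> series_bounded S a r (\<lambda>x. g x - g a) (D * r)"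
    using assms unfolding vanishing_series_def by blast
  let ?E = "C * D + \<bar>f a\<bar> * D + \<bar>g a\<bar> * C"
  show ?thesis unfolding vanishing_series_def
  proof (intro exI[of _ ?E] conjI allI impI)
    fix r :: real assume r: "0 < r" "r \<le> 1"
    have 1: "series_bounded S a r
        (\<lambda>x. ((f x - f a) * (g x - g a) + f a * (g x - g a)) + g a * (f x - f a))
        ((C * r) * (D * r) + \<bar>f a\<bar> * (D * r) + \<bar>g a\<bar> * (C * r))"
      by (rule series_bounded_add[OF finite_S r(1)
            series_bounded_add[OF finite_S r(1)
              series_bounded_mult[OF finite_S r(1) C(2)[OF r] D(2)[OF r]]
              series_bounded_scale[OF finite_S r(1) D(2)[OF r]]]
            series_bounded_scale[OF finite_S r(1) C(2)[OF r]]])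
    \<comment> \<open>This is where r \<le> 1 enters: it makes the quadratic term linear in
      \<open>r\<close>.\<close>
    have 2: "(C * r) * (D * r) \<le> C * D * r"
      using mult_left_mono[OF r(2), of "C * D * r"] C(1) D(1) r by (simp add: algebra_simps)
    then have 3: "(C * r) * (D * r) + \<bar>f a\<bar> * (D * r) + \<bar>g a\<bar> * (C * r) \<le> ?E * r"
      by (simp add: algebra_simps)
    have 4: "((f x - f a) * (g x - g a) + f a * (g x - g a)) + g a * (f x - f a) = f x * g x - f a * g a" for x
      by (simp add: algebra_simps)
    show "series_bounded S a r (\<lambda>x. f x * g x - f a * g a) (?E * r)"
      using series_bounded_mono[OF finite_S r(1) 1 3] by (simp only: 4)
  qed (use C D in auto)
qed

lemma vanishing_series_prod:
  "(\<And>i. i \<in> I \<Longrightarrow> vanishing_series S a (f i)) \<Longrightarrow> vanishing_series S a (\<lambda>x. \<Prod>i\<in>I. f i x)"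
  by (induction I rule: infinite_finite_induct)
    (auto intro: vanishing_series_const vanishing_series_mult)

lemma vanishing_series_sum:
  "(\<And>i. i \<in> I \<Longrightarrow> vanishing_series S a (f i)) \<Longrightarrow> vanishing_series S a (\<lambda>x. \<Sum>i\<in>I. f i x)"
  by (induction I rule: infinite_finite_induct)
    (auto intro: vanishing_series_const vanishing_series_add)

lemma vanishing_series_power:
  "vanishing_series S a f \<Longrightarrow> vanishing_series S a (\<lambda>x. f x ^ n)"
  by (induction n) (auto intro: vanishing_series_const vanishing_series_mult)

lemma vanishing_series_rat_mpoly:
  assumes "q \<in> rat_mpolys S" shows "vanishing_series S a (rat_mpoly_eval q)"
  using assms unfolding rat_mpoly_eval_def[abs_def] rat_mpolys_def
  by (auto intro!: vanishing_series_sum vanishing_series_mult vanishing_series_const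
      vanishing_series_prod vanishing_series_power vanishing_series_var)

text \<open>These are the Taylor coefficients of p(x, c + w) in w. They are polynomials in
  \<open>x\<close>; the induction is the Horner scheme for the composition.\<close>

lemma vanishing_series_shift:
  assumes "p \<in> rat_polys S"
  shows "vanishing_series S a (\<lambda>x. poly.coeff (pcompose (poly_at p x) [:c, 1:]) j)"
  using assms
proof (induction p arbitrary: j)
  case 0
  show ?case by (simp add: vanishing_series_const)
next
  case (pCons q p)
  have IH: "vanishing_series S a (\<lambda>x. poly.coeff (pcompose (poly_at p x) [:c, 1:]) i)" for i
    using pCons by (simp add: rat_polys_pCons_iff)
  have q: "vanishing_series S a (rat_mpoly_eval q)"
    using pCons.prems by (auto simp: rat_polys_pCons_iff intro: vanishing_series_rat_mpoly)
  have "vanishing_series S a (\<lambda>x. (if j = 0 then rat_mpoly_eval q x else 0) +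
    (c * poly.coeff (pcompose (poly_at p x) [:c, 1:]) j +
      (if j = 0 then 0 else poly.coeff (pcompose (poly_at p x) [:c, 1:]) (j - 1))))"
    by (intro vanishing_series_add vanishing_series_mult vanishing_series_const IH)
      (cases "j = 0", use q IH vanishing_series_const in auto)+
  then show ?case
    by (cases j) (simp_all add: poly_at_pCons pcompose_pCons coeff_pCons)
qed

lemma vanishing_series_bound:
  assumes "finite I" "\<And>i. i \<in> I \<Longrightarrow> vanishing_series S a (f i)"
  shows "\<exists>B>0. \<forall>i\<in>I. \<forall>r. 0 < r \<longrightarrow> r \<le> 1 \<longrightarrow>
    series_bounded S a r (\<lambda>x. f i x - f i a) (B * r) \<and> series_bounded S a r (f i) B"
  using assms
proof (induction I rule: finite_induct)
  case empty
  show ?case by (rule exI[of _ 1]) auto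
next
  case (insert i I)
  then obtain B where B: "B > 0" "\<forall>i\<in>I. \<forall>r. 0 < r \<longrightarrow> r \<le> 1 \<longrightarrow>
    series_bounded S a r (\<lambda>x. f i x - f i a) (B * r) \<and> series_bounded S a r (f i) B" by auto
  obtain C where C: "C \<ge> 0" "\<And>r. 0 < r \<Longrightarrow> r \<le> 1 \<Longrightarrow> series_bounded S a r (\<lambda>x. f i x - f i a) (C * r)"
    using insert.prems[of i] unfolding vanishing_series_def by blast
  define D where "D = B + C + \<bar>f i a\<bar>"
  have D: "series_bounded S a r (\<lambda>x. f j x - f j a) (D * r) \<and> series_bounded S a r (f j) D"
    if "j \<in> insert i I" "0 < r" "r \<le> 1" for j r
  proof (cases "j = i")
    case True
    have "series_bounded S a r (\<lambda>x. (f i x - f i a) + f i a) (C * r + \<bar>f i a\<bar>)"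
      by (intro series_bounded_add[OF finite_S that(2)] series_bounded_const[OF finite_S that(2)] C that)
    moreover have "C * r + \<bar>f i a\<bar> \<le> D"
      using mult_left_mono[OF that(3) C(1)] B(1) by (simp add: D_def)
    moreover have "C * r \<le> D * r" using B(1) that by (simp add: D_def mult_right_mono)
    ultimately show ?thesis using series_bounded_mono[OF finite_S that(2)] C(2)[OF that(2,3)] True
      by auto
  next
    case False
    then have "series_bounded S a r (\<lambda>x. f j x - f j a) (B * r)" "series_bounded S a r (f j) B"
      using B that by auto
    moreover have "B \<le> D" "B * r \<le> D * r" using C(1) that by (auto simp: D_def mult_right_mono)
    ultimately show ?thesis using series_bounded_mono[OF finite_S that(2)] by blast
  qed
  have "D > 0" using B C by (simp add: D_def)
  with D show ?case by blast
qed

text \<open>Contraction argument for w = sum_j gamma_j w^j, where gamma_0 and gamma_1 vanish at a.\<close>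

lemma series_fixed_point:
  fixes \<gamma> :: "nat \<Rightarrow> (real \<Rightarrow> real) \<Rightarrow> real"
  assumes \<gamma>: "\<And>j. vanishing_series S a (\<gamma> j)" "\<gamma> 0 a = 0" "\<gamma> 1 a = 0" and "\<rho>0 > 0"
  obtains r w where "0 < r" "series_bounded S a r w \<rho>0"
    "\<And>x. x \<in> polybox S a r \<Longrightarrow> (\<Sum>j\<le>d. \<gamma> j x * w x ^ j) = w x"
proof -
  \<comment> \<open>The range reaches \<open>Suc d\<close> so that it contains the index 1 even when
    \<open>d = 0\<close>.\<close>
  obtain B where B: "B > 0" and \<gamma>B: "\<And>j r. j \<le> Suc d \<Longrightarrow> 0 < r \<Longrightarrow> r \<le> 1 \<Longrightarrow>
      series_bounded S a r (\<lambda>x. \<gamma> j x - \<gamma> j a) (B * r) \<and> series_bounded S a r (\<gamma> j) B"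
    using vanishing_series_bound[of "{..Suc d}" \<gamma>] \<gamma>(1) by auto
  define K where "K = (\<Sum>j\<le>d. real j)"
  have K: "K \<ge> 0" by (simp add: K_def sum_nonneg)
  \<comment> \<open>On the ball of radius \<rho> \<le> 1 the term of index j \<ge> 2 has Lipschitz
    constant at most B \<rho> j; the last bound makes these constants add up to at most 1/4.\<close>
  define \<rho> where "\<rho> = min (min \<rho>0 1) (1 / (4 * B * (K + 1)))"
  have \<rho>: "\<rho> > 0" "\<rho> \<le> \<rho>0" "\<rho> \<le> 1" using assms B K by (auto simp: \<rho>_def)
  have "\<rho> \<le> 1 / (4 * B * (K + 1))" by (simp add: \<rho>_def)
  moreover have "0 < 4 * B * (K + 1)" using B K by simp
  ultimately have "\<rho> * (4 * B * (K + 1)) \<le> 1" by (simp only: pos_le_divide_eq)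
  moreover have "\<rho> * (4 * B * K) \<le> \<rho> * (4 * B * (K + 1))"
    using \<rho> B by (intro mult_left_mono) auto
  ultimately have BK: "B * \<rho> * K \<le> 1 / 4" by (simp add: algebra_simps)
  \<comment> \<open>With B r \<le> \<rho>/4 the constant term has norm at most \<rho>/2, which
    bounds the first iterate, and the linear term has Lipschitz constant at most 1/4.\<close>
  define r where "r = min 1 (\<rho> / (4 * B))"
  have r: "r > 0" "r \<le> 1" using \<rho> B by (auto simp: r_def)
  have "r \<le> \<rho> / (4 * B)" by (simp add: r_def)
  then have "B * r \<le> \<rho> / 4" using B by (simp add: field_simps)
  then have Br: "B * r \<le> \<rho> / 2" "B * r \<le> 1 / 4" using \<rho> by auto
  note sb = series_bounded_add[OF finite_S r(1)] series_bounded_mult[OF finite_S r(1)]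
  note mono = series_bounded_mono[OF finite_S r(1)]
  have \<gamma>j: "series_bounded S a r (\<gamma> j) B" if "j \<le> d" for j using \<gamma>B[of j r] that r by auto
  have \<gamma>0: "series_bounded S a r (\<gamma> 0) (B * r)" using \<gamma>B[of 0 r] \<gamma>(2) r by auto
  have \<gamma>1: "series_bounded S a r (\<gamma> 1) (B * r)" using \<gamma>B[of 1 r] \<gamma>(3) r by auto
  define \<Phi> where "\<Phi> u x = (\<Sum>j\<le>d. \<gamma> j x * u x ^ j)" for u x
  \<comment> \<open>A contraction with factor 1/2 on the ball of radius \<open>\<rho>\<close>: one
    quarter comes from the linear term and one quarter from the bounds B \<rho> j.\<close>
  have lip: "series_bounded S a r (\<lambda>x. \<Phi> u x - \<Phi> v x) (\<delta> / 2)"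
    if u: "series_bounded S a r u \<rho>" and v: "series_bounded S a r v \<rho>"
      and uv: "series_bounded S a r (\<lambda>x. u x - v x) \<delta>" for u v \<delta>
  proof -
    have \<delta>: "\<delta> \<ge> 0" by (rule series_bounded_nonneg[OF finite_S r(1) uv])
    have "series_bounded S a r (\<lambda>x. \<gamma> j x * (u x ^ j - v x ^ j))
        ((if j = 1 then \<delta> / 4 else 0) + B * \<rho> * \<delta> * j)" if "j \<le> d" for j
    proof (cases "j \<le> 1")
      case False
      have "\<rho> ^ (j - 1) \<le> \<rho>"
        using power_decreasing[of 1 "j - 1" \<rho>] \<rho> False by simp
      then have "B * (j * \<rho> ^ (j - 1) * \<delta>) \<le> B * (j * \<rho> * \<delta>)"
        using B \<delta> by (intro mult_left_mono mult_right_mono) auto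
      moreover have "series_bounded S a r (\<lambda>x. \<gamma> j x * (u x ^ j - v x ^ j)) (B * (j * \<rho> ^ (j - 1) * \<delta>))"
        by (intro sb series_bounded_power_diff[OF finite_S r(1)] u v uv \<gamma>j that)
      ultimately show ?thesis using False mono by (simp add: algebra_simps)
    next
      case True
      then consider "j = 0" | "j = 1" by linarith
      then show ?thesis
      proof cases
        case 2
        have "series_bounded S a r (\<lambda>x. \<gamma> 1 x * (u x - v x)) (B * r * \<delta>)" by (intro sb \<gamma>1 uv)
        moreover have "B * r * \<delta> \<le> \<delta> / 4 + B * \<rho> * \<delta>"
          using mult_right_mono[OF Br(2) \<delta>] B \<rho> \<delta> by (simp add: add_increasing2)
        ultimately show ?thesis using 2 mono by simp
      qed (use series_bounded_const[OF finite_S r(1), of a 0] in auto)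
    qed
    then have "series_bounded S a r (\<lambda>x. \<Sum>j\<le>d. \<gamma> j x * (u x ^ j - v x ^ j))
        (\<Sum>j\<le>d. (if j = 1 then \<delta> / 4 else 0) + B * \<rho> * \<delta> * j)"
      by (intro series_bounded_sum[OF finite_S r(1)]) auto
    moreover have "(\<Sum>j\<le>d. (if j = 1 then \<delta> / 4 else 0) + B * \<rho> * \<delta> * j) \<le> \<delta> / 2"
    proof -
      have "(\<Sum>j\<le>d. (if j = 1 then \<delta> / 4 else 0)) \<le> \<delta> / 4" using \<delta> by simp
      moreover have "(\<Sum>j\<le>d. B * \<rho> * \<delta> * j) = \<delta> * (B * \<rho> * K)"
        by (simp add: K_def sum_distrib_left mult.assoc mult.left_commute)
      moreover have "\<delta> * (B * \<rho> * K) \<le> \<delta> * (1 / 4)" by (intro mult_left_mono BK \<delta>)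
      ultimately show ?thesis by (simp add: sum.distrib)
    qed
    ultimately show ?thesis
      using mono by (simp add: \<Phi>_def sum_subtractf right_diff_distrib)
  qed
  define w where "w n = (\<Phi> ^^ n) (\<lambda>_. 0)" for n
  have w0: "w 0 = (\<lambda>_. 0)" and wS: "w (Suc n) = \<Phi> (w n)" for n by (simp_all add: w_def)
  \<comment> \<open>Increments halve from \<rho>/2 on, so no iterate leaves the ball of radius
    \<open>\<rho>\<close> on which \<open>lip\<close> applies.\<close>
  have main: "series_bounded S a r (w n) (\<rho> * (1 - 1 / 2 ^ n)) \<and>
      series_bounded S a r (\<lambda>x. w (Suc n) x - w n x) (\<rho> / 2 ^ Suc n)" for n
  proof (induction n)
    case 0
    have "w (Suc 0) x - w 0 x = \<gamma> 0 x" for x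
    proof -
      have "w (Suc 0) x - w 0 x = (\<Sum>j\<le>d. \<gamma> j x * 0 ^ j)" by (simp add: wS w0 \<Phi>_def)
      also have "\<dots> = (\<Sum>j\<in>{0}. \<gamma> j x * 0 ^ j)"
        by (rule sum.mono_neutral_right) (auto simp: zero_power)
      finally show ?thesis by simp
    qed
    then show ?case using mono[OF \<gamma>0 Br(1)] series_bounded_const[OF finite_S r(1), of a 0] w0 by simp
  next
    case (Suc n)
    have "series_bounded S a r (\<lambda>x. w n x + (w (Suc n) x - w n x)) (\<rho> * (1 - 1 / 2 ^ n) + \<rho> / 2 ^ Suc n)"
      by (intro sb) (use Suc in auto)
    moreover have "\<rho> * (1 - 1 / 2 ^ n) + \<rho> / 2 ^ Suc n = \<rho> * (1 - 1 / 2 ^ Suc n)"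
      by (simp add: field_simps)
    ultimately have 1: "series_bounded S a r (w (Suc n)) (\<rho> * (1 - 1 / 2 ^ Suc n))"
      by simp
    have le: "\<rho> * (1 - 1 / 2 ^ k) \<le> \<rho>" for k :: nat using \<rho> by simp
    have "series_bounded S a r (\<lambda>x. \<Phi> (w (Suc n)) x - \<Phi> (w n) x) (\<rho> / 2 ^ Suc n / 2)"
      by (rule lip[OF mono[OF 1 le] mono[OF conjunct1[OF Suc] le] conjunct2[OF Suc]])
    then show ?case using 1 by (simp add: wS)
  qed
  \<comment> \<open>The limit is written as the telescoping series of increments, so that
    \<open>series_bounded_sums\<close> makes it a power series of norm at most
    \<open>\<rho>\<close>.\<close>
  define v where "v x = (\<Sum>\<^sub>\<infinity>n. w (Suc n) x - w n x)" for x
  have geo: "((\<lambda>n. \<rho> / 2 ^ Suc n) has_sum \<rho>) UNIV"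
  proof -
    have "(\<lambda>n. (1 / 2) ^ Suc n :: real) sums 1" by (rule power_half_series)
    from sums_mult[OF this, of \<rho>] have "(\<lambda>n. \<rho> / 2 ^ Suc n) sums \<rho>"
      by (simp add: power_divide)
    then show ?thesis using \<rho> by (intro sums_nonneg_imp_has_sum) auto
  qed
  have sums: "((\<lambda>n. w (Suc n) x - w n x) has_sum v x) UNIV" if x: "x \<in> polybox S a r" for x
  proof -
    have "(\<lambda>n. norm (w (Suc n) x - w n x)) summable_on UNIV"
      by (rule summable_on_comparison_test[OF has_sum_imp_summable[OF geo]])
        (use series_bounded_bound[OF finite_S r(1) conjunct2[OF main] x] in auto)
    then show ?thesis unfolding v_def by (rule has_sum_infsum[OF abs_summable_summable])
  qed
  have "series_bounded S a r v \<rho>"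
    by (rule series_bounded_sums[OF finite_S r(1) conjunct2[OF main] geo sums])
  moreover have "(\<Sum>j\<le>d. \<gamma> j x * v x ^ j) = v x" if x: "x \<in> polybox S a r" for x
  proof -
    have "(\<Sum>i<n. w (Suc i) x - w i x) = w n x" for n
      using sum_lessThan_telescope[of "\<lambda>i. w i x" n] by (simp add: w0)
    then have lim: "(\<lambda>n. w n x) \<longlonglongrightarrow> v x"
      using has_sum_imp_sums[OF sums[OF x]] by (simp add: sums_def)
    then have "(\<lambda>n. \<Sum>j\<le>d. \<gamma> j x * w n x ^ j) \<longlonglongrightarrow> (\<Sum>j\<le>d. \<gamma> j x * v x ^ j)"
      by (intro tendsto_intros)
    moreover have "(\<lambda>n. \<Sum>j\<le>d. \<gamma> j x * w n x ^ j) = (\<lambda>n. w (Suc n) x)"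
      by (simp add: wS \<Phi>_def)
    ultimately show ?thesis
      using LIMSEQ_unique LIMSEQ_Suc[OF lim] by metis
  qed
  ultimately show ?thesis using that[of r v] r mono[OF _ \<rho>(2)] by blast
qed

text \<open>With the root written as c + w, the equation becomes w = w - p(x, c + w) / L, a Newton
  step with the slope \<open>L\<close> frozen at \<open>a\<close>. Its constant and linear
  coefficients vanish at \<open>a\<close>, because \<open>c\<close> is a root there and
  \<open>L\<close> is the linear Taylor coefficient. The bound \<open>\<rho>\<close> later selects
  the right branch.\<close>

lemma analytic_root_local:
  assumes p: "p \<in> rat_polys S" and root: "poly (poly_at p a) c = 0"
    and simple: "poly (pderiv (poly_at p a)) c \<noteq> 0" and "\<rho> > 0"
  obtains r f where "0 < r" "\<exists>M. series_bounded S a r f M"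
    "\<And>x. x \<in> polybox S a r \<Longrightarrow> poly (poly_at p x) (f x) = 0 \<and> \<bar>f x - c\<bar> \<le> \<rho>"
proof -
  define L where "L = poly (pderiv (poly_at p a)) c"
  define b where "b j x = poly.coeff (pcompose (poly_at p x) [:c, 1:]) j" for j x
  \<comment> \<open>The successor ensures that the index 1, which carries the summand w, occurs in
    sums up to \<open>d\<close>.\<close>
  define d where "d = Suc (Polynomial.degree p)"
  have expand: "(\<Sum>j\<le>d. b j x * w ^ j) = poly (poly_at p x) (c + w)" for x w
  proof -
    have "Polynomial.degree (pcompose (poly_at p x) [:c, 1:]) \<le> d"
      using degree_pcompose_le[of "poly_at p x" "[:c, 1:]"]
        map_poly_degree_leq[of "\<lambda>q. rat_mpoly_eval q x" p] by (simp add: d_def)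
    then have "(\<Sum>j\<le>d. b j x * w ^ j) = poly (pcompose (poly_at p x) [:c, 1:]) w"
      unfolding poly_altdef b_def
      by (intro sum.mono_neutral_right) (auto intro: coeff_eq_0)
    then show ?thesis by (simp add: poly_pcompose)
  qed
  have b0: "b 0 a = 0" using root by (simp add: b_def flip: poly_0_coeff_0) (simp add: poly_pcompose)
  have b1: "b 1 a = L"
  proof -
    have "b 1 a = poly (pderiv (pcompose (poly_at p a) [:c, 1:])) 0"
      by (simp add: b_def poly_0_coeff_0 coeff_pderiv)
    then show ?thesis by (simp add: pderiv_pcompose poly_pcompose L_def pderiv_pCons)
  qed
  define \<gamma> where "\<gamma> j x = (if j = 1 then 1 else 0) + (- 1 / L) * b j x" for j x
  have "vanishing_series S a (\<gamma> j)" for j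
    unfolding \<gamma>_def b_def
    by (intro vanishing_series_add vanishing_series_mult vanishing_series_const vanishing_series_shift p)
  moreover have "\<gamma> 0 a = 0" "\<gamma> 1 a = 0" using b0 b1 simple by (auto simp: \<gamma>_def L_def)
  ultimately obtain r w where r: "0 < r" and w: "series_bounded S a r w \<rho>"
    and fp: "\<And>x. x \<in> polybox S a r \<Longrightarrow> (\<Sum>j\<le>d. \<gamma> j x * w x ^ j) = w x"
    using series_fixed_point[of \<gamma> \<rho>] \<open>\<rho> > 0\<close> by blast
  show ?thesis
  proof (rule that[of r "\<lambda>x. c + w x"])
    show "\<exists>M. series_bounded S a r (\<lambda>x. c + w x) M"
      using series_bounded_add[OF finite_S r series_bounded_const[OF finite_S r] w] by blast
    fix x assume x: "x \<in> polybox S a r"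
    have "(\<Sum>j\<le>d. \<gamma> j x * w x ^ j) = (\<Sum>j\<le>d. (if j = 1 then w x else 0) + (- 1 / L) * (b j x * w x ^ j))"
      by (rule sum.cong) (auto simp: \<gamma>_def algebra_simps)
    also have "\<dots> = (\<Sum>j\<le>d. if j = 1 then w x else 0) + (- 1 / L) * poly (poly_at p x) (c + w x)"
      by (simp only: sum.distrib expand sum_distrib_left[symmetric])
    also have "(\<Sum>j\<le>d. if j = 1 then w x else 0) = w x" by (simp add: d_def)
    finally show "poly (poly_at p x) (c + w x) = 0 \<and> \<bar>c + w x - c\<bar> \<le> \<rho>"
      using fp[OF x] simple series_bounded_bound[OF finite_S r w x] by (simp add: L_def)
  qed (rule r)
qed

end

section \<open>Germs at the base point\<close>

definition nash_filter :: "real set \<Rightarrow> (real \<Rightarrow> real) filter"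
  where "nash_filter T = (INF U\<in>basic_nhds T. principal U)"

text \<open>Cubes centred at the base point with arbitrary real radius are easier to shrink and
  intersect than the rational boxes; for nonempty \<open>T\<close> they generate the same
  filter.\<close>

definition cube :: "real set \<Rightarrow> real set \<Rightarrow> real \<Rightarrow> (real \<Rightarrow> real) set"
  where "cube T S \<delta> = {x \<in> T \<rightarrow>\<^sub>E UNIV. \<forall>t\<in>S. \<bar>x t - t\<bar> < \<delta>}"

text \<open>Continuity is asked only at the base point and analyticity nowhere, so ring operations
  are easy to handle. For independent \<open>T\<close> these functions turn out to have exactly the
  germs of Nash functions.\<close>

definition nash_like :: "real set \<Rightarrow> ((real \<Rightarrow> real) \<Rightarrow> real) \<Rightarrow> bool"
  where "nash_like T u \<longleftrightarrow> (\<exists>U. eventually (\<lambda>x. x \<in> U) (nash_filter T) \<and> alg_on T U u) \<and>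
    (u \<longlongrightarrow> u (base_point T)) (nash_filter T)"

lemma cube_mono: "S \<subseteq> S' \<Longrightarrow> \<delta>' \<le> \<delta> \<Longrightarrow> cube T S' \<delta>' \<subseteq> cube T S \<delta>"
  by (fastforce simp: cube_def)

lemma basic_nhd_contains_cube:
  assumes "U \<in> basic_nhds T"
  shows "\<exists>S \<delta>. finite S \<and> S \<subseteq> T \<and> \<delta> > 0 \<and> cube T S \<delta> \<subseteq> U"
proof -
  obtain S c and \<epsilon> :: rat where U: "U = {x \<in> T \<rightarrow>\<^sub>E UNIV. \<forall>t\<in>S. \<bar>x t - of_rat (c t)\<bar> < of_rat \<epsilon>}"
    and S: "finite S" "S \<noteq> {}" "S \<subseteq> T" and c: "\<forall>t\<in>S. \<bar>t - of_rat (c t)\<bar> < of_rat \<epsilon>"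
    using assms unfolding basic_nhds_def by blast
  define \<delta> where "\<delta> = Min ((\<lambda>t. of_rat \<epsilon> - \<bar>t - of_rat (c t)\<bar>) ` S)"
  have "\<delta> > 0" unfolding \<delta>_def using S c by (subst Min_gr_iff) auto
  moreover have "\<delta> \<le> of_rat \<epsilon> - \<bar>t - of_rat (c t)\<bar>" if "t \<in> S" for t
    unfolding \<delta>_def using S that by (intro Min_le) auto
  then have "cube T S \<delta> \<subseteq> U" unfolding U cube_def by force
  ultimately show ?thesis using S by blast
qed

lemma cube_contains_basic_nhd:
  assumes "finite S" "S \<subseteq> T" "\<delta> > 0" "T \<noteq> {}"
  shows "\<exists>U\<in>basic_nhds T. U \<subseteq> cube T S \<delta>"
proof -
  obtain t0 where t0: "t0 \<in> T" using assms by blast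
  obtain \<epsilon> :: rat where \<epsilon>: "0 < real_of_rat \<epsilon>" "real_of_rat \<epsilon> < \<delta> / 2"
    using of_rat_dense[of 0 "\<delta> / 2"] assms by auto
  have "\<exists>c. \<bar>t - real_of_rat c\<bar> < real_of_rat \<epsilon>" for t
  proof -
    obtain q where "t - of_rat \<epsilon> < real_of_rat q" "real_of_rat q < t"
      using of_rat_dense[of "t - of_rat \<epsilon>" t] \<epsilon> by auto
    then show ?thesis by (intro exI[of _ q]) auto
  qed
  then obtain c where c: "\<And>t. \<bar>t - real_of_rat (c t)\<bar> < real_of_rat \<epsilon>" by metis
  \<comment> \<open>Inserting \<open>t0\<close> covers \<open>S = {}\<close>, since
    \<open>basic_nhds\<close> demands a nonempty set of coordinates.\<close>
  let ?U = "{x \<in> T \<rightarrow>\<^sub>E UNIV. \<forall>t\<in>insert t0 S. \<bar>x t - of_rat (c t)\<bar> < of_rat \<epsilon>}"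
  have "?U \<in> basic_nhds T"
    unfolding basic_nhds_def
    by (rule CollectI, rule exI[of _ "insert t0 S"], rule exI[of _ c], rule exI[of _ \<epsilon>])
      (use assms t0 c \<epsilon>(1) in \<open>auto\<close>)
  moreover have "\<bar>x - t\<bar> < \<delta>" if "\<bar>x - of_rat (c t)\<bar> < of_rat \<epsilon>" for x t
    using that c[of t] \<epsilon>(2) by linarith
  then have "?U \<subseteq> cube T S \<delta>" unfolding cube_def by auto
  ultimately show ?thesis by blast
qed

lemma basic_nhds_nonempty: "T \<noteq> {} \<Longrightarrow> basic_nhds T \<noteq> {}"
  using cube_contains_basic_nhd[of "{}" T 1] by auto

lemma base_point_in_cube: "S \<subseteq> T \<Longrightarrow> \<delta> > 0 \<Longrightarrow> base_point T \<in> cube T S \<delta>"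
  by (auto simp: cube_def base_point_def)

text \<open>The basic sets form a filter base: the intersection of two of them contains a cube, and
  hence a third.\<close>

lemma eventually_nash_filter_basic:
  assumes "T \<noteq> {}"
  shows "eventually P (nash_filter T) \<longleftrightarrow> (\<exists>U\<in>basic_nhds T. \<forall>x\<in>U. P x)"
proof -
  have "\<exists>W\<in>basic_nhds T. principal W \<le> inf (principal U) (principal V)"
    if UV: "U \<in> basic_nhds T" "V \<in> basic_nhds T" for U V
  proof -
    obtain S \<delta> where S: "finite S" "S \<subseteq> T" "\<delta> > 0" "cube T S \<delta> \<subseteq> U"
      using basic_nhd_contains_cube[OF UV(1)] by blast
    obtain S' \<delta>' where S': "finite S'" "S' \<subseteq> T" "\<delta>' > 0" "cube T S' \<delta>' \<subseteq> V"
      using basic_nhd_contains_cube[OF UV(2)] by blast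
    obtain W where "W \<in> basic_nhds T" "W \<subseteq> cube T (S \<union> S') (min \<delta> \<delta>')"
      using cube_contains_basic_nhd[of "S \<union> S'" T "min \<delta> \<delta>'"] S S' assms by auto
    moreover have "cube T (S \<union> S') (min \<delta> \<delta>') \<subseteq> U \<inter> V"
      using S S' cube_mono[of S "S \<union> S'" "min \<delta> \<delta>'" \<delta> T] cube_mono[of S' "S \<union> S'" "min \<delta> \<delta>'" \<delta>' T]
      by auto
    ultimately show ?thesis by (intro bexI[of _ W]) auto
  qed
  then show ?thesis
    unfolding nash_filter_def
    using eventually_INF_base[of "basic_nhds T" principal P] basic_nhds_nonempty[OF assms]
    by (auto simp: eventually_principal)
qed

lemma eventually_nash_filter:
  assumes "T \<noteq> {}"
  shows "eventually P (nash_filter T) \<longleftrightarrow>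
    (\<exists>S \<delta>. finite S \<and> S \<subseteq> T \<and> \<delta> > 0 \<and> (\<forall>x\<in>cube T S \<delta>. P x))"
proof
  assume "eventually P (nash_filter T)"
  then obtain U where "U \<in> basic_nhds T" "\<forall>x\<in>U. P x"
    using eventually_nash_filter_basic[OF assms] by blast
  then show "\<exists>S \<delta>. finite S \<and> S \<subseteq> T \<and> \<delta> > 0 \<and> (\<forall>x\<in>cube T S \<delta>. P x)"
    using basic_nhd_contains_cube[of U T] by blast
next
  assume "\<exists>S \<delta>. finite S \<and> S \<subseteq> T \<and> \<delta> > 0 \<and> (\<forall>x\<in>cube T S \<delta>. P x)"
  then obtain S \<delta> where "finite S" "S \<subseteq> T" "\<delta> > 0" and P: "\<forall>x\<in>cube T S \<delta>. P x" by blast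
  then obtain U where "U \<in> basic_nhds T" "U \<subseteq> cube T S \<delta>"
    using cube_contains_basic_nhd[of S T \<delta>] assms by blast
  with P show "eventually P (nash_filter T)"
    unfolding eventually_nash_filter_basic[OF assms] by blast
qed

section \<open>Functions that are algebraic near the base point and continuous at it\<close>

context
  fixes T :: "real set"
  assumes T_nonempty: "T \<noteq> {}"
begin

lemma eventually_base_point: "eventually P (nash_filter T) \<Longrightarrow> P (base_point T)"
  using eventually_nash_filter[OF T_nonempty, of P] base_point_in_cube by blast

lemma base_point_in_basic_nhd: "U \<in> basic_nhds T \<Longrightarrow> base_point T \<in> U"
  using basic_nhd_contains_cube[of U T] base_point_in_cube by blast

lemma eventually_in_basic_nhd: "U \<in> basic_nhds T \<Longrightarrow> eventually (\<lambda>x. x \<in> U) (nash_filter T)"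
  using eventually_nash_filter_basic[OF T_nonempty] by blast

lemma tendsto_var:
  assumes "t \<in> T" shows "((\<lambda>x. x t) \<longlongrightarrow> base_point T t) (nash_filter T)"
proof (rule tendstoI)
  fix e :: real assume "e > 0"
  then show "\<forall>\<^sub>F x in nash_filter T. dist (x t) (base_point T t) < e"
    unfolding eventually_nash_filter[OF T_nonempty] using assms
    by (intro exI[of _ "{t}"] exI[of _ e]) (auto simp: cube_def base_point_def dist_real_def)
qed

text \<open>Cubes are open in each coordinate. Hence an identity valid near the base point may be
  differentiated in Lambda_t at every nearby point, not only at the base point.\<close>

lemma eventually_slice:
  assumes "t \<in> T" "eventually P (nash_filter T)"
  shows "\<forall>\<^sub>F x in nash_filter T. \<forall>\<^sub>F s in nhds (x t). P (x(t := s))"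
proof -
  obtain S \<delta> where S: "finite S" "S \<subseteq> T" "\<delta> > 0" "\<forall>x\<in>cube T S \<delta>. P x"
    using assms(2) unfolding eventually_nash_filter[OF T_nonempty] by blast
  have "\<forall>\<^sub>F s in nhds (x t). P (x(t := s))" if x: "x \<in> cube T S \<delta>" for x
  proof -
    have "x(t := s) \<in> cube T S \<delta>" if s: "t \<in> S \<longrightarrow> s \<in> ball t \<delta>" for s
    proof -
      have "x(t := s) \<in> T \<rightarrow>\<^sub>E UNIV"
        using x assms(1) by (auto simp: cube_def PiE_def extensional_def)
      then show ?thesis using x s by (auto simp: cube_def dist_real_def abs_minus_commute)
    qed
    moreover have "\<forall>\<^sub>F s in nhds (x t). t \<in> S \<longrightarrow> s \<in> ball t \<delta>"
    proof (cases "t \<in> S")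
      case True
      then have "x t \<in> ball t \<delta>" using x by (auto simp: cube_def dist_real_def)
      from eventually_nhds_in_open[OF open_ball this] show ?thesis by simp
    qed simp
    ultimately show ?thesis using S(4) by (auto elim: eventually_mono)
  qed
  then show ?thesis unfolding eventually_nash_filter[OF T_nonempty] using S by blast
qed

lemma tendsto_rat_mpoly_eval:
  assumes "q \<in> rat_mpolys T"
  shows "(rat_mpoly_eval q \<longlongrightarrow> rat_mpoly_eval q (base_point T)) (nash_filter T)"
  using assms unfolding rat_mpoly_eval_def[abs_def] rat_mpolys_def
  by (auto intro!: tendsto_sum tendsto_mult tendsto_const tendsto_prod tendsto_power tendsto_var)

text \<open>The filter \<open>F\<close> is left open in order to cover both continuity along
  \<open>nash_filter T\<close> and joint continuity in (x, z) along a product filter.\<close>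

lemma tendsto_poly_at:
  assumes p: "p \<in> rat_polys T" and u: "(u \<longlongrightarrow> z) F"
    and xf: "filterlim xf (nash_filter T) F"
  shows "((\<lambda>y. poly (poly_at p (xf y)) (u y)) \<longlongrightarrow> poly (poly_at p (base_point T)) z) F"
  unfolding poly_at_eq_sum[OF order_refl]
  by (intro tendsto_sum tendsto_mult tendsto_power u
      filterlim_compose[OF tendsto_rat_mpoly_eval xf] rat_polysD[OF p])

lemma nash_like_cong:
  assumes "nash_like T u" "\<forall>\<^sub>F x in nash_filter T. v x = u x"
  shows "nash_like T v"
proof -
  obtain U where U: "eventually (\<lambda>x. x \<in> U) (nash_filter T)" "alg_on T U u"
    using assms(1) unfolding nash_like_def by blast
  have "eventually (\<lambda>x. x \<in> {x \<in> U. v x = u x}) (nash_filter T)"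
    using U(1) assms(2) by eventually_elim auto
  moreover have "alg_on T {x \<in> U. v x = u x} v"
    by (rule alg_on_cong[OF alg_on_subset[OF U(2)]]) auto
  moreover have "(v \<longlongrightarrow> v (base_point T)) (nash_filter T)"
    using assms(1) tendsto_cong[OF assms(2)] eventually_base_point[OF assms(2)]
    by (simp add: nash_like_def)
  ultimately show ?thesis unfolding nash_like_def by blast
qed

lemma nash_like_combine:
  assumes "nash_like T u" "nash_like T v"
    and "\<And>U. alg_on T U u \<Longrightarrow> alg_on T U v \<Longrightarrow> alg_on T U w"
    and "(w \<longlongrightarrow> w (base_point T)) (nash_filter T)"
  shows "nash_like T w"
proof -
  obtain U V where "eventually (\<lambda>x. x \<in> U) (nash_filter T)" "alg_on T U u"
    and "eventually (\<lambda>x. x \<in> V) (nash_filter T)" "alg_on T V v"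
    using assms(1,2) unfolding nash_like_def by blast
  then have "eventually (\<lambda>x. x \<in> U \<inter> V) (nash_filter T)" "alg_on T (U \<inter> V) w"
    by (auto elim: eventually_elim2 intro: assms(3) alg_on_subset)
  then show ?thesis unfolding nash_like_def using assms(4) by blast
qed

lemma nash_like_tendsto: "nash_like T u \<Longrightarrow> (u \<longlongrightarrow> u (base_point T)) (nash_filter T)"
  by (simp add: nash_like_def)

lemma nash_like_add: "nash_like T u \<Longrightarrow> nash_like T v \<Longrightarrow> nash_like T (\<lambda>x. u x + v x)"
  by (rule nash_like_combine[of u v]) (auto intro: alg_on_add tendsto_add nash_like_tendsto)

lemma nash_like_mult: "nash_like T u \<Longrightarrow> nash_like T v \<Longrightarrow> nash_like T (\<lambda>x. u x * v x)"
  by (rule nash_like_combine[of u v]) (auto intro: alg_on_mult tendsto_mult nash_like_tendsto)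

lemma nash_like_inverse:
  "nash_like T u \<Longrightarrow> u (base_point T) \<noteq> 0 \<Longrightarrow> nash_like T (\<lambda>x. inverse (u x))"
  by (rule nash_like_combine[of u u]) (auto intro: alg_on_inverse tendsto_inverse nash_like_tendsto)

lemma nash_like_rat_mpoly: "q \<in> rat_mpolys T \<Longrightarrow> nash_like T (rat_mpoly_eval q)"
  unfolding nash_like_def using alg_on_poly[of q T UNIV] tendsto_rat_mpoly_eval
  by (auto intro!: exI[of _ UNIV])

lemma nash_like_const: "nash_like T (\<lambda>_. of_rat c)"
proof -
  have "rat_mpoly_eval (rat_const c) = (\<lambda>_. of_rat c)" by (rule ext) simp
  then show ?thesis using nash_like_rat_mpoly[of "rat_const c"] by simp
qed

lemma nash_like_var: "t \<in> T \<Longrightarrow> nash_like T (\<lambda>x. x t)"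
proof -
  have "rat_mpoly_eval (rat_var t) = (\<lambda>x. x t)" by (rule ext) simp
  then show "t \<in> T \<Longrightarrow> nash_like T (\<lambda>x. x t)" using nash_like_rat_mpoly[of "rat_var t"] by simp
qed

lemma nash_like_0: "nash_like T (\<lambda>_. 0)" and nash_like_1: "nash_like T (\<lambda>_. 1)"
  using nash_like_const[of 0] nash_like_const[of 1] by simp_all

lemma nash_like_uminus: "nash_like T u \<Longrightarrow> nash_like T (\<lambda>x. - u x)"
  using nash_like_mult[OF nash_like_const[of "-1"]] by simp

lemma nash_like_diff: "nash_like T u \<Longrightarrow> nash_like T v \<Longrightarrow> nash_like T (\<lambda>x. u x - v x)"
  using nash_like_add[OF _ nash_like_uminus] by simp

lemma nash_like_power: "nash_like T u \<Longrightarrow> nash_like T (\<lambda>x. u x ^ n)"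
  by (induction n) (auto intro: nash_like_1 nash_like_mult)

lemma nash_like_sum: "(\<And>i. i \<in> I \<Longrightarrow> nash_like T (u i)) \<Longrightarrow> nash_like T (\<lambda>x. \<Sum>i\<in>I. u i x)"
  by (induction I rule: infinite_finite_induct) (auto intro: nash_like_0 nash_like_add)

lemma nash_like_poly_at:
  assumes "p \<in> rat_polys T" "nash_like T u"
  shows "nash_like T (\<lambda>x. poly (poly_at p x) (u x))"
  unfolding poly_at_eq_sum[OF order_refl]
  by (intro nash_like_sum nash_like_mult nash_like_power nash_like_rat_mpoly rat_polysD assms)

lemma alg_on_base_point:
  assumes "nash_like T u" shows "alg_on T {base_point T} (\<lambda>_. u (base_point T))"
proof -
  obtain U where U: "eventually (\<lambda>x. x \<in> U) (nash_filter T)" "alg_on T U u"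
    using assms unfolding nash_like_def by blast
  have "alg_on T {base_point T} u"
    using alg_on_subset[OF U(2)] eventually_base_point[OF U(1)] by auto
  then show ?thesis by (rule alg_on_cong) auto
qed

section \<open>Consequences of algebraic independence: uniqueness and existence of germs with a
  given value\<close>

context
  assumes indep: "algebraically_independent T"
begin

lemma rat_mpoly_eval_base_point_eq_0:
  assumes "q \<in> rat_mpolys T" "rat_mpoly_eval q (base_point T) = 0" shows "q = 0"
proof -
  have "rat_mpoly_eval q (\<lambda>t. t) = 0"
    using assms rat_mpoly_eval_cong[OF assms(1), of "base_point T" "\<lambda>t. t"]
    by (simp add: base_point_def)
  then show ?thesis using indep assms(1) unfolding algebraically_independent_def by blast
qed

lemma nash_like_eq_0:
  assumes u: "nash_like T u" and u0: "u (base_point T) = 0"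
  shows "\<forall>\<^sub>F x in nash_filter T. u x = 0"
proof -
  obtain U p where U: "eventually (\<lambda>x. x \<in> U) (nash_filter T)" and p: "p \<in> rat_polys T" "p \<noteq> 0"
    "\<forall>x\<in>U. poly (poly_at p x) (u x) = 0"
    using u unfolding nash_like_def alg_on_def by blast
  \<comment> \<open>The exponent, initially 0, records the powers of Z cancelled so far: in the
    induction on \<open>p\<close>, each zero constant term moves one factor u into the
    power.\<close>
  have "\<forall>\<^sub>F x in nash_filter T. u x ^ 0 * poly (poly_at p x) (u x) = 0"
    using U by eventually_elim (use p in auto)
  then have "\<exists>k. \<forall>\<^sub>F x in nash_filter T. u x ^ k * poly (poly_at p x) (u x) = 0" by blast
  then obtain k where "\<forall>\<^sub>F x in nash_filter T. u x ^ k * poly (poly_at p x) (u x) = 0" by blast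
  then show ?thesis
    using p(1,2)
  proof (induction p arbitrary: k rule: pCons_induct[case_names 0 pCons])
    case (pCons a p)
    show ?case
    proof (cases "a = 0")
      case True
      show ?thesis
        by (rule pCons.IH[of "Suc k"])
          (use pCons True in \<open>auto simp: rat_polys_pCons_iff poly_at_pCons algebra_simps\<close>)
    next
      case False
      define v where "v x = poly (poly_at (pCons a p) x) (u x)" for x
      have "(v \<longlongrightarrow> poly (poly_at (pCons a p) (base_point T)) 0) (nash_filter T)"
        unfolding v_def
        by (rule tendsto_poly_at[OF pCons.prems(2) _ filterlim_ident])
          (use nash_like_tendsto[OF u] u0 in simp)
      moreover have "poly (poly_at (pCons a p) (base_point T)) 0 \<noteq> 0"
        using False rat_mpoly_eval_base_point_eq_0[of a] pCons.prems(2)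
        by (auto simp: poly_at_pCons rat_polys_pCons_iff)
      ultimately have "\<forall>\<^sub>F x in nash_filter T. v x \<noteq> 0"
        by (rule tendsto_imp_eventually_ne)
      then show ?thesis using pCons.prems(1) by eventually_elim (simp add: v_def)
    qed
  qed simp
qed

lemma nash_like_unique:
  assumes "nash_like T u" "nash_like T v" "u (base_point T) = v (base_point T)"
  shows "\<forall>\<^sub>F x in nash_filter T. u x = v x"
  using nash_like_eq_0[OF nash_like_diff[OF assms(1,2)]] assms(3) by simp

text \<open>
  Minimality of the degree of p makes the root simple at the base point; the derivative in Z
  is then positive near it, so the root nearby is unique and hence agrees with the local series.
\<close>

lemma nash_function_exists:
  assumes "alg_on T {base_point T} (\<lambda>_. \<alpha>)"
  obtains U f S p where "U \<in> basic_nhds T" "f (base_point T) = \<alpha>" "finite S" "S \<subseteq> T"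
    "analytic_in_vars S U f" "p \<in> rat_polys T" "p \<noteq> 0"
    "\<And>x. x \<in> U \<Longrightarrow> poly (poly_at p x) (f x) = 0"
    "\<And>x. x \<in> U \<Longrightarrow> poly (poly_at (pderiv p) x) (f x) > 0"
proof -
  let ?x = "base_point T"
  define R where "R p \<longleftrightarrow> p \<in> rat_polys T \<and> p \<noteq> 0 \<and> poly (poly_at p ?x) \<alpha> = 0" for p
  obtain q where "R q" using assms by (auto simp: alg_on_def R_def)
  then obtain q where q: "R q" and qmin: "\<And>q'. R q' \<Longrightarrow> Polynomial.degree q \<le> Polynomial.degree q'"
    using ex_has_least_nat[of R _ Polynomial.degree] by blast
  have "Polynomial.degree q \<noteq> 0"
  proof
    assume "Polynomial.degree q = 0"
    then obtain c where "q = [:c:]" by (rule degree_eq_zeroE)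
    then show False using q rat_mpoly_eval_base_point_eq_0[of c]
      by (auto simp: R_def rat_polys_pCons_iff poly_at_pCons)
  qed
  then have "\<not> R (pderiv q)" "pderiv q \<noteq> 0"
    using qmin[of "pderiv q"] by (auto simp: degree_pderiv pderiv_eq_0_iff)
  then have D: "poly (poly_at (pderiv q) ?x) \<alpha> \<noteq> 0"
    using q by (auto simp: R_def rat_polys_pderiv)
  \<comment> \<open>The sign is chosen to make the derivative in Z positive at the base
    point.\<close>
  define p where "p = (if poly (poly_at (pderiv q) ?x) \<alpha> > 0 then q else - q)"
  have p: "p \<in> rat_polys T" "p \<noteq> 0" "poly (poly_at p ?x) \<alpha> = 0" "poly (poly_at (pderiv p) ?x) \<alpha> > 0"
    using q D by (auto simp: R_def p_def rat_polys_minus poly_at_minus pderiv_minus)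
  define F where "F x z = poly (poly_at p x) z" for x z
  define G where "G x z = poly (poly_at (pderiv p) x) z" for x z
  \<comment> \<open>Joint continuity gives positivity of the derivative on a product of a
    neighbourhood of the base point and an interval around \<open>\<alpha>\<close>, hence strict
    monotonicity in z there.\<close>
  have "((\<lambda>y. poly (poly_at (pderiv p) (fst y)) (snd y)) \<longlongrightarrow> G ?x \<alpha>) (prod_filter (nash_filter T) (nhds \<alpha>))"
    unfolding G_def
    by (rule tendsto_poly_at[OF rat_polys_pderiv[OF p(1)] filterlim_snd filterlim_fst])
  then have "\<forall>\<^sub>F y in prod_filter (nash_filter T) (nhds \<alpha>). G (fst y) (snd y) > 0"
    unfolding G_def using p(4) order_tendstoD(1) by blast
  then obtain P Q where PQ: "eventually P (nash_filter T)" "eventually Q (nhds \<alpha>)"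
    "\<And>x z. P x \<Longrightarrow> Q z \<Longrightarrow> G x z > 0"
    unfolding eventually_prod_filter by auto
  obtain \<eta>' where \<eta>': "\<eta>' > 0" "\<And>z. dist z \<alpha> < \<eta>' \<Longrightarrow> Q z"
    using PQ(2) unfolding eventually_nhds_metric by blast
  \<comment> \<open>Halving makes the closed interval of radius \<open>\<eta>\<close> fit into the
    open one.\<close>
  define \<eta> where "\<eta> = \<eta>' / 2"
  have \<eta>: "\<eta> > 0" "\<And>x z. P x \<Longrightarrow> \<bar>z - \<alpha>\<bar> \<le> \<eta> \<Longrightarrow> G x z > 0"
    using \<eta>' PQ(3) by (auto simp: \<eta>_def dist_real_def)
  have mono: "F x y < F x z" if h: "P x" "\<alpha> - \<eta> \<le> y" "y < z" "z \<le> \<alpha> + \<eta>" for x y z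
  proof -
    obtain \<xi> where "\<xi> > y" "\<xi> < z" "F x z - F x y = (z - y) * G x \<xi>"
      using poly_MVT[OF h(3), of "poly_at p x"] by (auto simp: F_def G_def poly_at_pderiv)
    moreover from this have "G x \<xi> > 0" using that by (intro \<eta>) auto
    ultimately show ?thesis using that(3) by (metis diff_gt_0_iff_gt mult_pos_pos)
  qed
  have Px: "P ?x" using PQ(1) by (rule eventually_base_point)
  have ends: "F ?x (\<alpha> - \<eta>) < 0" "F ?x (\<alpha> + \<eta>) > 0"
    using mono[OF Px, of "\<alpha> - \<eta>" \<alpha>] mono[OF Px, of \<alpha> "\<alpha> + \<eta>"] p(3) \<eta>(1) by (auto simp: F_def)
  have tF: "((\<lambda>x. F x z) \<longlongrightarrow> F ?x z) (nash_filter T)" for z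
    unfolding F_def by (rule tendsto_poly_at[OF p(1) tendsto_const filterlim_ident])
  have "\<forall>\<^sub>F x in nash_filter T. P x \<and> F x (\<alpha> - \<eta>) < 0 \<and> F x (\<alpha> + \<eta>) > 0"
    using PQ(1) order_tendstoD(2)[OF tF ends(1)] order_tendstoD(1)[OF tF ends(2)]
    by eventually_elim auto
  then obtain U where U: "U \<in> basic_nhds T"
    and UP: "\<And>x. x \<in> U \<Longrightarrow> P x \<and> F x (\<alpha> - \<eta>) < 0 \<and> F x (\<alpha> + \<eta>) > 0"
    unfolding eventually_nash_filter_basic[OF T_nonempty] by blast
  have uniq: "y = z" if "x \<in> U" "\<bar>y - \<alpha>\<bar> \<le> \<eta>" "\<bar>z - \<alpha>\<bar> \<le> \<eta>" "F x y = 0" "F x z = 0" for x y z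
  proof -
    have "\<alpha> - \<eta> \<le> y" "y \<le> \<alpha> + \<eta>" "\<alpha> - \<eta> \<le> z" "z \<le> \<alpha> + \<eta>" using that by auto
    then show ?thesis
      using mono[of x y z] mono[of x z y] UP[OF that(1)] that(4,5)
      by (cases y z rule: linorder_cases) auto
  qed
  have ex: "\<exists>z. \<bar>z - \<alpha>\<bar> < \<eta> \<and> F x z = 0" if xU: "x \<in> U" for x
  proof -
    obtain z where "\<alpha> - \<eta> < z" "z < \<alpha> + \<eta>" "F x z = 0"
      using poly_IVT_pos[of "\<alpha> - \<eta>" "\<alpha> + \<eta>" "poly_at p x"] UP[OF xU] \<eta>(1)
      unfolding F_def by auto
    then show ?thesis by (intro exI[of _ z]) auto
  qed
  \<comment> \<open>By \<open>uniq\<close> the choice is unambiguous on \<open>U\<close>, so one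
    branch is fixed on all of \<open>U\<close> before any local series is considered.\<close>
  define f where "f x = (SOME z. \<bar>z - \<alpha>\<bar> < \<eta> \<and> F x z = 0)" for x
  have f: "\<bar>f x - \<alpha>\<bar> < \<eta>" "F x (f x) = 0" if "x \<in> U" for x
    using someI_ex[OF ex[OF that]] by (auto simp: f_def)
  have Gf: "G x (f x) > 0" if "x \<in> U" for x
    using \<eta>(2) UP[OF that] f(1)[OF that] by auto
  obtain S where S: "finite S" "S \<subseteq> T" "p \<in> rat_polys S"
    using finite_vars_rat_polys[OF p(1)] by blast
  have "analytic_in_vars S U f"
    unfolding analytic_in_vars_def
  proof
    fix a assume a: "a \<in> U"
    have "poly (pderiv (poly_at p a)) (f a) \<noteq> 0" "poly (poly_at p a) (f a) = 0"
      using Gf[OF a] f(2)[OF a] by (auto simp: G_def F_def poly_at_pderiv)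
    \<comment> \<open>The tolerance \<eta> - |f a - \<alpha>| keeps the local series root within
      \<open>\<eta>\<close> of \<open>\<alpha>\<close>, where \<open>uniq\<close> identifies it with
      \<open>f\<close>.\<close>
    then obtain r g where r: "r > 0" and g: "\<exists>M. series_bounded S a r g M"
      and gF: "\<And>x. x \<in> polybox S a r \<Longrightarrow> poly (poly_at p x) (g x) = 0 \<and> \<bar>g x - f a\<bar> \<le> \<eta> - \<bar>f a - \<alpha>\<bar>"
      using analytic_root_local[OF S(1,3), of a "f a" "\<eta> - \<bar>f a - \<alpha>\<bar>"] f(1)[OF a] by auto
    obtain c where c: "\<And>x. x \<in> polybox S a r \<Longrightarrow>
        ((\<lambda>m. c m * weight S m (\<lambda>s. x s - a s)) has_sum g x) (exponents S)"
      using g unfolding series_bounded_def by blast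
    have "((\<lambda>m. c m * (\<Prod>s\<in>S. (x s - a s) ^ Poly_Mapping.lookup m s)) has_sum f x)
        {m. Poly_Mapping.keys m \<subseteq> S}" if x: "x \<in> U" "\<forall>s\<in>S. \<bar>x s - a s\<bar> < r" for x
    proof -
      have box: "x \<in> polybox S a r" using x by (auto simp: polybox_def less_imp_le)
      have "g x = f x"
        using uniq[OF x(1), of "g x" "f x"] gF[OF box] f[OF x(1)] by (auto simp: F_def)
      then show ?thesis using c[OF box] by (simp add: weight_def exponents_def)
    qed
    then show "\<exists>r>0. \<exists>c. \<forall>x\<in>U. (\<forall>s\<in>S. \<bar>x s - a s\<bar> < r) \<longrightarrow>
       ((\<lambda>m. c m * (\<Prod>s\<in>S. (x s - a s) ^ Poly_Mapping.lookup m s)) has_sum f x)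
        {m. Poly_Mapping.keys m \<subseteq> S}"
      using r by blast
  qed
  moreover have "f ?x = \<alpha>"
    using uniq[OF base_point_in_basic_nhd[OF U], of "f ?x" \<alpha>] f[OF base_point_in_basic_nhd[OF U]] p(3) \<eta>(1)
    by (auto simp: F_def)
  ultimately show ?thesis
    using that[of U f S p] U S p f(2) Gf unfolding F_def G_def by blast
qed

end
end

section \<open>Analyticity: continuity and partial derivatives\<close>

text \<open>Shrinking the box by l \<le> 1 scales a nonconstant monomial by at most
  \<open>l\<close>, and such a monomial is zero at 0; the constant monomial cancels in the
  difference.\<close>

lemma weight_diff_le:
  assumes "finite S" "m \<in> exponents S" "x \<in> polybox S a (l * \<rho>)" "0 < l" "l \<le> 1" "0 < \<rho>"
  shows "\<bar>weight S m (\<lambda>s. x s - a s) - weight S m (\<lambda>_. 0)\<bar> \<le> l * weight S m (\<lambda>_. \<rho>)"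
proof (cases "m = 0")
  case True
  then show ?thesis using assms by simp
next
  case False
  then obtain s where s: "Poly_Mapping.lookup m s \<noteq> 0" by (metis lookup_zero poly_mapping_eqI)
  with assms(2) have sS: "s \<in> S" by (auto simp: exponents_def in_keys_iff)
  have 0: "weight S m (\<lambda>_. 0) = 0"
    unfolding weight_def using assms(1) sS s by (intro prod_zero) (auto simp: zero_power)
  have "(\<Prod>u\<in>S - {s}. l ^ Poly_Mapping.lookup m u) \<le> 1"
    using assms by (intro prod_le_1) (auto simp: power_le_one)
  moreover have "l ^ Poly_Mapping.lookup m s \<le> l"
    using power_decreasing[of 1 "Poly_Mapping.lookup m s" l] s assms by simp
  ultimately have l: "(\<Prod>u\<in>S. l ^ Poly_Mapping.lookup m u) \<le> l"
    unfolding prod.remove[OF assms(1) sS]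
    using mult_mono[of "l ^ Poly_Mapping.lookup m s" l "\<Prod>u\<in>S - {s}. l ^ Poly_Mapping.lookup m u" 1] assms
    by (simp add: prod_nonneg)
  have "\<bar>weight S m (\<lambda>s. x s - a s)\<bar> \<le> weight S m (\<lambda>_. l * \<rho>)"
    by (rule abs_weight_le[OF assms(3)])
  also have "\<dots> = (\<Prod>u\<in>S. l ^ Poly_Mapping.lookup m u) * weight S m (\<lambda>_. \<rho>)"
    by (simp add: weight_def power_mult_distrib prod.distrib)
  also have "\<dots> \<le> l * weight S m (\<lambda>_. \<rho>)"
    using l weight_pos[OF assms(6), of S m] by (intro mult_right_mono) auto
  finally show ?thesis by (simp add: 0)
qed

lemma analytic_in_varsD:
  assumes "analytic_in_vars S U f" "a \<in> U"
  obtains r c where "r > 0" "\<And>x. x \<in> U \<Longrightarrow> \<forall>s\<in>S. \<bar>x s - a s\<bar> < r \<Longrightarrow>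
    ((\<lambda>m. c m * weight S m (\<lambda>s. x s - a s)) has_sum f x) (exponents S)"
proof -
  have "\<exists>r>0. \<exists>c. \<forall>x\<in>U. (\<forall>s\<in>S. \<bar>x s - a s\<bar> < r) \<longrightarrow>
    ((\<lambda>m. c m * weight S m (\<lambda>s. x s - a s)) has_sum f x) (exponents S)"
    using assms unfolding analytic_in_vars_def weight_def exponents_def by (rule bspec)
  then obtain r c where "r > 0" "\<forall>x\<in>U. (\<forall>s\<in>S. \<bar>x s - a s\<bar> < r) \<longrightarrow>
    ((\<lambda>m. c m * weight S m (\<lambda>s. x s - a s)) has_sum f x) (exponents S)"
    by (elim exE conjE)
  then show ?thesis by (intro that[of r c]) simp_all
qed

text \<open>Unconditional convergence of a real series is absolute, so convergence at one point off
  centre in all S-coordinates bounds the weighted l1 norm by some \<open>N\<close>. On the box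
  shrunk by \<open>l\<close>, f then deviates from its central value by at most l N.\<close>

lemma analytic_in_vars_tendsto:
  assumes T: "T \<noteq> {}" and S: "finite S" "S \<subseteq> T" and U: "U \<in> basic_nhds T"
    and f: "analytic_in_vars S U f"
  shows "(f \<longlongrightarrow> f (base_point T)) (nash_filter T)"
proof (rule tendstoI)
  fix \<epsilon> :: real assume "\<epsilon> > 0"
  let ?a = "base_point T"
  have aU: "?a \<in> U" by (rule base_point_in_basic_nhd[OF T U])
  obtain r c where r: "r > 0" and c: "\<And>x. x \<in> U \<Longrightarrow> \<forall>s\<in>S. \<bar>x s - ?a s\<bar> < r \<Longrightarrow>
    ((\<lambda>m. c m * weight S m (\<lambda>s. x s - ?a s)) has_sum f x) (exponents S)"
    using analytic_in_varsD[OF f aU] by blast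
  obtain S' \<delta> where S': "finite S'" "S' \<subseteq> T" "\<delta> > 0" "cube T S' \<delta> \<subseteq> U"
    using basic_nhd_contains_cube[OF U] by blast
  define \<rho> where "\<rho> = min r \<delta> / 2"
  have \<rho>: "\<rho> > 0" "\<rho> < r" "\<rho> < \<delta>" using r S' by (auto simp: \<rho>_def min_def)
  \<comment> \<open>A point with all S-coordinates shifted by rho: convergence there is absolute.\<close>
  define b where "b = (\<lambda>t\<in>T. t + \<rho>)"
  have "b \<in> cube T S' \<delta>" using S'(2) \<rho> by (auto simp: b_def cube_def)
  with S'(4) have bU: "b \<in> U" by (rule subsetD)
  have ab: "b s - ?a s = \<rho>" if "s \<in> S" for s using that S by (auto simp: b_def base_point_def)
  have "weight S m (\<lambda>s. b s - ?a s) = weight S m (\<lambda>_. \<rho>)" for m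
    unfolding weight_def by (rule prod.cong) (simp_all add: ab)
  then have "((\<lambda>m. c m * weight S m (\<lambda>_. \<rho>)) has_sum f b) (exponents S)"
    using c[OF bU] ab \<rho> by simp
  then have "(\<lambda>m. c m * weight S m (\<lambda>_. \<rho>)) summable_on exponents S"
    by (rule has_sum_imp_summable)
  then have "(\<lambda>m. norm (c m * weight S m (\<lambda>_. \<rho>))) summable_on exponents S"
    by (rule summable_on_iff_abs_summable_on_real[THEN iffD1])
  then obtain N where N: "((\<lambda>m. norm (c m * weight S m (\<lambda>_. \<rho>))) has_sum N) (exponents S)"
    by (auto simp: summable_on_def)
  have N0: "N \<ge> 0" by (rule has_sum_nonneg[OF N]) simp
  \<comment> \<open>Chosen so that l N < \<epsilon>; the summand 1 avoids division by zero when N =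
    0.\<close>
  define l where "l = min 1 (\<epsilon> / (2 * (N + 1)))"
  have l: "0 < l" "l \<le> 1" using \<open>\<epsilon> > 0\<close> N0 by (auto simp: l_def)
  have "l * N < \<epsilon>"
  proof -
    have "l * N \<le> \<epsilon> / (2 * (N + 1)) * N" using N0 by (intro mult_right_mono) (auto simp: l_def)
    also have "\<dots> < \<epsilon>"
      using \<open>\<epsilon> > 0\<close> N0 by (simp add: field_simps add_nonneg_pos)
    finally show ?thesis .
  qed
  have close: "dist (f x) (f ?a) < \<epsilon>" if x: "x \<in> cube T (S' \<union> S) (l * \<rho>)" for x
  proof -
    have l\<rho>: "l * \<rho> \<le> \<rho>" using l \<rho> mult_right_mono[of l 1 \<rho>] by simp
    then have "l * \<rho> \<le> \<delta>" using \<rho> by linarith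
    then have "x \<in> cube T S' \<delta>" using x cube_mono[of S' "S' \<union> S" "l * \<rho>" \<delta> T] by auto
    then have xU: "x \<in> U" using S' by blast
    have xs: "\<bar>x s - ?a s\<bar> < l * \<rho>" if "s \<in> S" for s
      using x that S by (auto simp: cube_def base_point_def)
    then have xb: "x \<in> polybox S ?a (l * \<rho>)" by (auto simp: polybox_def less_imp_le)
    have cx: "((\<lambda>m. c m * weight S m (\<lambda>s. x s - ?a s)) has_sum f x) (exponents S)"
    proof (rule c[OF xU], rule)
      show "\<bar>x s - ?a s\<bar> < r" if "s \<in> S" for s using xs[OF that] l\<rho> \<rho> by linarith
    qed
    have ca: "((\<lambda>m. c m * weight S m (\<lambda>_. 0)) has_sum f ?a) (exponents S)"
      using c[OF aU] r by simp
    let ?d = "\<lambda>m. c m * (weight S m (\<lambda>s. x s - ?a s) - weight S m (\<lambda>_. 0))"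
    have d: "(?d has_sum (f x - f ?a)) (exponents S)"
      using has_sum_add[OF cx has_sum_uminusI[OF ca]] by (simp add: right_diff_distrib)
    have le: "norm (?d m) \<le> l * norm (c m * weight S m (\<lambda>_. \<rho>))" if "m \<in> exponents S" for m
    proof -
      have "norm (?d m) \<le> \<bar>c m\<bar> * (l * weight S m (\<lambda>_. \<rho>))"
        using weight_diff_le[OF S(1) that xb l \<rho>(1)] by (simp add: abs_mult mult_left_mono)
      then show ?thesis using weight_pos[OF \<rho>(1), of S m] by (simp add: abs_mult algebra_simps)
    qed
    have lN: "((\<lambda>m. l * norm (c m * weight S m (\<lambda>_. \<rho>))) has_sum l * N) (exponents S)"
      by (rule has_sum_cmult_right[OF N])
    have "(\<lambda>m. norm (?d m)) summable_on exponents S"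
      by (rule summable_on_comparison_test[OF has_sum_imp_summable[OF lN] le]) auto
    then obtain K where K: "((\<lambda>m. norm (?d m)) has_sum K) (exponents S)"
      by (auto simp: summable_on_def)
    have "norm (f x - f ?a) \<le> K" by (rule norm_has_sum_bound[OF K d])
    also have "K \<le> l * N" by (rule has_sum_mono[OF K lN le])
    finally show ?thesis using \<open>l * N < \<epsilon>\<close> by (simp add: dist_real_def)
  qed
  show "\<forall>\<^sub>F x in nash_filter T. dist (f x) (f ?a) < \<epsilon>"
    unfolding eventually_nash_filter[OF T]
    by (rule exI[of _ "S' \<union> S"], rule exI[of _ "l * \<rho>"]) (use S S' l \<rho> close in auto)
qed

lemma analytic_in_vars_slice_const:
  assumes f: "analytic_in_vars S U f" and "a \<in> U" "t \<notin> S" "a(t := s) \<in> U"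
  shows "f (a(t := s)) = f a"
proof -
  obtain r c where r: "r > 0" and c: "\<And>x. x \<in> U \<Longrightarrow> \<forall>s\<in>S. \<bar>x s - a s\<bar> < r \<Longrightarrow>
    ((\<lambda>m. c m * weight S m (\<lambda>s. x s - a s)) has_sum f x) (exponents S)"
    using analytic_in_varsD[OF f assms(2)] by blast
  have "weight S m (\<lambda>u. (a(t := s)) u - a u) = weight S m (\<lambda>u. a u - a u)" for m
    unfolding weight_def by (rule prod.cong) (use assms(3) in auto)
  moreover have "\<forall>u\<in>S. \<bar>(a(t := s)) u - a u\<bar> < r" using assms(3) r by auto
  ultimately show ?thesis
    using c[OF assms(4)] c[OF assms(2)] r has_sum_unique by simp
qed

text \<open>Along the slice through \<open>a\<close>, every monomial involving a variable other than
  \<open>t\<close> vanishes. What remains is a power series in s - a t, which is differentiated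
  termwise; for \<open>t\<close> outside \<open>S\<close> the function is constant on the
  slice.\<close>

lemma analytic_in_vars_slice_differentiable:
  assumes f: "analytic_in_vars S U f" and S: "finite S" and a: "a \<in> U"
    and U: "\<forall>\<^sub>F s in nhds (a t). a(t := s) \<in> U"
  shows "\<exists>D. ((\<lambda>s. f (a(t := s))) has_real_derivative D) (at (a t))"
proof (cases "t \<in> S")
  case False
  have "\<forall>\<^sub>F s in nhds (a t). f (a(t := s)) = f a"
    using U by eventually_elim (rule analytic_in_vars_slice_const[OF f a False])
  then have "((\<lambda>s. f (a(t := s))) has_real_derivative 0) (at (a t))"
    by (subst DERIV_cong_ev[OF refl _ refl]) auto
  then show ?thesis by blast
next
  case True
  obtain r c where r: "r > 0" and c: "\<And>x. x \<in> U \<Longrightarrow> \<forall>s\<in>S. \<bar>x s - a s\<bar> < r \<Longrightarrow>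
    ((\<lambda>m. c m * weight S m (\<lambda>s. x s - a s)) has_sum f x) (exponents S)"
    using analytic_in_varsD[OF f a] by blast
  define d where "d k = c (Poly_Mapping.single t k)" for k
  let ?X = "range (\<lambda>k. Poly_Mapping.single t (k::nat))"
  have wt: "weight S (Poly_Mapping.single t k) (\<lambda>u. (a(t := s)) u - a u) = (s - a t) ^ k" for k s
    using S True by (simp add: weight_def lookup_single when_def prod.remove[of S t])
  have w0: "weight S m (\<lambda>u. (a(t := s)) u - a u) = 0" if m: "m \<in> exponents S - ?X" for m s
  proof -
    have "\<exists>u. u \<noteq> t \<and> Poly_Mapping.lookup m u \<noteq> 0"
    proof (rule ccontr)
      assume "\<not> ?thesis"
      then have "m = Poly_Mapping.single t (Poly_Mapping.lookup m t)"
        by (intro poly_mapping_eqI) (auto simp: lookup_single when_def)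
      then show False using m by blast
    qed
    then obtain u where u: "u \<noteq> t" "Poly_Mapping.lookup m u \<noteq> 0" by blast
    with m have "u \<in> S" by (auto simp: exponents_def in_keys_iff)
    then show ?thesis unfolding weight_def using S u
      by (intro prod_zero) (auto simp: zero_power intro!: bexI[of _ u])
  qed
  have sums: "(\<lambda>k. d k * (s - a t) ^ k) sums f (a(t := s))"
    if s: "a(t := s) \<in> U" "\<bar>s - a t\<bar> < r" for s
  proof -
    let ?g = "\<lambda>m. c m * weight S m (\<lambda>u. (a(t := s)) u - a u)"
    have "(?g has_sum f (a(t := s))) (exponents S)"
      by (rule c[OF s(1)]) (use s(2) r in auto)
    moreover have "?X \<subseteq> exponents S" using True by (auto simp: exponents_def split: if_splits)
    then have "(?g has_sum f (a(t := s))) ?X \<longleftrightarrow> (?g has_sum f (a(t := s))) (exponents S)"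
      using w0 by (intro has_sum_cong_neutral) auto
    ultimately have "(?g has_sum f (a(t := s))) ?X" by simp
    moreover have "inj (\<lambda>k. Poly_Mapping.single t (k::nat))"
      by (rule injI) (metis lookup_single_eq)
    ultimately have "((\<lambda>k. d k * (s - a t) ^ k) has_sum f (a(t := s))) UNIV"
      by (subst (asm) has_sum_reindex) (simp_all add: o_def wt d_def del: fun_upd_apply)
    then show ?thesis by (rule has_sum_imp_sums)
  qed
  obtain e where e: "e > 0" "\<And>s. dist s (a t) < e \<Longrightarrow> a(t := s) \<in> U"
    using U unfolding eventually_nhds_metric by blast
  define \<rho> where "\<rho> = min e r"
  have \<rho>: "\<rho> > 0" using e r by (simp add: \<rho>_def)
  define G where "G h = suminf (\<lambda>k. d k * h ^ k)" for h
  \<comment> \<open>Convergence at a nonzero point makes the series differentiable at 0.\<close>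
  have "(\<lambda>k. d k * (\<rho> / 2) ^ k) sums f (a(t := a t + \<rho> / 2))"
    using sums[of "a t + \<rho> / 2"] e \<rho> by (auto simp: \<rho>_def dist_real_def min_def split: if_splits)
  then have "(G has_real_derivative (suminf (\<lambda>n. diffs d n * 0 ^ n))) (at 0)"
    unfolding G_def[abs_def] using \<rho> by (intro termdiffs_strong[of _ "\<rho> / 2"]) (auto simp: sums_iff)
  then have "((\<lambda>s. G (s + - a t)) has_real_derivative (suminf (\<lambda>n. diffs d n * 0 ^ n))) (at (a t))"
    by (subst DERIV_shift[symmetric]) simp
  moreover have "\<forall>\<^sub>F s in nhds (a t). f (a(t := s)) = G (s + - a t)"
    unfolding eventually_nhds_metric
  proof (intro exI[of _ \<rho>] conjI allI impI)
    fix s assume "dist s (a t) < \<rho>"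
    then show "f (a(t := s)) = G (s + - a t)"
      using sums[of s] e by (auto simp: \<rho>_def dist_real_def G_def sums_iff)
  qed (rule \<rho>)
  ultimately show ?thesis
    by (subst DERIV_cong_ev[OF refl _ refl]) auto
qed

section \<open>Partial derivatives and implicit differentiation\<close>

definition slice_deriv :: "real \<Rightarrow> ((real \<Rightarrow> real) \<Rightarrow> real) \<Rightarrow> (real \<Rightarrow> real) \<Rightarrow> real"
  where "slice_deriv t u x = deriv (\<lambda>s. u (x(t := s))) (x t)"

definition slice_differentiable :: "real set \<Rightarrow> real \<Rightarrow> ((real \<Rightarrow> real) \<Rightarrow> real) \<Rightarrow> bool"
  where "slice_differentiable T t u \<longleftrightarrow> (\<forall>\<^sub>F x in nash_filter T.
    ((\<lambda>s. u (x(t := s))) has_real_derivative slice_deriv t u x) (at (x t)))"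

text \<open>Asking only for the existence of a derivative polynomial, the same for all
  \<open>x\<close>, makes closure under sums and products enough; no formula for partial derivatives
  of monomials has to be carried along.\<close>

definition has_poly_deriv :: "real set \<Rightarrow> real \<Rightarrow> rat_mpoly \<Rightarrow> bool"
  where "has_poly_deriv T t q \<longleftrightarrow> (\<exists>q'\<in>rat_mpolys T. \<forall>x.
    ((\<lambda>s. rat_mpoly_eval q (x(t := s))) has_real_derivative rat_mpoly_eval q' x) (at (x t)))"

lemma has_poly_deriv_add:
  assumes "has_poly_deriv T t p" "has_poly_deriv T t q" shows "has_poly_deriv T t (p + q)"
proof -
  obtain p' q' where p': "p' \<in> rat_mpolys T" "q' \<in> rat_mpolys T"
    "\<And>x. ((\<lambda>s. rat_mpoly_eval p (x(t := s))) has_real_derivative rat_mpoly_eval p' x) (at (x t))"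
    "\<And>x. ((\<lambda>s. rat_mpoly_eval q (x(t := s))) has_real_derivative rat_mpoly_eval q' x) (at (x t))"
    using assms unfolding has_poly_deriv_def by blast
  have "((\<lambda>s. rat_mpoly_eval (p + q) (x(t := s))) has_real_derivative rat_mpoly_eval (p' + q') x) (at (x t))" for x
    using DERIV_add[OF p'(3)[of x] p'(4)[of x]] by (simp add: rat_mpoly_eval_add)
  then show ?thesis unfolding has_poly_deriv_def using p' rat_mpolys_add by blast
qed

lemma has_poly_deriv_mult:
  assumes "has_poly_deriv T t p" "has_poly_deriv T t q" "p \<in> rat_mpolys T" "q \<in> rat_mpolys T"
  shows "has_poly_deriv T t (p * q)"
proof -
  obtain p' q' where p': "p' \<in> rat_mpolys T" "q' \<in> rat_mpolys T"
    "\<And>x. ((\<lambda>s. rat_mpoly_eval p (x(t := s))) has_real_derivative rat_mpoly_eval p' x) (at (x t))"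
    "\<And>x. ((\<lambda>s. rat_mpoly_eval q (x(t := s))) has_real_derivative rat_mpoly_eval q' x) (at (x t))"
    using assms unfolding has_poly_deriv_def by blast
  have "((\<lambda>s. rat_mpoly_eval (p * q) (x(t := s))) has_real_derivative
      rat_mpoly_eval (p' * q + q' * p) x) (at (x t))" for x
    using DERIV_mult[OF p'(3)[of x] p'(4)[of x]] by (simp add: rat_mpoly_eval_add rat_mpoly_eval_mult)
  moreover have "p' * q + q' * p \<in> rat_mpolys T"
    by (intro rat_mpolys_add rat_mpolys_mult assms p')
  ultimately show ?thesis unfolding has_poly_deriv_def by blast
qed

lemma has_poly_deriv_const: "has_poly_deriv T t (rat_const c)"
  unfolding has_poly_deriv_def by (rule bexI[of _ 0]) auto

lemma has_poly_deriv_var: "has_poly_deriv T t (rat_var u)"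
  unfolding has_poly_deriv_def by (rule bexI[of _ "if u = t then 1 else 0"]) auto

lemma has_poly_deriv_mono:
  "Poly_Mapping.keys m \<subseteq> T \<Longrightarrow> has_poly_deriv T t (Poly_Mapping.single m 1)"
proof -
  assume m: "Poly_Mapping.keys m \<subseteq> T"
  \<comment> \<open>The induction runs over the exponent \<open>m\<close>, building the monomial
    from powers of variables; membership in \<open>rat_mpolys T\<close> is carried along for the
    product rule.\<close>
  have "has_poly_deriv T t (Poly_Mapping.single m 1) \<and> Poly_Mapping.single m 1 \<in> rat_mpolys T"
  proof (induction m rule: poly_mapping_single_induct)
    case zero
    show ?case using has_poly_deriv_const[of T t 1] by (simp add: rat_const_def)
  next
    case (single u k)
    then have u: "u \<in> T" using m by blast
    have "rat_var u ^ k = Poly_Mapping.single (Poly_Mapping.single u k) 1"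
      by (induction k) (auto simp: rat_var_def mult_single single_add[symmetric])
    moreover have "has_poly_deriv T t (rat_var u ^ k)"
    proof (induction k)
      case 0
      show ?case using has_poly_deriv_const[of T t 1] by (simp add: rat_const_def)
    qed (auto intro!: has_poly_deriv_mult has_poly_deriv_var rat_mpolys_power rat_var_in_rat_mpolys u)
    ultimately show ?case using rat_mpolys_power[OF rat_var_in_rat_mpolys[OF u], of k] by simp
  next
    case (add m n)
    then show ?case
      using has_poly_deriv_mult[of T t "Poly_Mapping.single m 1" "Poly_Mapping.single n 1"]
        rat_mpolys_mult[of "Poly_Mapping.single m 1" T "Poly_Mapping.single n 1"]
      by (simp add: mult_single)
  qed
  then show ?thesis by blast
qed

lemma has_poly_deriv_rat_mpoly:
  assumes "q \<in> rat_mpolys T" shows "has_poly_deriv T t q"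
proof (induction q rule: poly_mapping_single_induct)
  case zero
  show ?case using has_poly_deriv_const[of T t 0] by (simp add: rat_const_def)
next
  case (single m c)
  then have m: "Poly_Mapping.keys m \<subseteq> T" using assms by (auto simp: rat_mpolys_def)
  have "has_poly_deriv T t (rat_const c * Poly_Mapping.single m 1)"
    by (intro has_poly_deriv_mult has_poly_deriv_const has_poly_deriv_mono m rat_const_in_rat_mpolys)
      (use m in \<open>auto simp: rat_mpolys_single_iff\<close>)
  then show ?case by (simp add: rat_const_def mult_single)
qed (rule has_poly_deriv_add)

text \<open>The chain rule for p(x, u): \<open>p'\<close> arises by differentiating the coefficients
  of \<open>p\<close> in Lambda_t. It is chosen before \<open>x\<close> and \<open>u\<close>, so
  that the resulting formula for a partial derivative is algebraic.\<close>

lemma poly_at_slice_deriv: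
  assumes "p \<in> rat_polys T"
  shows "\<exists>p'\<in>rat_polys T. \<forall>x u D. (u has_real_derivative D) (at (x t)) \<longrightarrow>
    ((\<lambda>s. poly (poly_at p (x(t := s))) (u s)) has_real_derivative
      poly (poly_at p' x) (u (x t)) + poly (poly_at (pderiv p) x) (u (x t)) * D) (at (x t))"
  using assms
proof (induction p)
  case 0
  show ?case by (rule bexI[of _ 0]) auto
next
  case (pCons a p)
  then have a: "a \<in> rat_mpolys T" and p: "p \<in> rat_polys T" by (auto simp: rat_polys_pCons_iff)
  obtain p' where p': "p' \<in> rat_polys T" "\<And>x u D. (u has_real_derivative D) (at (x t)) \<Longrightarrow>
    ((\<lambda>s. poly (poly_at p (x(t := s))) (u s)) has_real_derivative
      poly (poly_at p' x) (u (x t)) + poly (poly_at (pderiv p) x) (u (x t)) * D) (at (x t))"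
    using pCons.IH[OF p] by blast
  obtain a' where a': "a' \<in> rat_mpolys T" "\<And>x. ((\<lambda>s. rat_mpoly_eval a (x(t := s)))
      has_real_derivative rat_mpoly_eval a' x) (at (x t))"
    using has_poly_deriv_rat_mpoly[OF a, of t] unfolding has_poly_deriv_def by blast
  show ?case
  proof (intro bexI[of _ "pCons a' p'"] allI impI)
    fix x and u :: "real \<Rightarrow> real" and D assume u: "(u has_real_derivative D) (at (x t))"
    from DERIV_add[OF a'(2)[of x] DERIV_mult[OF u p'(2)[where x = x and u = u, OF u]]]
    show "((\<lambda>s. poly (poly_at (pCons a p) (x(t := s))) (u s)) has_real_derivative
      poly (poly_at (pCons a' p') x) (u (x t)) + poly (poly_at (pderiv (pCons a p)) x) (u (x t)) * D) (at (x t))"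
      by (simp add: poly_at_pCons pderiv_pCons poly_at_add algebra_simps)
  qed (use a' p' in \<open>simp add: rat_polys_pCons_iff\<close>)
qed

context
  fixes T :: "real set"
  assumes T_nonempty: "T \<noteq> {}" and indep: "algebraically_independent T"
begin

lemma nash_function_nash_like:
  assumes U: "U \<in> basic_nhds T" and f: "f \<in> nash_functions T U"
  shows "nash_like T f"
proof -
  have "(f \<longlongrightarrow> f (base_point T)) (nash_filter T)"
    using f analytic_in_vars_tendsto[OF T_nonempty _ _ U, of _ f] unfolding nash_functions_def by blast
  moreover have "alg_on T U f"
    using f unfolding nash_functions_def alg_on_def rat_polys_def by blast
  ultimately show ?thesis
    unfolding nash_like_def using eventually_in_basic_nhd[OF T_nonempty U] by blast
qed

text \<open>A Nash function with the same value at the base point exists, and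
  \<open>nash_like_unique\<close> identifies the germs. The polynomial with positive derivative in Z
  is kept for implicit differentiation.\<close>

lemma nash_like_representative:
  assumes "nash_like T u"
  obtains U f S p where "U \<in> basic_nhds T" "f \<in> nash_functions T U" "nash_like T f"
    "\<forall>\<^sub>F x in nash_filter T. u x = f x" "finite S" "S \<subseteq> T"
    "analytic_in_vars S U f" "p \<in> rat_polys T"
    "\<And>x. x \<in> U \<Longrightarrow> poly (poly_at p x) (f x) = 0"
    "\<And>x. x \<in> U \<Longrightarrow> poly (poly_at (pderiv p) x) (f x) > 0"
proof -
  obtain U f S p where *: "U \<in> basic_nhds T" "f (base_point T) = u (base_point T)" "finite S" "S \<subseteq> T"
    "analytic_in_vars S U f" "p \<in> rat_polys T" "p \<noteq> 0"
    "\<And>x. x \<in> U \<Longrightarrow> poly (poly_at p x) (f x) = 0"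
    "\<And>x. x \<in> U \<Longrightarrow> poly (poly_at (pderiv p) x) (f x) > 0"
    using nash_function_exists[OF T_nonempty indep alg_on_base_point[OF T_nonempty assms]] by blast
  then have f: "f \<in> nash_functions T U"
    unfolding nash_functions_def rat_polys_def by blast
  have nf: "nash_like T f" by (rule nash_function_nash_like[OF *(1) f])
  show ?thesis
    by (rule that[OF *(1) f nf nash_like_unique[OF T_nonempty indep assms nf *(2)[symmetric]] *(3,4,5,6,8,9)])
qed

lemma slice_deriv_cong:
  assumes "t \<in> T" "\<forall>\<^sub>F x in nash_filter T. u x = v x"
  shows "\<forall>\<^sub>F x in nash_filter T. slice_deriv t u x = slice_deriv t v x"
  using eventually_slice[OF T_nonempty assms]
  by eventually_elim (simp add: slice_deriv_def deriv_cong_ev)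

text \<open>All three claims are read off one representative \<open>f\<close>. Its analyticity gives
  differentiability and, for \<open>t\<close> outside the finite set \<open>S\<close>, a zero
  derivative. Differentiating p(x, f) = 0 identifies the derivative with \<open>w\<close>, whose
  denominator is nonzero at the base point.\<close>

lemma
  assumes u: "nash_like T u"
  shows slice_differentiable_nash_like: "t \<in> T \<Longrightarrow> slice_differentiable T t u"
    and nash_like_slice_deriv: "t \<in> T \<Longrightarrow> nash_like T (slice_deriv t u)"
    and finite_slice_deriv: "\<exists>S. finite S \<and> S \<subseteq> T \<and> (\<forall>t\<in>T - S. \<forall>\<^sub>F x in nash_filter T. slice_deriv t u x = 0)"
proof -
  obtain U f S p where U: "U \<in> basic_nhds T" and f: "f \<in> nash_functions T U" "nash_like T f"
    and uf: "\<forall>\<^sub>F x in nash_filter T. u x = f x" and S: "finite S" "S \<subseteq> T"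
    and an: "analytic_in_vars S U f" and p: "p \<in> rat_polys T"
    and pf: "\<And>x. x \<in> U \<Longrightarrow> poly (poly_at p x) (f x) = 0"
    and pos: "\<And>x. x \<in> U \<Longrightarrow> poly (poly_at (pderiv p) x) (f x) > 0"
    using nash_like_representative[OF u] by blast
  have evU: "\<forall>\<^sub>F x in nash_filter T. x \<in> U" by (rule eventually_in_basic_nhd[OF T_nonempty U])
  have "\<forall>\<^sub>F x in nash_filter T. slice_deriv t u x = 0" if t: "t \<in> T - S" for t
    using evU eventually_slice[OF T_nonempty DiffD1[OF t] evU] slice_deriv_cong[OF DiffD1[OF t] uf]
  proof eventually_elim
    case (elim x)
    have "\<forall>\<^sub>F s in nhds (x t). f (x(t := s)) = f x"
      using elim(2) t by (auto elim!: eventually_mono intro: analytic_in_vars_slice_const[OF an elim(1)])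
    then have "((\<lambda>s. f (x(t := s))) has_real_derivative 0) (at (x t))"
      by (subst DERIV_cong_ev[OF refl _ refl]) auto
    then show ?case using elim(3) t by (simp add: slice_deriv_def DERIV_imp_deriv)
  qed
  with S show "\<exists>S. finite S \<and> S \<subseteq> T \<and> (\<forall>t\<in>T - S. \<forall>\<^sub>F x in nash_filter T. slice_deriv t u x = 0)" by blast
  assume t: "t \<in> T"
  obtain p' where p': "p' \<in> rat_polys T" "\<And>x u D. (u has_real_derivative D) (at (x t)) \<Longrightarrow>
    ((\<lambda>s. poly (poly_at p (x(t := s))) (u s)) has_real_derivative
      poly (poly_at p' x) (u (x t)) + poly (poly_at (pderiv p) x) (u (x t)) * D) (at (x t))"
    using poly_at_slice_deriv[OF p, of t] by blast
  define w where "w x = - (poly (poly_at p' x) (f x) * inverse (poly (poly_at (pderiv p) x) (f x)))" for x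
  have "poly (poly_at (pderiv p) (base_point T)) (f (base_point T)) \<noteq> 0"
    using pos[OF base_point_in_basic_nhd[OF T_nonempty U]] by simp
  then have w: "nash_like T w"
    unfolding w_def
    by (intro nash_like_uminus nash_like_mult nash_like_inverse nash_like_poly_at T_nonempty f p'
        rat_polys_pderiv p)
  have D: "\<forall>\<^sub>F x in nash_filter T. ((\<lambda>s. u (x(t := s))) has_real_derivative w x) (at (x t))"
    using evU eventually_slice[OF T_nonempty t evU] eventually_slice[OF T_nonempty t uf]
  proof eventually_elim
    case (elim x)
    obtain D where D: "((\<lambda>s. f (x(t := s))) has_real_derivative D) (at (x t))"
      using analytic_in_vars_slice_differentiable[OF an S(1) elim(1,2)] by blast
    have "((\<lambda>s. poly (poly_at p (x(t := s))) (f (x(t := s)))) has_real_derivative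
      poly (poly_at p' x) (f x) + poly (poly_at (pderiv p) x) (f x) * D) (at (x t))"
      using p'(2)[where x = x and u = "\<lambda>s. f (x(t := s))", OF D] by simp
    moreover have "\<forall>\<^sub>F s in nhds (x t). poly (poly_at p (x(t := s))) (f (x(t := s))) = 0"
      using elim(2) by eventually_elim (rule pf)
    then have "((\<lambda>s. poly (poly_at p (x(t := s))) (f (x(t := s)))) has_real_derivative 0) (at (x t))"
      by (subst DERIV_cong_ev[OF refl _ refl]) auto
    ultimately have "poly (poly_at p' x) (f x) + poly (poly_at (pderiv p) x) (f x) * D = 0"
      by (rule DERIV_unique)
    then have "D = w x" using pos[OF elim(1)] by (simp add: w_def field_simps)
    then show ?case
      using D elim(3) by (subst DERIV_cong_ev[OF refl _ refl]) auto
  qed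
  then have wD: "\<forall>\<^sub>F x in nash_filter T. slice_deriv t u x = w x"
    by eventually_elim (simp add: slice_deriv_def DERIV_imp_deriv)
  show "slice_differentiable T t u"
    unfolding slice_differentiable_def using D wD by eventually_elim simp
  show "nash_like T (slice_deriv t u)"
    by (rule nash_like_cong[OF T_nonempty w wD])
qed

end

section \<open>The field of germs\<close>

locale nash_germs =
  fixes T :: "real set"
  assumes T_nonempty: "T \<noteq> {}" and indep: "algebraically_independent T"
begin

abbreviation K :: "germ ring" where "K \<equiv> nash_field T"
abbreviation x0 :: "real \<Rightarrow> real" where "x0 \<equiv> base_point T"
abbreviation F0 :: "(real \<Rightarrow> real) filter" where "F0 \<equiv> nash_filter T"

lemma germ_of_eq: "germ_of T f = {h. \<forall>\<^sub>F x in F0. h x = f x}"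
  by (simp add: germ_of_def eventually_nash_filter_basic[OF T_nonempty])

lemma germ_of_eq_iff: "germ_of T f = germ_of T h \<longleftrightarrow> (\<forall>\<^sub>F x in F0. f x = h x)"
proof
  assume "germ_of T f = germ_of T h"
  moreover have "f \<in> germ_of T f" by (simp add: germ_of_eq)
  ultimately show "\<forall>\<^sub>F x in F0. f x = h x" by (simp add: germ_of_eq)
next
  assume fh: "\<forall>\<^sub>F x in F0. f x = h x"
  have "(\<forall>\<^sub>F x in F0. u x = f x) \<longleftrightarrow> (\<forall>\<^sub>F x in F0. u x = h x)" for u
    using fh by (auto elim: eventually_elim2)
  then show "germ_of T f = germ_of T h" by (simp add: germ_of_eq)
qed

text \<open>From here on, closure of the field under an operation needs only algebraicity and
  continuity at the base point.\<close>

lemma carrier_K: "carrier K = {germ_of T u | u. nash_like T u}"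
proof
  show "carrier K \<subseteq> {germ_of T u | u. nash_like T u}"
    using nash_function_nash_like[OF T_nonempty indep] by (auto simp: nash_field_def)
  show "{germ_of T u | u. nash_like T u} \<subseteq> carrier K"
  proof clarify
    fix u assume "nash_like T u"
    then obtain U f where "U \<in> basic_nhds T" "f \<in> nash_functions T U" "\<forall>\<^sub>F x in F0. u x = f x"
      using nash_like_representative[OF T_nonempty indep] by metis
    then show "germ_of T u \<in> carrier K"
      by (auto simp: nash_field_def germ_of_eq_iff)
  qed
qed

lemma germ_in_carrier: "nash_like T u \<Longrightarrow> germ_of T u \<in> carrier K"
  by (auto simp: carrier_K)

lemma carrierE:
  assumes "a \<in> carrier K" obtains u where "nash_like T u" "a = germ_of T u"
  using assms by (auto simp: carrier_K)

text \<open>The operation does not depend on representatives, so all sets in the union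
  coincide.\<close>

lemma germ_union2:
  "(\<Union>f\<in>germ_of T u. \<Union>h\<in>germ_of T v. germ_of T (\<lambda>x. b (f x) (h x))) = germ_of T (\<lambda>x. b (u x) (v x))"
proof -
  have "germ_of T (\<lambda>x. b (f x) (h x)) = germ_of T (\<lambda>x. b (u x) (v x))"
    if "f \<in> germ_of T u" "h \<in> germ_of T v" for f h
    using that unfolding germ_of_eq_iff by (auto simp: germ_of_eq elim: eventually_elim2)
  moreover have "u \<in> germ_of T u" "v \<in> germ_of T v" by (simp_all add: germ_of_eq)
  ultimately show ?thesis by blast
qed

lemma mult_germ: "germ_of T u \<otimes>\<^bsub>K\<^esub> germ_of T v = germ_of T (\<lambda>x. u x * v x)"
  using germ_union2[where b = "(*)" and u = u and v = v] by (simp add: nash_field_def)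

lemma add_germ: "germ_of T u \<oplus>\<^bsub>K\<^esub> germ_of T v = germ_of T (\<lambda>x. u x + v x)"
  using germ_union2[where b = "(+)" and u = u and v = v] by (simp add: nash_field_def)

lemma zero_germ: "\<zero>\<^bsub>K\<^esub> = germ_of T (\<lambda>_. 0)" and one_germ: "\<one>\<^bsub>K\<^esub> = germ_of T (\<lambda>_. 1)"
  by (simp_all add: nash_field_def)

lemmas germ_simps = mult_germ add_germ zero_germ one_germ

text \<open>Identities between such germs can thus be checked on real numbers at the base
  point.\<close>

lemma germ_eq_iff_value:
  assumes "nash_like T u" "nash_like T v"
  shows "germ_of T u = germ_of T v \<longleftrightarrow> u x0 = v x0"
  unfolding germ_of_eq_iff
  using nash_like_unique[OF T_nonempty indep assms]
    eventually_base_point[OF T_nonempty, of "\<lambda>x. u x = v x"] by blast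

lemma germ_eq_zero_iff: "nash_like T u \<Longrightarrow> germ_of T u = \<zero>\<^bsub>K\<^esub> \<longleftrightarrow> u x0 = 0"
  using germ_eq_iff_value[OF _ nash_like_0[OF T_nonempty]] by (simp add: zero_germ)

lemmas nash_like_intros = nash_like_add[OF T_nonempty] nash_like_mult[OF T_nonempty]
  nash_like_uminus[OF T_nonempty] nash_like_0[OF T_nonempty] nash_like_1[OF T_nonempty]
  nash_like_const[OF T_nonempty] nash_like_var[OF T_nonempty]

lemma field_K: "field K"
proof -
  have ab: "abelian_group K"
  proof (rule abelian_groupI)
    fix a assume "a \<in> carrier K"
    then obtain u where u: "nash_like T u" "a = germ_of T u" by (rule carrierE)
    then have "germ_of T (\<lambda>x. - u x) \<oplus>\<^bsub>K\<^esub> a = \<zero>\<^bsub>K\<^esub>" by (simp add: germ_simps)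
    then show "\<exists>b\<in>carrier K. b \<oplus>\<^bsub>K\<^esub> a = \<zero>\<^bsub>K\<^esub>"
      using u by (auto intro!: bexI[of _ "germ_of T (\<lambda>x. - u x)"] germ_in_carrier nash_like_intros)
  qed ((elim carrierE)?, simp add: germ_simps germ_in_carrier nash_like_intros add_ac)+
  have mon: "comm_monoid K"
    by (rule comm_monoidI)
      ((elim carrierE)?, simp add: germ_simps germ_in_carrier nash_like_intros mult_ac)+
  have "cring K"
    by (rule cringI[OF ab mon])
      (elim carrierE, simp add: germ_simps distrib_right)
  moreover have "Units K = carrier K - {\<zero>\<^bsub>K\<^esub>}"
  proof
    show "Units K \<subseteq> carrier K - {\<zero>\<^bsub>K\<^esub>}"
    proof
      fix a assume a: "a \<in> Units K"
      then obtain u where u: "nash_like T u" "a = germ_of T u" by (auto simp: Units_def elim: carrierE)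
      from a obtain b where b: "b \<in> carrier K" "b \<otimes>\<^bsub>K\<^esub> a = \<one>\<^bsub>K\<^esub>" by (auto simp: Units_def)
      from b(1) obtain v where v: "nash_like T v" "b = germ_of T v" by (rule carrierE)
      have "\<forall>\<^sub>F x in F0. v x * u x = 1" using b(2) u v by (simp add: germ_simps germ_of_eq_iff)
      from eventually_base_point[OF T_nonempty this] have "u x0 \<noteq> 0" by auto
      then show "a \<in> carrier K - {\<zero>\<^bsub>K\<^esub>}" using u by (simp add: germ_eq_zero_iff germ_in_carrier)
    qed
    show "carrier K - {\<zero>\<^bsub>K\<^esub>} \<subseteq> Units K"
    proof
      fix a assume a: "a \<in> carrier K - {\<zero>\<^bsub>K\<^esub>}"
      then obtain u where u: "nash_like T u" "a = germ_of T u" by (auto elim: carrierE)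
      with a have u0: "u x0 \<noteq> 0" by (simp add: germ_eq_zero_iff)
      have v: "nash_like T (\<lambda>x. inverse (u x))" by (rule nash_like_inverse[OF T_nonempty u(1) u0])
      \<comment> \<open>Only the values at the base point are compared, where \<open>u\<close> is
        nonzero.\<close>
      have "germ_of T (\<lambda>x. inverse (u x)) \<otimes>\<^bsub>K\<^esub> a = \<one>\<^bsub>K\<^esub>"
        unfolding u(2) mult_germ one_germ
        using u0 by (subst germ_eq_iff_value) (auto intro!: nash_like_intros u v)
      moreover from this have "a \<otimes>\<^bsub>K\<^esub> germ_of T (\<lambda>x. inverse (u x)) = \<one>\<^bsub>K\<^esub>"
        by (simp add: u(2) mult_germ mult.commute)
      ultimately show "a \<in> Units K" using u v by (auto simp: Units_def intro: germ_in_carrier)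
    qed
  qed
  ultimately show ?thesis by (rule cring.cring_fieldI)
qed

sublocale field K by (rule field_K)

lemma uminus_germ:
  assumes "nash_like T u" shows "\<ominus>\<^bsub>K\<^esub> germ_of T u = germ_of T (\<lambda>x. - u x)"
  by (rule minus_equality)
    (use assms in \<open>auto simp: germ_simps intro!: germ_in_carrier nash_like_intros\<close>)

lemma pow_germ: "germ_of T u [^]\<^bsub>K\<^esub> (n::nat) = germ_of T (\<lambda>x. u x ^ n)"
  by (induction n) (simp_all add: germ_simps mult.commute)

section \<open>The ordering and real closedness\<close>

lemma nash_pos_iff:
  assumes "nash_like T u" shows "germ_of T u \<in> nash_pos T \<longleftrightarrow> u x0 > 0"
proof -
  have "f x0 = u x0" if "f \<in> germ_of T u" for f
    using that eventually_base_point[OF T_nonempty, of "\<lambda>x. f x = u x"] by (simp add: germ_of_eq)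
  moreover have "u \<in> germ_of T u" by (simp add: germ_of_eq)
  ultimately have "(\<exists>f\<in>germ_of T u. f x0 > 0) \<longleftrightarrow> u x0 > 0" by metis
  then show ?thesis using germ_in_carrier[OF assms] by (simp add: nash_pos_def)
qed

lemma nash_pos_subset: "nash_pos T \<subseteq> carrier K"
  by (auto simp: nash_pos_def)

lemma ordered_field_K: "ordered_field K (nash_pos T)"
  unfolding ordered_field_def
proof (intro conjI ballI)
  show "\<zero>\<^bsub>K\<^esub> \<notin> nash_pos T"
    using nash_pos_iff[OF nash_like_0[OF T_nonempty]] by (simp add: zero_germ)
  fix a assume "a \<in> carrier K"
  then obtain u where u: "nash_like T u" "a = germ_of T u" by (rule carrierE)
  then show "a = \<zero>\<^bsub>K\<^esub> \<or> a \<in> nash_pos T \<or> \<ominus>\<^bsub>K\<^esub> a \<in> nash_pos T"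
    by (auto simp: uminus_germ germ_eq_zero_iff nash_pos_iff nash_like_intros)
next
  fix a b assume ab: "a \<in> nash_pos T" "b \<in> nash_pos T"
  obtain u where u: "nash_like T u" "a = germ_of T u"
    using subsetD[OF nash_pos_subset ab(1)] by (rule carrierE)
  obtain v where v: "nash_like T v" "b = germ_of T v"
    using subsetD[OF nash_pos_subset ab(2)] by (rule carrierE)
  from ab u v show "a \<oplus>\<^bsub>K\<^esub> b \<in> nash_pos T" "a \<otimes>\<^bsub>K\<^esub> b \<in> nash_pos T"
    by (auto simp: germ_simps nash_pos_iff nash_like_intros)
qed (use field_K nash_pos_subset in auto)

lemma nash_like_with_value:
  assumes "alg_on T {x0} (\<lambda>_. \<alpha>)" obtains u where "nash_like T u" "u x0 = \<alpha>"
proof -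
  obtain U f S p where U: "U \<in> basic_nhds T" "f x0 = \<alpha>" "finite S" "S \<subseteq> T"
    "analytic_in_vars S U f" "p \<in> rat_polys T" "p \<noteq> 0"
    "\<And>x. x \<in> U \<Longrightarrow> poly (poly_at p x) (f x) = 0"
    using nash_function_exists[OF T_nonempty indep assms] by metis
  then have "f \<in> nash_functions T U"
    unfolding nash_functions_def rat_polys_def by blast
  with nash_function_nash_like[OF T_nonempty indep U(1)] that U(2) show ?thesis by blast
qed

text \<open>The real square root of the value is algebraic over Q(T), hence the value of some germ;
  its square agrees with \<open>a\<close> at the base point and therefore as a germ.\<close>

lemma nash_pos_sqrt:
  assumes "a \<in> nash_pos T" shows "\<exists>b\<in>carrier K. b \<otimes>\<^bsub>K\<^esub> b = a"
proof -
  obtain u where u: "nash_like T u" "a = germ_of T u"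
    using subsetD[OF nash_pos_subset assms] by (rule carrierE)
  then have pos: "u x0 > 0" using assms nash_pos_iff by simp
  have "alg_on T {x0} (\<lambda>_. if i = 0 then u x0 else 0)" for i :: nat
    using alg_on_base_point[OF T_nonempty u(1)] alg_on_base_point[OF T_nonempty nash_like_0[OF T_nonempty]]
    by simp
  from alg_on_root[of 2 T "{x0}" "\<lambda>i _. if i = 0 then u x0 else 0" "\<lambda>_. sqrt (u x0)", OF _ this]
  have "alg_on T {x0} (\<lambda>_. sqrt (u x0))"
    using pos by (simp add: numeral_2_eq_2)
  then obtain v where v: "nash_like T v" "v x0 = sqrt (u x0)" by (rule nash_like_with_value)
  then have "germ_of T v \<otimes>\<^bsub>K\<^esub> germ_of T v = a"
    unfolding u(2) mult_germ using pos by (subst germ_eq_iff_value) (auto intro!: nash_like_intros u)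
  with germ_in_carrier[OF v(1)] show ?thesis by blast
qed

end

lemma odd_degree_real_root:
  fixes p :: "real poly"
  assumes "odd (Polynomial.degree p)" shows "\<exists>x. poly p x = 0"
proof -
  have pos: "\<exists>x. poly p x = 0" if odd: "odd (Polynomial.degree p)" and lc: "Polynomial.lead_coeff p > 0" for p :: "real poly"
  proof -
    obtain b where b: "\<forall>x\<ge>b. poly p x \<ge> Polynomial.lead_coeff p"
      using poly_pinfty_gt_lc[OF lc] by blast
    \<comment> \<open>This is -p(-x). Its leading coefficient is that of \<open>p\<close> because
      the degree is odd, so the bound for large arguments also makes \<open>p\<close> negative far
      to the left.\<close>
    define q where "q = - pcompose p [:0, -1:]"
    have "Polynomial.lead_coeff q > 0"
      using lc odd lead_coeff_comp[of "[:0, -1::real:]" p] by (simp add: q_def)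
    then obtain c where c: "\<forall>x\<ge>c. poly q x \<ge> Polynomial.lead_coeff q"
      using poly_pinfty_gt_lc by blast
    define d where "d = max 1 (max b c)"
    have "poly p d > 0" using b lc by (auto simp: d_def intro: less_le_trans)
    moreover have "poly q d > 0"
      using c \<open>Polynomial.lead_coeff q > 0\<close> by (auto simp: d_def intro: less_le_trans)
    then have "poly p (- d) < 0" by (simp add: q_def poly_pcompose)
    moreover have "- d < d" by (simp add: d_def)
    ultimately show ?thesis using poly_IVT_pos[of "-d" d p] by blast
  qed
  show ?thesis
  proof (cases "Polynomial.lead_coeff p > 0")
    case False
    have "Polynomial.lead_coeff p \<noteq> 0" using assms by auto
    with False have "Polynomial.lead_coeff p < 0" by linarith
    then have "Polynomial.lead_coeff (- p) > 0" by simp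
    then show ?thesis using pos[of "- p"] assms by simp
  qed (use pos assms in blast)
qed

context nash_germs
begin

text \<open>For a germ the choice is unambiguous, because the base point lies in every basic
  neighbourhood.\<close>

definition value_at :: "germ \<Rightarrow> real"
  where "value_at a = (SOME r. \<exists>f\<in>a. f x0 = r)"

lemma value_germ: "value_at (germ_of T u) = u x0"
proof -
  have "u \<in> germ_of T u" by (simp add: germ_of_eq)
  then have "\<exists>r. \<exists>f\<in>germ_of T u. f x0 = r" by blast
  then have "\<exists>f\<in>germ_of T u. f x0 = value_at (germ_of T u)"
    unfolding value_at_def by (rule someI_ex)
  then show ?thesis
    using eventually_base_point[OF T_nonempty, of "\<lambda>x. _ x = u x"] by (auto simp: germ_of_eq)
qed

lemma value_at_eq_0_iff: "a \<in> carrier K \<Longrightarrow> value_at a = 0 \<longleftrightarrow> a = \<zero>\<^bsub>K\<^esub>"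
  by (elim carrierE) (simp add: value_germ germ_eq_zero_iff)

text \<open>Coefficient lists over the germ field start with the leading coefficient, those of
  \<open>Poly\<close> with the constant one; hence \<open>rev\<close>.\<close>

lemma value_at_eval:
  assumes "set p \<subseteq> carrier K" "a \<in> carrier K"
  shows "value_at (eval p a) = poly (Poly (rev (map value_at p))) (value_at a)"
  using assms(1)
proof (induction p)
  case Nil
  show ?case by (simp add: zero_germ value_germ)
next
  case (Cons c p)
  obtain u where u: "nash_like T u" "a = germ_of T u" using assms(2) by (rule carrierE)
  obtain v where v: "nash_like T v" "c = germ_of T v" using Cons.prems by (auto elim: carrierE)
  have "eval p a \<in> carrier K" using Cons.prems assms(2) by (intro eval_in_carrier) auto
  then obtain w where w: "nash_like T w" "eval p a = germ_of T w" by (rule carrierE)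
  then have "w x0 = poly (Poly (rev (map value_at p))) (u x0)"
    using Cons u by (simp add: value_germ)
  then show ?case
    by (simp add: w(2)[unfolded u(2)] u v pow_germ germ_simps value_germ Poly_append poly_monom algebra_simps)
qed

text \<open>The polynomial of values has the same odd degree, since the value of a nonzero germ is
  nonzero, and so has a real root. That root is algebraic over Q(T) and is therefore the value of a
  germ.\<close>

lemma odd_degree_root:
  assumes p: "p \<in> carrier (univ_poly K (carrier K))" and odd: "odd (Polynomials.degree p)"
  shows "\<exists>a\<in>carrier K. eval p a = \<zero>\<^bsub>K\<^esub>"
proof -
  have "p \<noteq> []" using odd by auto
  then have pK: "set p \<subseteq> carrier K" and hd: "hd p \<noteq> \<zero>\<^bsub>K\<^esub>"
    using p by (auto simp: univ_poly_def polynomial_def)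
  define q where "q = Poly (rev (map value_at p))"
  have "poly.coeff q (length p - 1) = value_at (hd p)"
    using \<open>p \<noteq> []\<close> by (simp add: q_def nth_default_def rev_nth hd_conv_nth)
  then have lc: "poly.coeff q (length p - 1) \<noteq> 0"
    using \<open>p \<noteq> []\<close> hd pK value_at_eq_0_iff[of "hd p"] by (simp add: subset_eq)
  have deg: "Polynomial.degree q = length p - 1"
  proof (rule antisym)
    show "Polynomial.degree q \<le> length p - 1"
      by (rule degree_le) (auto simp: q_def nth_default_def)
  qed (rule le_degree[OF lc])
  obtain z where z: "poly q z = 0"
    using odd_degree_real_root[of q] deg odd by auto
  let ?n = "length p - 1"
  have n: "?n > 0" using odd by (cases "?n = 0") auto
  have alg: "alg_on T {x0} (\<lambda>_. poly.coeff q i)" for i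
  proof -
    have "poly.coeff q i \<in> insert 0 (value_at ` set p)"
      unfolding q_def using nth_mem[of i "rev (map value_at p)"]
      by (auto simp: nth_default_def simp del: nth_mem)
    moreover have "alg_on T {x0} (\<lambda>_. value_at c)" if "c \<in> carrier K" for c
      using that alg_on_base_point[OF T_nonempty] by (auto elim!: carrierE simp: value_germ)
    moreover have "alg_on T {x0} (\<lambda>_. 0)"
      using alg_on_base_point[OF T_nonempty nash_like_0[OF T_nonempty]] by simp
    ultimately show ?thesis using pK by auto
  qed
  have "alg_on T {x0} (\<lambda>_. -1)"
    using alg_on_base_point[OF T_nonempty nash_like_const[OF T_nonempty, of "-1"]] by simp
  \<comment> \<open>Coefficients of the equation solved for the top power, in the monic form
    required by \<open>alg_on_root\<close>.\<close>
  then have alg': "alg_on T {x0} (\<lambda>_. -1 * (poly.coeff q i * inverse (poly.coeff q ?n)))" for i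
    by (intro alg_on_mult alg_on_inverse alg)
  have "alg_on T {x0} (\<lambda>_. z)"
  proof (rule alg_on_root[OF n alg'])
    have "poly.coeff q ?n * z ^ ?n + (\<Sum>i<?n. poly.coeff q i * z ^ i) = 0"
      using z deg by (simp add: poly_altdef lessThan_Suc_atMost[symmetric])
    then have "z ^ ?n = - (\<Sum>i<?n. poly.coeff q i * z ^ i) / poly.coeff q ?n"
      using lc by (simp add: field_simps)
    then show "z ^ ?n = (\<Sum>i<?n. -1 * (poly.coeff q i * inverse (poly.coeff q ?n)) * z ^ i)"
      by (simp add: sum_negf sum_distrib_left divide_inverse algebra_simps)
  qed
  then obtain u where u: "nash_like T u" "u x0 = z" by (rule nash_like_with_value)
  have "eval p (germ_of T u) \<in> carrier K" by (intro eval_in_carrier pK germ_in_carrier u)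
  moreover have "value_at (eval p (germ_of T u)) = 0"
    using value_at_eval[OF pK germ_in_carrier[OF u(1)]] u z by (simp add: value_germ q_def)
  ultimately show ?thesis using value_at_eq_0_iff germ_in_carrier[OF u(1)] by blast
qed

lemma real_closed_K: "real_closed_field K (nash_pos T)"
  unfolding real_closed_field_def using ordered_field_K nash_pos_sqrt odd_degree_root by blast

section \<open>Partial derivatives of germs and the derivation\<close>

lemma partial_germ:
  assumes "t \<in> T" shows "nash_partial T t (germ_of T u) = germ_of T (slice_deriv t u)"
proof -
  have "germ_of T (\<lambda>x. deriv (\<lambda>s. f (x(t := s))) (x t)) = germ_of T (slice_deriv t u)"
    if "f \<in> germ_of T u" for f
    using slice_deriv_cong[OF T_nonempty indep assms, of f u] that
    unfolding germ_of_eq_iff by (simp add: germ_of_eq slice_deriv_def)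
  moreover have "u \<in> germ_of T u" by (simp add: germ_of_eq)
  ultimately show ?thesis unfolding nash_partial_def by blast
qed

lemma partial_closed: "t \<in> T \<Longrightarrow> a \<in> carrier K \<Longrightarrow> nash_partial T t a \<in> carrier K"
  by (auto elim!: carrierE simp: partial_germ
      intro!: germ_in_carrier nash_like_slice_deriv[OF T_nonempty indep])

text \<open>Representatives are differentiable in Lambda_t at all points near the base point, so the
  pointwise rules hold eventually, which is equality of germs.\<close>

lemma
  assumes t: "t \<in> T" and a: "a \<in> carrier K" and b: "b \<in> carrier K"
  shows partial_add: "nash_partial T t (a \<oplus>\<^bsub>K\<^esub> b) = nash_partial T t a \<oplus>\<^bsub>K\<^esub> nash_partial T t b"
    and partial_mult: "nash_partial T t (a \<otimes>\<^bsub>K\<^esub> b) =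
      (nash_partial T t a \<otimes>\<^bsub>K\<^esub> b) \<oplus>\<^bsub>K\<^esub> (a \<otimes>\<^bsub>K\<^esub> nash_partial T t b)"
proof -
  obtain u where u: "nash_like T u" "a = germ_of T u" using a by (rule carrierE)
  obtain v where v: "nash_like T v" "b = germ_of T v" using b by (rule carrierE)
  note sd = slice_differentiable_nash_like[OF T_nonempty indep _ t, unfolded slice_differentiable_def]
  have "\<forall>\<^sub>F x in F0. slice_deriv t (\<lambda>x. u x + v x) x = slice_deriv t u x + slice_deriv t v x"
    using sd[OF u(1)] sd[OF v(1)]
  proof eventually_elim
    case (elim x)
    from DERIV_imp_deriv[OF DERIV_add[OF elim]] show ?case unfolding slice_deriv_def by simp
  qed
  then show "nash_partial T t (a \<oplus>\<^bsub>K\<^esub> b) = nash_partial T t a \<oplus>\<^bsub>K\<^esub> nash_partial T t b"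
    by (simp add: u v germ_simps partial_germ[OF t] germ_of_eq_iff)
  have "\<forall>\<^sub>F x in F0. slice_deriv t (\<lambda>x. u x * v x) x = slice_deriv t u x * v x + u x * slice_deriv t v x"
    using sd[OF u(1)] sd[OF v(1)]
  proof eventually_elim
    case (elim x)
    from DERIV_imp_deriv[OF DERIV_mult[OF elim]] show ?case unfolding slice_deriv_def by (simp add: mult.commute)
  qed
  then show "nash_partial T t (a \<otimes>\<^bsub>K\<^esub> b) =
      (nash_partial T t a \<otimes>\<^bsub>K\<^esub> b) \<oplus>\<^bsub>K\<^esub> (a \<otimes>\<^bsub>K\<^esub> nash_partial T t b)"
    by (simp add: u v germ_simps partial_germ[OF t] germ_of_eq_iff)
qed

lemma finite_partial_support:
  assumes "a \<in> carrier K" shows "finite {t\<in>T. nash_partial T t a \<noteq> \<zero>\<^bsub>K\<^esub>}"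
proof -
  obtain u where u: "nash_like T u" "a = germ_of T u" using assms by (rule carrierE)
  obtain S where S: "finite S" "\<forall>t\<in>T - S. \<forall>\<^sub>F x in F0. slice_deriv t u x = 0"
    using finite_slice_deriv[OF T_nonempty indep u(1)] by blast
  have "nash_partial T t a = \<zero>\<^bsub>K\<^esub>" if "t \<in> T - S" for t
    using S(2) that by (simp add: u(2) partial_germ zero_germ germ_of_eq_iff)
  then have "{t\<in>T. nash_partial T t a \<noteq> \<zero>\<^bsub>K\<^esub>} \<subseteq> S" by blast
  then show ?thesis using S(1) finite_subset by blast
qed

text \<open>The index set in \<open>nash_delta\<close> varies with the element; enlarging it to any
  finite \<open>S\<close> that supports the partial derivatives makes different elements
  comparable.\<close>

lemma delta_eq_finsum:
  assumes g: "\<And>t. t \<in> T \<Longrightarrow> g t \<in> carrier K" and a: "a \<in> carrier K"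
    and S: "finite S" "S \<subseteq> T" "\<And>t. t \<in> T - S \<Longrightarrow> nash_partial T t a = \<zero>\<^bsub>K\<^esub>"
  shows "nash_delta T g a = (\<Oplus>\<^bsub>K\<^esub>t\<in>S. g t \<otimes>\<^bsub>K\<^esub> nash_partial T t a)"
  unfolding nash_delta_def
proof (rule add.finprod_mono_neutral_cong_left[OF S(1)])
  show "{t \<in> T. g t \<otimes>\<^bsub>K\<^esub> nash_partial T t a \<noteq> \<zero>\<^bsub>K\<^esub>} \<subseteq> S" using S(3) g by auto
qed (use S g a partial_closed in auto)

lemma derivation_delta:
  assumes g: "\<And>t. t \<in> T \<Longrightarrow> g t \<in> carrier K"
  shows "derivation K (nash_delta T g)"
  unfolding derivation_def
proof (intro conjI ballI)
  \<comment> \<open>By the sum and product rules, one finite set supports the partial derivatives of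
    \<open>a\<close>, \<open>b\<close>, their sum and their product.\<close>
  have delta: "\<exists>S. finite S \<and> S \<subseteq> T \<and> (\<forall>c\<in>{a, b, a \<oplus>\<^bsub>K\<^esub> b, a \<otimes>\<^bsub>K\<^esub> b}.
      nash_delta T g c = (\<Oplus>\<^bsub>K\<^esub>t\<in>S. g t \<otimes>\<^bsub>K\<^esub> nash_partial T t c))"
    if ab: "a \<in> carrier K" "b \<in> carrier K" for a b
  proof -
    let ?S = "{t\<in>T. nash_partial T t a \<noteq> \<zero>\<^bsub>K\<^esub>} \<union> {t\<in>T. nash_partial T t b \<noteq> \<zero>\<^bsub>K\<^esub>}"
    have S: "finite ?S" "?S \<subseteq> T" using finite_partial_support ab by auto
    have z: "nash_partial T t c = \<zero>\<^bsub>K\<^esub>"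
      if "c \<in> {a, b, a \<oplus>\<^bsub>K\<^esub> b, a \<otimes>\<^bsub>K\<^esub> b}" "t \<in> T - ?S" for c t
      using that ab partial_add[of t a b] partial_mult[of t a b] by auto
    have "nash_delta T g c = (\<Oplus>\<^bsub>K\<^esub>t\<in>?S. g t \<otimes>\<^bsub>K\<^esub> nash_partial T t c)"
      if c: "c \<in> {a, b, a \<oplus>\<^bsub>K\<^esub> b, a \<otimes>\<^bsub>K\<^esub> b}" for c
    proof (rule delta_eq_finsum[OF _ _ S z[OF c]])
      show "c \<in> carrier K" using c ab by blast
    qed (rule g)
    then show ?thesis by (intro exI[of _ ?S] conjI ballI S)
  qed
  show "nash_delta T g \<in> carrier K \<rightarrow> carrier K"
  proof
    fix a assume a: "a \<in> carrier K"
    obtain S where "S \<subseteq> T" "nash_delta T g a = (\<Oplus>\<^bsub>K\<^esub>t\<in>S. g t \<otimes>\<^bsub>K\<^esub> nash_partial T t a)"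
      using delta[OF a a] by auto
    then show "nash_delta T g a \<in> carrier K"
      using g partial_closed a by (auto intro!: finsum_closed)
  qed
  fix a b assume a: "a \<in> carrier K" and b: "b \<in> carrier K"
  obtain S where S: "finite S" "S \<subseteq> T" and d: "\<And>c. c \<in> {a, b, a \<oplus>\<^bsub>K\<^esub> b, a \<otimes>\<^bsub>K\<^esub> b} \<Longrightarrow>
      nash_delta T g c = (\<Oplus>\<^bsub>K\<^esub>t\<in>S. g t \<otimes>\<^bsub>K\<^esub> nash_partial T t c)"
    using delta[OF a b] by blast
  define ga where "ga t = g t \<otimes>\<^bsub>K\<^esub> nash_partial T t a" for t
  define gb where "gb t = g t \<otimes>\<^bsub>K\<^esub> nash_partial T t b" for t
  have gc: "ga \<in> S \<rightarrow> carrier K" "gb \<in> S \<rightarrow> carrier K"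
    using S(2) g partial_closed a b by (auto simp: ga_def gb_def)
  have da: "nash_delta T g a = (\<Oplus>\<^bsub>K\<^esub>t\<in>S. ga t)" and db: "nash_delta T g b = (\<Oplus>\<^bsub>K\<^esub>t\<in>S. gb t)"
    using d by (simp_all add: ga_def gb_def)
  have sum: "g t \<otimes>\<^bsub>K\<^esub> nash_partial T t (a \<oplus>\<^bsub>K\<^esub> b) = ga t \<oplus>\<^bsub>K\<^esub> gb t"
    and product: "g t \<otimes>\<^bsub>K\<^esub> nash_partial T t (a \<otimes>\<^bsub>K\<^esub> b) = ga t \<otimes>\<^bsub>K\<^esub> b \<oplus>\<^bsub>K\<^esub> a \<otimes>\<^bsub>K\<^esub> gb t"
    if "t \<in> S" for t
  proof -
    have t: "t \<in> T" using that S(2) by blast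
    note c = g[OF t] partial_closed[OF t a] partial_closed[OF t b] a b
    show "g t \<otimes>\<^bsub>K\<^esub> nash_partial T t (a \<oplus>\<^bsub>K\<^esub> b) = ga t \<oplus>\<^bsub>K\<^esub> gb t"
      using c by (simp add: ga_def gb_def partial_add[OF t] r_distr)
    show "g t \<otimes>\<^bsub>K\<^esub> nash_partial T t (a \<otimes>\<^bsub>K\<^esub> b) = ga t \<otimes>\<^bsub>K\<^esub> b \<oplus>\<^bsub>K\<^esub> a \<otimes>\<^bsub>K\<^esub> gb t"
      using c m_lcomm[of a "g t" "nash_partial T t b"]
      by (simp add: ga_def gb_def partial_mult[OF t] r_distr m_assoc)
  qed
  have "nash_delta T g (a \<oplus>\<^bsub>K\<^esub> b) = (\<Oplus>\<^bsub>K\<^esub>t\<in>S. ga t \<oplus>\<^bsub>K\<^esub> gb t)"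
    unfolding d[of "a \<oplus>\<^bsub>K\<^esub> b", simplified]
    by (rule finsum_cong'[OF refl]) (use gc sum in auto)
  then show "nash_delta T g (a \<oplus>\<^bsub>K\<^esub> b) = nash_delta T g a \<oplus>\<^bsub>K\<^esub> nash_delta T g b"
    by (simp add: da db finsum_addf[OF gc])
  have "nash_delta T g (a \<otimes>\<^bsub>K\<^esub> b) = (\<Oplus>\<^bsub>K\<^esub>t\<in>S. ga t \<otimes>\<^bsub>K\<^esub> b \<oplus>\<^bsub>K\<^esub> a \<otimes>\<^bsub>K\<^esub> gb t)"
    unfolding d[of "a \<otimes>\<^bsub>K\<^esub> b", simplified]
    by (rule finsum_cong'[OF refl]) (use gc a b product in auto)
  also have "\<dots> = (\<Oplus>\<^bsub>K\<^esub>t\<in>S. ga t \<otimes>\<^bsub>K\<^esub> b) \<oplus>\<^bsub>K\<^esub> (\<Oplus>\<^bsub>K\<^esub>t\<in>S. a \<otimes>\<^bsub>K\<^esub> gb t)"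
    by (rule finsum_addf) (use gc a b in auto)
  also have "\<dots> = (\<Oplus>\<^bsub>K\<^esub>t\<in>S. ga t) \<otimes>\<^bsub>K\<^esub> b \<oplus>\<^bsub>K\<^esub> a \<otimes>\<^bsub>K\<^esub> (\<Oplus>\<^bsub>K\<^esub>t\<in>S. gb t)"
    using finsum_ldistr[OF S(1) b gc(1)] finsum_rdistr[OF S(1) a gc(2)] by simp
  finally show "nash_delta T g (a \<otimes>\<^bsub>K\<^esub> b) =
      (nash_delta T g a \<otimes>\<^bsub>K\<^esub> b) \<oplus>\<^bsub>K\<^esub> (a \<otimes>\<^bsub>K\<^esub> nash_delta T g b)"
    by (simp add: da db)
qed

lemma nash_const_closed: "nash_const T c \<in> carrier K"
  unfolding nash_const_def by (intro germ_in_carrier nash_like_intros)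

lemma nash_var_closed: "t \<in> T \<Longrightarrow> nash_var T t \<in> carrier K"
  unfolding nash_var_def by (intro germ_in_carrier nash_like_intros)

lemma nash_const_mult: "nash_const T c \<otimes>\<^bsub>K\<^esub> nash_const T d = nash_const T (c * d)"
  by (simp add: nash_const_def mult_germ of_rat_mult)

lemma nash_const_0: "nash_const T 0 = \<zero>\<^bsub>K\<^esub>"
  by (simp add: nash_const_def zero_germ)

lemma nash_const_1: "nash_const T 1 = \<one>\<^bsub>K\<^esub>"
  by (simp add: nash_const_def one_germ)

lemma delta_scaled_var:
  assumes g: "\<And>t. t \<in> T \<Longrightarrow> g t \<in> carrier K" and t: "t \<in> T"
  shows "nash_delta T g (nash_const T c \<otimes>\<^bsub>K\<^esub> nash_var T t) = g t \<otimes>\<^bsub>K\<^esub> nash_const T c"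
proof -
  have sd: "slice_deriv t' (\<lambda>x. of_rat c * x t) = (\<lambda>_. of_rat (if t' = t then c else 0))" for t'
    by (auto simp: slice_deriv_def fun_eq_iff intro!: DERIV_imp_deriv derivative_eq_intros)
  have cv: "nash_const T c \<otimes>\<^bsub>K\<^esub> nash_var T t = germ_of T (\<lambda>x. of_rat c * x t)"
    by (simp add: nash_const_def nash_var_def mult_germ)
  have p: "nash_partial T t' (nash_const T c \<otimes>\<^bsub>K\<^esub> nash_var T t) = nash_const T (if t' = t then c else 0)"
    if "t' \<in> T" for t'
    unfolding cv unfolding partial_germ[OF that] sd unfolding nash_const_def by (rule refl)
  have "nash_delta T g (nash_const T c \<otimes>\<^bsub>K\<^esub> nash_var T t) =
      (\<Oplus>\<^bsub>K\<^esub>t'\<in>{t}. g t' \<otimes>\<^bsub>K\<^esub> nash_partial T t' (nash_const T c \<otimes>\<^bsub>K\<^esub> nash_var T t))"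
    by (rule delta_eq_finsum[OF g])
      (use t nash_const_closed nash_var_closed p nash_const_0 in auto)
  then show ?thesis using g t p[OF t] nash_const_closed by simp
qed

end

section \<open>Differential closedness\<close>

lemma (in cring) mpolys_coeff_closed: "p \<in> mpolys R \<Longrightarrow> p m \<in> carrier R"
  using indexed_pset_in_carrier[of "carrier R" p UNIV] carrier_coeffE unfolding mpolys_def by blast

lemma (in cring) finite_mpoly_vars:
  assumes "p \<in> mpolys R" shows "finite (mpoly_vars R p)"
  using assms unfolding mpolys_def
proof (induction rule: indexed_pset.induct)
  case (indexed_const k)
  show ?case by (simp add: mpoly_vars_def indexed_const_index_free)
next
  case (indexed_padd P Q)
  have "mpoly_vars R (indexed_padd P Q) \<subseteq> mpoly_vars R P \<union> mpoly_vars R Q"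
    by (auto simp: mpoly_vars_def intro: indexed_padd_index_free)
  then show ?case using indexed_padd.IH finite_subset by blast
next
  case (indexed_pmult P i)
  have "mpoly_vars R (indexed_pmult P i) \<subseteq> insert i (mpoly_vars R P)"
    by (auto simp: mpoly_vars_def intro: indexed_pmult_index_free)
  then show ?case using indexed_pmult.IH finite_subset by blast
qed

lemma (in cring) mpoly_vars_le_ord:
  assumes "p \<in> mpolys R" "mpoly_ord R p \<le> int n" "i \<in> mpoly_vars R p"
  shows "i \<le> n"
  using assms Max_ge[OF finite_mpoly_vars[OF assms(1)] assms(3)]
  by (auto simp: mpoly_ord_def split: if_splits)

text \<open>Entries of \<open>nth xs\<close> beyond the end of the list are unspecified and need not
  lie in the carrier, so agreement and membership are asked only for variables that occur.\<close>

lemma (in cring) mpoly_eval_cong: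
  assumes p: "p \<in> mpolys R" and ab: "\<And>i. i \<in> mpoly_vars R p \<Longrightarrow> a i = b i \<and> b i \<in> carrier R"
  shows "mpoly_eval R p a = mpoly_eval R p b"
  unfolding mpoly_eval_def
proof (rule finsum_cong'[OF refl])
  have b: "b i \<in> carrier R" "a i = b i" if "p m \<noteq> \<zero>" "i \<in># m" for m i
    using ab[of i] that by (auto simp: mpoly_vars_def index_free_def)
  show "(\<lambda>m. p m \<otimes> (\<Otimes>i\<in>set_mset m. b i [^] count m i)) \<in> {m. p m \<noteq> \<zero>} \<rightarrow> carrier R"
    using b mpolys_coeff_closed[OF p] by (auto intro!: finprod_closed)
  fix m assume "m \<in> {m. p m \<noteq> \<zero>}"
  then have m: "p m \<noteq> \<zero>" by simp
  have "(\<Otimes>i\<in>set_mset m. a i [^] count m i) = (\<Otimes>i\<in>set_mset m. b i [^] count m i)"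
    by (rule finprod_cong'[OF refl]) (use b[OF m] in auto)
  then show "p m \<otimes> (\<Otimes>i\<in>set_mset m. a i [^] count m i) = p m \<otimes> (\<Otimes>i\<in>set_mset m. b i [^] count m i)"
    by simp
qed

lemma (in cring) diff_eval_eq:
  assumes "q \<in> mpolys R" "mpoly_ord R q \<le> int n" "length xs = n + 1" "set xs \<subseteq> carrier R"
    and "\<And>i. i \<le> n \<Longrightarrow> (\<delta> ^^ i) a = xs ! i"
  shows "diff_eval R \<delta> q a = mpoly_eval R q (nth xs)"
  unfolding diff_eval_def
proof (rule mpoly_eval_cong[OF assms(1)])
  fix i assume "i \<in> mpoly_vars R q"
  then have "i \<le> n" by (rule mpoly_vars_le_ord[OF assms(1,2)])
  then show "(\<delta> ^^ i) a = xs ! i \<and> xs ! i \<in> carrier R" using assms(3-5) nth_mem[of i xs] by auto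
qed

lemma (in domain) mpoly_eval_indexed_const_one: "mpoly_eval R (indexed_const \<one>) a = \<one>"
proof -
  have "{m. indexed_const \<one> m \<noteq> \<zero>} = {{#}}" by (auto simp: indexed_const_def)
  then show ?thesis by (simp add: mpoly_eval_def indexed_const_def)
qed

section \<open>Solving a differential system by the constructed family\<close>

locale nash_construction = nash_germs +
  fixes Tz :: "tuple \<Rightarrow> real set" and tz :: "tuple \<Rightarrow> nat \<Rightarrow> real" and rz :: "tuple \<Rightarrow> nat \<Rightarrow> rat"
    and fz :: "tuple \<Rightarrow> germ" and h g :: "real \<Rightarrow> germ"
  assumes partition: "partition_family T Tz"
    and admissible: "admissible_choices T Tz tz rz fz"
    and constructed: "constructed_family T Tz tz rz fz h g"
begin

definition chosen_point :: "tuple \<Rightarrow> germ list"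
  where "chosen_point z =
    map (\<lambda>i. nash_const T (rz z i) \<otimes>\<^bsub>K\<^esub> nash_var T (tz z i)) [0..<tuple_deg z] @ [fz z]"

lemma tuple_deg_pos: "z \<in> nash_tuples T \<Longrightarrow> tuple_deg z \<ge> 1"
  by (auto simp: nash_tuples_def tuple_deg_def)

lemma choices:
  assumes "z \<in> nash_tuples T"
  shows "i < tuple_deg z \<Longrightarrow> tz z i \<in> T" "i < tuple_deg z \<Longrightarrow> rz z i \<noteq> 0" "fz z \<in> carrier K"
    "mpoly_eval K (fst z) (nth (chosen_point z)) = \<zero>\<^bsub>K\<^esub>"
    "Q \<in> set (fst (snd z)) \<Longrightarrow> mpoly_eval K Q (nth (chosen_point z)) \<in> nash_pos T"
proof -
  obtain P Qs fs where z: "z = (P, Qs, fs)" by (cases z)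
  have "case z of (P, Qs, fs) \<Rightarrow> tz z ` {..<tuple_deg z} \<subseteq> const_params T P \<and>
      (\<forall>i<tuple_deg z. rz z i \<noteq> 0) \<and> fz z \<in> carrier K \<and>
      mpoly_eval K P (nth (chosen_point z)) = \<zero>\<^bsub>K\<^esub> \<and>
      (\<forall>Q\<in>set Qs. mpoly_eval K Q (nth (chosen_point z)) \<in> nash_pos T)"
    using admissible assms unfolding admissible_choices_def chosen_point_def Let_def by fastforce
  then show "i < tuple_deg z \<Longrightarrow> tz z i \<in> T" "i < tuple_deg z \<Longrightarrow> rz z i \<noteq> 0" "fz z \<in> carrier K"
    "mpoly_eval K (fst z) (nth (chosen_point z)) = \<zero>\<^bsub>K\<^esub>"
    "Q \<in> set (fst (snd z)) \<Longrightarrow> mpoly_eval K Q (nth (chosen_point z)) \<in> nash_pos T"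
    by (auto simp: z const_params_def)
qed

lemma g_tz:
  assumes "z \<in> nash_tuples T"
  shows "i + 2 \<le> tuple_deg z \<Longrightarrow>
      g (tz z i) = nash_const T (rz z (i + 1) / rz z i) \<otimes>\<^bsub>K\<^esub> nash_var T (tz z (i + 1))"
    "g (tz z (tuple_deg z - 1)) = nash_const T (1 / rz z (tuple_deg z - 1)) \<otimes>\<^bsub>K\<^esub> fz z"
    "t \<in> Tz z - tz z ` {..<tuple_deg z} \<Longrightarrow> g t \<in> carrier K"
  using constructed assms unfolding constructed_family_def by (auto simp: Let_def)

lemma g_closed:
  assumes "t \<in> T" shows "g t \<in> carrier K"
proof -
  obtain z where z: "z \<in> nash_tuples T" "t \<in> Tz z"
    using assms partition unfolding partition_family_def by blast
  show ?thesis
  proof (cases "t \<in> tz z ` {..<tuple_deg z}")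
    case True
    then obtain i where i: "i < tuple_deg z" "t = tz z i" by blast
    consider "i + 2 \<le> tuple_deg z" | "i = tuple_deg z - 1" using i by linarith
    then show ?thesis
    proof cases
      case 1
      then show ?thesis
        using g_tz(1)[OF z(1) 1] choices(1)[OF z(1), of "i + 1"] i nash_const_closed nash_var_closed by simp
    next
      case 2
      then show ?thesis using g_tz(2)[OF z(1)] choices(3)[OF z(1)] i nash_const_closed by simp
    qed
  qed (use z g_tz(3) in blast)
qed

text \<open>The quotients in \<open>g\<close> are designed for this: applying the derivation to r_i
  Lambda_(t_i) gives r_i g_(t_i), in which r_i cancels and r_(i+1) Lambda_(t_(i+1)) remains, or
  \<open>fz z\<close> at the last index.\<close>

lemma delta_iterates:
  assumes z: "z \<in> nash_tuples T" and "i \<le> tuple_deg z"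
  shows "(nash_delta T g ^^ i) (nash_const T (rz z 0) \<otimes>\<^bsub>K\<^esub> nash_var T (tz z 0)) = chosen_point z ! i"
  using assms(2)
proof (induction i)
  case 0
  show ?case using tuple_deg_pos[OF z] by (simp add: chosen_point_def nth_append)
next
  case (Suc i)
  let ?c = "\<lambda>j. nash_const T (rz z j) \<otimes>\<^bsub>K\<^esub> nash_var T (tz z j)"
  have i: "i < tuple_deg z" using Suc.prems by simp
  have "(nash_delta T g ^^ Suc i) (?c 0) = nash_delta T g (?c i)"
    using Suc i by (simp add: chosen_point_def nth_append)
  also have "\<dots> = g (tz z i) \<otimes>\<^bsub>K\<^esub> nash_const T (rz z i)"
    by (rule delta_scaled_var[OF g_closed choices(1)[OF z i]])
  also have "\<dots> = chosen_point z ! Suc i"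
  proof (cases "i + 2 \<le> tuple_deg z")
    case True
    then have v: "nash_var T (tz z (i + 1)) \<in> carrier K"
      using choices(1)[OF z, of "i + 1"] nash_var_closed by simp
    have "g (tz z i) \<otimes>\<^bsub>K\<^esub> nash_const T (rz z i) =
        (nash_const T (rz z (i + 1) / rz z i) \<otimes>\<^bsub>K\<^esub> nash_const T (rz z i)) \<otimes>\<^bsub>K\<^esub> nash_var T (tz z (i + 1))"
      unfolding g_tz(1)[OF z True] using v nash_const_closed
      by (simp add: m_assoc m_comm[of "nash_var T (tz z (Suc i))" "nash_const T (rz z i)"])
    then show ?thesis
      using True choices(2)[OF z i] by (simp add: nash_const_mult chosen_point_def nth_append)
  next
    case False
    then have k: "i = tuple_deg z - 1" using i by linarith
    have "g (tz z i) \<otimes>\<^bsub>K\<^esub> nash_const T (rz z i) =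
        (nash_const T (1 / rz z i) \<otimes>\<^bsub>K\<^esub> nash_const T (rz z i)) \<otimes>\<^bsub>K\<^esub> fz z"
      using g_tz(2)[OF z] choices(3)[OF z] nash_const_closed
      by (simp add: k m_assoc m_comm[of "fz z" "nash_const T _"])
    moreover have "Suc i = tuple_deg z" using k i by linarith
    ultimately show ?thesis
      using choices(2)[OF z i] choices(3)[OF z]
      by (simp add: nash_const_mult nash_const_1 chosen_point_def nth_append)
  qed
  finally show ?case .
qed

lemma ordered_diff_closed_K: "ordered_diff_closed_field K (nash_pos T) (nash_delta T g)"
  unfolding ordered_diff_closed_field_def
proof (intro conjI allI impI real_closed_K derivation_delta g_closed; (elim conjE)?)
  fix p qs n xs
  assume p: "p \<in> mpolys K" and qs: "set qs \<subseteq> mpolys K"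
    and ordp: "mpoly_ord K p = int n" and ordq: "\<forall>q\<in>set qs. mpoly_ord K q \<le> int n"
    and len: "length xs = n + 1" and xs: "set xs \<subseteq> carrier K"
    and root: "mpoly_eval K p (nth xs) = \<zero>\<^bsub>K\<^esub>"
    and simple: "mpoly_eval K (mpoly_deriv K n p) (nth xs) \<noteq> \<zero>\<^bsub>K\<^esub>"
    and pos: "\<forall>q\<in>set qs. mpoly_eval K q (nth xs) \<in> nash_pos T"
  show "\<exists>a\<in>carrier K. diff_eval K (nash_delta T g) p a = \<zero>\<^bsub>K\<^esub> \<and>
      (\<forall>q\<in>set qs. diff_eval K (nash_delta T g) q a \<in> nash_pos T)"
  proof (cases n)
    case 0
    \<comment> \<open>Order 0 has no tuple, since tuples have degree at least 1. No derivative
      occurs in the system, so the given a_0 is itself a solution.\<close>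
    have it: "(nash_delta T g ^^ i) (xs ! 0) = xs ! i" if "i \<le> 0" for i using that by simp
    have "diff_eval K (nash_delta T g) q (xs ! 0) = mpoly_eval K q (nth xs)" if "q \<in> insert p (set qs)" for q
      by (rule diff_eval_eq[of q 0, OF _ _ _ xs it]) (use that p qs ordp ordq len 0 in auto)
    moreover have "xs ! 0 \<in> carrier K" using xs len by (simp add: subset_eq)
    ultimately show ?thesis using root pos by (intro bexI[of _ "xs ! 0"]) auto
  next
    case (Suc n')
    \<comment> \<open>The construction requires at least one inequality; the constant 1 supplies it.\<close>
    define z where "z = (p, indexed_const \<one>\<^bsub>K\<^esub> # qs, xs)"
    have deg: "tuple_deg z = n" using len by (simp add: z_def tuple_deg_def)
    have zero_notin: "\<zero>\<^bsub>K\<^esub> \<notin> nash_pos T" using ordered_field_K by (simp add: ordered_field_def)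
    have one_pos: "\<one>\<^bsub>K\<^esub> \<in> nash_pos T"
      using nash_pos_iff[OF nash_like_1[OF T_nonempty]] by (simp add: one_germ)
    have one: "indexed_const \<one>\<^bsub>K\<^esub> \<in> mpolys K" "mpoly_ord K (indexed_const \<one>\<^bsub>K\<^esub>) \<le> int n"
      by (auto simp: mpolys_def mpoly_ord_def mpoly_vars_def indexed_const_index_free
          intro: indexed_pset.indexed_const)
    have posQ: "mpoly_eval K Q (nth xs) \<in> nash_pos T" if "Q \<in> set (indexed_const \<one>\<^bsub>K\<^esub> # qs)" for Q
      using that pos one_pos mpoly_eval_indexed_const_one by auto
    have ordQ: "mpoly_ord K Q \<le> int n" if "Q \<in> set (indexed_const \<one>\<^bsub>K\<^esub> # qs)" for Q
      using that ordq one by auto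
    have alphap: "mpoly_alpha K p = ereal (real n)"
    proof -
      have "mpoly_vars K p \<noteq> {}" using ordp by (auto simp: mpoly_ord_def)
      then have "\<not> (\<forall>m. p m = \<zero>\<^bsub>K\<^esub>)" by (auto simp: mpoly_vars_def index_free_def)
      then show ?thesis by (simp add: mpoly_alpha_def ordp)
    qed
    have alphaQ: "mpoly_alpha K Q \<le> ereal (real n) \<and> -1 \<le> mpoly_alpha K Q"
      if "Q \<in> set (indexed_const \<one>\<^bsub>K\<^esub> # qs)" for Q
    proof -
      \<comment> \<open>\<open>mpoly_alpha\<close> is -\<infinity> at the zero polynomial, which
        tuples exclude; a polynomial with a positive value is not zero.\<close>
      have nz: "\<not> (\<forall>m. Q m = \<zero>\<^bsub>K\<^esub>)"
      proof
        assume "\<forall>m. Q m = \<zero>\<^bsub>K\<^esub>"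
        then have "mpoly_eval K Q (nth xs) = \<zero>\<^bsub>K\<^esub>" by (simp add: mpoly_eval_def)
        then show False using posQ[OF that] zero_notin by simp
      qed
      have "-1 \<le> mpoly_ord K Q" by (simp add: mpoly_ord_def)
      then have "ereal (-1) \<le> mpoly_alpha K Q" using nz by (simp add: mpoly_alpha_def)
      moreover have "real_of_int (mpoly_ord K Q) \<le> real n" using ordQ[OF that] by linarith
      then have "mpoly_alpha K Q \<le> ereal (real n)" using nz by (simp add: mpoly_alpha_def)
      ultimately show ?thesis by (simp add: one_ereal_def)
    qed
    have z: "z \<in> nash_tuples T"
      unfolding nash_tuples_def z_def
      by (rule CollectI, rule exI[of _ p], rule exI[of _ "indexed_const \<one>\<^bsub>K\<^esub> # qs"], rule exI[of _ xs],
          rule exI[of _ n], intro conjI ballI)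
        (use Suc len p qs one xs alphap alphaQ root simple posQ in auto)
    have len': "length (chosen_point z) = n + 1" by (simp add: chosen_point_def deg)
    have carrier': "set (chosen_point z) \<subseteq> carrier K"
      using choices(1,3)[OF z] nash_const_closed nash_var_closed by (auto simp: chosen_point_def)
    let ?a = "nash_const T (rz z 0) \<otimes>\<^bsub>K\<^esub> nash_var T (tz z 0)"
    have eval: "diff_eval K (nash_delta T g) q ?a = mpoly_eval K q (nth (chosen_point z))"
      if "q \<in> insert p (set qs)" for q
      by (rule diff_eval_eq[OF _ _ len' carrier' delta_iterates[OF z]])
        (use that p qs ordp ordq deg in auto)
    have "?a \<in> carrier K" using choices(1)[OF z, of 0] deg Suc nash_const_closed nash_var_closed by simp
    moreover have "diff_eval K (nash_delta T g) p ?a = \<zero>\<^bsub>K\<^esub>"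
      using eval[of p] choices(4)[OF z] by (simp add: z_def)
    moreover have "diff_eval K (nash_delta T g) q ?a \<in> nash_pos T" if "q \<in> set qs" for q
      using eval[of q] choices(5)[OF z, of q] that by (simp add: z_def)
    ultimately show ?thesis by blast
  qed
qed

end

theorem theorem8:
  fixes T :: "real set"
    and Tz :: "tuple \<Rightarrow> real set"
    and tz :: "tuple \<Rightarrow> nat \<Rightarrow> real"
    and rz :: "tuple \<Rightarrow> nat \<Rightarrow> rat"
    and fz :: "tuple \<Rightarrow> germ"
    and h g :: "real \<Rightarrow> germ"
  assumes "infinite T"
    and "algebraically_independent T"
    and "partition_family T Tz"
    and "admissible_choices T Tz tz rz fz"
    and "constructed_family T Tz tz rz fz h g"
  shows "ordered_diff_closed_field (nash_field T) (nash_pos T) (nash_delta T g)"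
proof -
  have "T \<noteq> {}" using assms(1) by auto
  interpret nash_construction T Tz tz rz fz h g
    by (unfold_locales) (fact \<open>T \<noteq> {}\<close> assms)+
  show ?thesis by (rule ordered_diff_closed_K)
qed

end
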